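(* Let $f:\mathbf{P}^2\to\mathbf{P}^2$ be an endomorphism of algebraic degree $d>1$ of the complex projective plane, and let $\mathcal{P}$ be an irreducible pencil of curves of degree $k\ge 1$ on $\mathbf{P}^2$, defined by $\pi:\mathbf{P}^2\dashrightarrow\mathbf{P}^1$. Suppose that $f$ leaves $\mathcal{P}$ invariant. Then one of the following two cases holds. (i) $\mathcal{P}$ is an elementary pencil, that is, the pencil of lines through a point of $\mathbf{P}^2$. In this case, in any homogeneous coordinates on $\mathbf{P}^2$ and $\mathbf{P}^1$ such that $\pi[x:y:z]=[x:y]$ (such coordinates exist), $f$ takes the form $f[x:y:z]=[P(x,y):Q(x,y):R(x,y,z)]$, where $P,Q,R$ are homogeneous polynomials of degree $d$, with $P$ and $Q$ depending only on $x,y$. (ii) $\mathcal{P}$ is a binomial pencil, that is, there are homogeneous coordinates on $\mathbf{P}^2$ and $\mathbf{P}^1$ such that $\pi[x:y:z]=[x^hy^{k-h}:z^k]$, where $h$ is an integer with $0<h<k$ and $\gcd(h,k)=1$. In this case, in such coordinates and after conjugation with an element of $\mathrm{PGL}(3,\mathbf{C})$ preserving $\mathcal{P}$, $f$ takes the form $$f[x:y:z]=[x^d:y^d:R]\quad\text{or}\quad f[x:y:z]=[y^d:x^d:R],$$ where $$R(x,y,z)=z^{d-kl}\prod_{i=1}^l\bigl(z^k+c_ix^hy^{k-h}\bigr)$$ for some integer $l$ with $0\le l\le d/k$ and some $c_1,\dots,c_l\in\mathbf{C}^*$.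
   Context: $\mathbf{P}^n$ denotes complex projective $n$-space. An endomorphism $f:\mathbf{P}^2\to\mathbf{P}^2$ of algebraic degree $d$ is a morphism given in homogeneous coordinates by three homogeneous polynomials of degree $d$ with no common zero other than the origin. A pencil $\mathcal{P}$ of curves of degree $k\ge1$ on $\mathbf{P}^2$ is defined by a rational map $\pi:\mathbf{P}^2\dashrightarrow\mathbf{P}^1$, $\pi[x:y:z]=[A(x,y,z):B(x,y,z)]$, where $A,B$ are linearly independent homogeneous polynomials of degree $k$ without common factor (so there is no base divisor). An element of $\mathcal{P}$ is the divisor of $sA+tB$ for some $[s:t]\in\mathbf{P}^1$; a curve in $\mathcal{P}$ is the (reduced) support of an element of $\mathcal{P}$. The pencil $\mathcal{P}$ is irreducible if the generic curve in $\mathcal{P}$ is irreducible. The endomorphism $f$ leaves the irreducible pencil $\mathcal{P}$ invariant if $f$ maps any curve in $\mathcal{P}$ onto a curve in $\mathcal{P}$ (possibly the same curve). An element of $\mathrm{PGL}(3,\mathbf{C})$ (an automorphism of $\mathbf{P}^2$) preserves $\mathcal{P}$ if it maps curves in $\mathcal{P}$ onto curves in $\mathcal{P}$. *)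

theory Defs
  imports "HOL-Analysis.Analysis" "HOL-Library.Poly_Mapping"
begin

section \<open>Complex projective space\<close>

definition proj_rel :: "complex ^ 'n \<Rightarrow> complex ^ 'n \<Rightarrow> bool" where
  "proj_rel u v \<longleftrightarrow> u \<noteq> 0 \<and> v \<noteq> 0 \<and> (\<exists>c. c \<noteq> 0 \<and> v = c *s u)"

lemma part_equivp_proj_rel: "part_equivp (proj_rel :: complex ^ 'n \<Rightarrow> _)"
proof (rule part_equivpI)
  have "(1 :: complex ^ 'n) \<noteq> 0"
    by simp
  then have "proj_rel (1 :: complex ^ 'n) 1"
    unfolding proj_rel_def by (auto intro!: exI[of _ 1])
  then show "\<exists>x. proj_rel (x :: complex ^ 'n) x" ..
  show "symp (proj_rel :: complex ^ 'n \<Rightarrow> _)"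
  proof (rule sympI)
    fix u v :: "complex ^ 'n"
    assume "proj_rel u v"
    then obtain c where "u \<noteq> 0" "v \<noteq> 0" "c \<noteq> 0" "v = c *s u"
      unfolding proj_rel_def by blast
    then show "proj_rel v u"
      unfolding proj_rel_def by (auto intro!: exI[of _ "inverse c"] simp: vector_smult_assoc)
  qed
  show "transp (proj_rel :: complex ^ 'n \<Rightarrow> _)"
    by (rule transpI) (auto simp: proj_rel_def vector_smult_assoc)
qed

text \<open>Complex projective space of dimension \<open>CARD('n) - 1\<close>: the partial relation is reflexive
  exactly on the nonzero vectors. \<open>abs_proj v\<close> is the point \<open>[v]\<close> and is only meaningful for
  \<open>v \<noteq> 0\<close>; \<open>rep_proj p\<close> is some (nonzero) vector of homogeneous coordinates of \<open>p\<close>.\<close>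

quotient_type (overloaded) 'n proj = "complex ^ 'n" / partial: proj_rel
  by (rule part_equivp_proj_rel)

definition proj_map :: "complex ^ 'n ^ 'n \<Rightarrow> 'n proj \<Rightarrow> 'n proj" where
  "proj_map M p = abs_proj (M *v rep_proj p)"

definition PGL :: "('n::finite proj \<Rightarrow> 'n proj) set" where
  "PGL = {proj_map M | M. invertible M}"

section \<open>Polynomials\<close>

type_synonym 'n mpoly = "('n \<Rightarrow>\<^sub>0 nat) \<Rightarrow>\<^sub>0 complex"

definition Const :: "complex \<Rightarrow> 'n mpoly" where
  "Const c = Poly_Mapping.single 0 c"

definition Var :: "'n \<Rightarrow> 'n mpoly" where
  "Var i = Poly_Mapping.single (Poly_Mapping.single i 1) 1"

definition eval :: "'n::finite mpoly \<Rightarrow> complex ^ 'n \<Rightarrow> complex" where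
  "eval F v = (\<Sum>m\<in>Poly_Mapping.keys F.
     Poly_Mapping.lookup F m * (\<Prod>i\<in>UNIV. (v $ i) ^ Poly_Mapping.lookup m i))"

definition homogeneous :: "nat \<Rightarrow> 'n::finite mpoly \<Rightarrow> bool" where
  "homogeneous d F \<longleftrightarrow> (\<forall>m\<in>Poly_Mapping.keys F. (\<Sum>i\<in>UNIV. Poly_Mapping.lookup m i) = d)"

definition vars :: "'n mpoly \<Rightarrow> 'n set" where
  "vars F = (\<Union>m\<in>Poly_Mapping.keys F. Poly_Mapping.keys m)"

definition no_common_factor :: "'n mpoly \<Rightarrow> 'n mpoly \<Rightarrow> bool" where
  "no_common_factor F G \<longleftrightarrow> (\<forall>D. D dvd F \<longrightarrow> D dvd G \<longrightarrow> D dvd 1)"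

section \<open>Zariski closed sets\<close>

definition zero_set :: "'n::finite mpoly set \<Rightarrow> 'n proj set" where
  "zero_set S = {p. \<forall>F\<in>S. eval F (rep_proj p) = 0}"

definition zariski_closed :: "'n::finite proj set \<Rightarrow> bool" where
  "zariski_closed Z \<longleftrightarrow> (\<exists>S. (\<forall>F\<in>S. \<exists>m. homogeneous m F) \<and> Z = zero_set S)"

definition irreducible_set :: "'n::finite proj set \<Rightarrow> bool" where
  "irreducible_set Z \<longleftrightarrow> Z \<noteq> {} \<and>
     (\<forall>Z1 Z2. zariski_closed Z1 \<longrightarrow> zariski_closed Z2 \<longrightarrow> Z = Z1 \<union> Z2 \<longrightarrow> Z = Z1 \<or> Z = Z2)"

section \<open>Endomorphisms\<close>

text \<open>\<open>F\<close> is the list of homogeneous polynomials of degree \<open>d\<close>, without common zero other than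
  the origin, defining the morphism \<open>f\<close>.\<close>

definition endo_form ::
    "nat \<Rightarrow> ('n::finite mpoly) ^ 'n \<Rightarrow> ('n proj \<Rightarrow> 'n proj) \<Rightarrow> bool" where
  "endo_form d F f \<longleftrightarrow>
     (\<forall>i. homogeneous d (F $ i)) \<and>
     (\<forall>v. (\<forall>i. eval (F $ i) v = 0) \<longrightarrow> v = 0) \<and>
     (\<forall>p. f p = abs_proj (\<chi> i. eval (F $ i) (rep_proj p)))"

definition endomorphism :: "nat \<Rightarrow> ('n::finite proj \<Rightarrow> 'n proj) \<Rightarrow> bool" where
  "endomorphism d f \<longleftrightarrow> (\<exists>F. endo_form d F f)"

section \<open>Pencils of plane curves\<close>

definition pencil_element :: "3 mpoly \<Rightarrow> 3 mpoly \<Rightarrow> complex ^ 2 \<Rightarrow> 3 mpoly" where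
  "pencil_element A B c = Const (c $ 1) * A + Const (c $ 2) * B"

definition pencil :: "nat \<Rightarrow> 3 mpoly \<Rightarrow> 3 mpoly \<Rightarrow> bool" where
  "pencil k A B \<longleftrightarrow> k \<ge> 1 \<and> homogeneous k A \<and> homogeneous k B \<and>
     (\<forall>c. pencil_element A B c = 0 \<longrightarrow> c = 0) \<and> no_common_factor A B"

text \<open>The rational map \<open>[A : B]\<close> as a partial map. When \<open>A\<close> and \<open>B\<close> have no common factor, its
  domain is the complement of the base locus \<open>A = B = 0\<close>, so two such rational maps are equal
  iff they are equal as partial maps.\<close>

definition pencil_map :: "3 mpoly \<Rightarrow> 3 mpoly \<Rightarrow> 3 proj \<rightharpoonup> 2 proj" where
  "pencil_map A B p =
     (let v = rep_proj p in
      if eval A v = 0 \<and> eval B v = 0 then None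
      else Some (abs_proj (vector [eval A v, eval B v])))"

definition pencil_curve :: "3 mpoly \<Rightarrow> 3 mpoly \<Rightarrow> complex ^ 2 \<Rightarrow> 3 proj set" where
  "pencil_curve A B c = zero_set {pencil_element A B c}"

definition pencil_curves :: "3 mpoly \<Rightarrow> 3 mpoly \<Rightarrow> 3 proj set set" where
  "pencil_curves A B = {pencil_curve A B c | c. c \<noteq> 0}"

text \<open>Generic means for all parameters in a nonempty Zariski open, i.e. cofinite, subset of the
  projective line.\<close>

definition irreducible_pencil :: "3 mpoly \<Rightarrow> 3 mpoly \<Rightarrow> bool" where
  "irreducible_pencil A B \<longleftrightarrow>
     finite {abs_proj c | c. c \<noteq> 0 \<and> \<not> irreducible_set (pencil_curve A B c)}"

text \<open>Used both for an endomorphism leaving the pencil invariant and for an automorphism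
  preserving it.\<close>

definition maps_pencil_to_itself ::
    "(3 proj \<Rightarrow> 3 proj) \<Rightarrow> 3 mpoly \<Rightarrow> 3 mpoly \<Rightarrow> bool" where
  "maps_pencil_to_itself f A B \<longleftrightarrow> (\<forall>C\<in>pencil_curves A B. f ` C \<in> pencil_curves A B)"

section \<open>Homogeneous coordinates and the two special pencils\<close>

text \<open>Homogeneous coordinates on the plane and on the line are given by \<open>\<phi> \<in> PGL\<close> and
  \<open>\<psi> \<in> PGL\<close>: the point \<open>p\<close> has coordinates \<open>\<phi> p\<close>.\<close>

definition in_coords :: "('n proj \<Rightarrow> 'n proj) \<Rightarrow> ('n proj \<Rightarrow> 'n proj) \<Rightarrow> 'n proj \<Rightarrow> 'n proj" where
  "in_coords \<phi> f = \<phi> \<circ> f \<circ> inv \<phi>"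

definition map_in_coords ::
    "(3 proj \<Rightarrow> 3 proj) \<Rightarrow> (2 proj \<Rightarrow> 2 proj) \<Rightarrow> (3 proj \<rightharpoonup> 2 proj) \<Rightarrow> 3 proj \<rightharpoonup> 2 proj" where
  "map_in_coords \<phi> \<psi> \<pi> = map_option \<psi> \<circ> \<pi> \<circ> inv \<phi>"

definition lines_through :: "3 proj \<Rightarrow> 3 proj set set" where
  "lines_through p = {zero_set {L} | L. homogeneous 1 L \<and> L \<noteq> 0 \<and> p \<in> zero_set {L}}"

text \<open>For \<open>k = 1\<close> every element of the pencil is a reduced line, so comparing supports amounts to
  comparing divisors.\<close>

definition elementary_pencil :: "nat \<Rightarrow> 3 mpoly \<Rightarrow> 3 mpoly \<Rightarrow> bool" where
  "elementary_pencil k A B \<longleftrightarrow> k = 1 \<and> (\<exists>p. pencil_curves A B = lines_through p)"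

definition elementary_coords ::
    "3 mpoly \<Rightarrow> 3 mpoly \<Rightarrow> (3 proj \<Rightarrow> 3 proj) \<Rightarrow> (2 proj \<Rightarrow> 2 proj) \<Rightarrow> bool" where
  "elementary_coords A B \<phi> \<psi> \<longleftrightarrow> \<phi> \<in> PGL \<and> \<psi> \<in> PGL \<and>
     map_in_coords \<phi> \<psi> (pencil_map A B) = pencil_map (Var 1) (Var 2)"

definition binomial_coords ::
    "nat \<Rightarrow> nat \<Rightarrow> 3 mpoly \<Rightarrow> 3 mpoly \<Rightarrow> (3 proj \<Rightarrow> 3 proj) \<Rightarrow> (2 proj \<Rightarrow> 2 proj) \<Rightarrow> bool" where
  "binomial_coords k h A B \<phi> \<psi> \<longleftrightarrow> \<phi> \<in> PGL \<and> \<psi> \<in> PGL \<and>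
     map_in_coords \<phi> \<psi> (pencil_map A B) = pencil_map (Var 1 ^ h * Var 2 ^ (k - h)) (Var 3 ^ k)"

definition binomial_pencil :: "nat \<Rightarrow> 3 mpoly \<Rightarrow> 3 mpoly \<Rightarrow> bool" where
  "binomial_pencil k A B \<longleftrightarrow>
     (\<exists>h \<phi> \<psi>. 0 < h \<and> h < k \<and> gcd h k = 1 \<and> binomial_coords k h A B \<phi> \<psi>)"

definition binomial_R :: "nat \<Rightarrow> nat \<Rightarrow> nat \<Rightarrow> nat \<Rightarrow> (nat \<Rightarrow> complex) \<Rightarrow> 3 mpoly" where
  "binomial_R d k h l c =
     Var 3 ^ (d - k * l) *
     (\<Prod>i=1..l. Var 3 ^ k + Const (c i) * Var 1 ^ h * Var 2 ^ (k - h))"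

end

theory Submission
  imports Defs
    "HOL-Computational_Algebra.Polynomial_Factorial"
    "HOL-Computational_Algebra.Field_as_Ring"
    "HOL-Computational_Algebra.Fundamental_Theorem_Algebra"
    "HOL-Computational_Algebra.Formal_Power_Series"
begin

text \<open>The pencil defines the 1-form \<open>A dB - B dA = D \<omega>\<close>, with \<open>\<omega>\<close> having coprime coefficients of
  degree \<open>n\<close>. Invariance gives \<open>F\<^sup>*\<omega> = K \<omega>\<close> for a form \<open>K\<close> of degree \<open>(d - 1) (n + 1)\<close>, and \<open>K\<close> divides
  the Jacobian of \<open>F\<close>, which is nonzero of degree \<open>3 (d - 1)\<close>; so \<open>n \<le> 2\<close>. If \<open>n = 1\<close>, then \<open>A\<close> and \<open>B\<close>
  are constant along some direction, and irreducibility forces a pencil of lines. If \<open>n = 2\<close>, then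
  \<open>\<omega>\<close> is the contraction of the volume form with the radial field and a linear field \<open>M\<close>, and
  \<open>K\<close> is the Jacobian up to a constant, so that \<open>M F = \<kappa> DF M + h F\<close>. The polynomial
  trajectories of a nilpotent part of \<open>M\<close> would be mapped by \<open>F\<close> to polynomial curves of too large a
  degree, so \<open>M\<close> is diagonalizable; \<open>A\<close> and \<open>B\<close> are then combinations of monomials of the same
  weight, and irreducibility leaves only two monomials. In binomial coordinates \<open>F\<close> permutes the
  weights of \<open>M\<close> affinely, which determines the monomials of its components.\<close>

section \<open>Polynomials in three variables as iterated polynomials\<close>

text \<open>Two facts in the overview would usually come from dimension theory: composition with F
  keeps a triple of forms free of common factors, and the Jacobian of F is not zero. Both rest on
  two statements proved by elimination: two plane curves always meet, so that F contracts no curve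
  to a point, and a prime ideal containing two coprime forms contains two independent linear forms.
  The degree of K comes from counting the form of the composed pencil twice. If A dB - B dA = D
  \<omega> with deg D = \<delta>, then \<delta> + n = 2k - 1, and the composed form, of degree 2dk -
  1, is (D o F) K \<omega>; hence deg K = (d - 1)(n + 1). K divides the Jacobian because the
  cofactor matrix, applied to the pullback relation, gives the Jacobian times \<omega> o F on one
  side and a multiple of K on the other, and \<omega> o F has no common factor. The degree of a
  polynomial trajectory is bounded by dimension three: a nilpotent chain has at most three nonzero
  vectors, while the image of a trajectory of degree r needs more than rd. Irreducibility enters
  only as the finiteness of the set of c for which A - cB splits into factors with distinct
  supports.\<close>

text \<open>This ring is a factorial domain by type class inference, unlike the type of Defs.\<close>

type_synonym p3 = "complex poly poly poly"

definition ev :: "p3 \<Rightarrow> complex ^ 3 \<Rightarrow> complex" where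
  "ev p v = poly (poly (poly p [:[:v $ 3:]:]) [:v $ 2:]) (v $ 1)"

definition c3 :: "complex \<Rightarrow> p3" where "c3 c = [:[:[:c:]:]:]"

definition X :: "3 \<Rightarrow> p3" where
  "X i = (if i = 1 then [:[:[:0, 1:]:]:] else if i = 2 then [:[:0, 1:]:] else [:0, 1:])"

lemma three_neq [simp]: "(1::3) \<noteq> 2" "(1::3) \<noteq> 3" "(2::3) \<noteq> 3" "(2::3) \<noteq> 1" "(3::3) \<noteq> 1" "(3::3) \<noteq> 2"
  by simp_all

lemma ev_add [simp]: "ev (p + q) v = ev p v + ev q v"
  and ev_mult [simp]: "ev (p * q) v = ev p v * ev q v"
  and ev_minus [simp]: "ev (- p) v = - ev p v"
  and ev_diff [simp]: "ev (p - q) v = ev p v - ev q v"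
  and ev_0 [simp]: "ev 0 v = 0"
  and ev_1 [simp]: "ev 1 v = 1"
  and ev_c3 [simp]: "ev (c3 c) v = c"
  and ev_power [simp]: "ev (p ^ n) v = ev p v ^ n"
  by (simp_all add: ev_def c3_def)

lemma ev_X [simp]: "ev (X i) v = v $ i"
  using exhaust_3[of i] by (auto simp: ev_def X_def)

lemma ev_sum [simp]: "ev (sum f A) v = (\<Sum>a\<in>A. ev (f a) v)"
  by (induction A rule: infinite_finite_induct) auto

lemma ev_prod [simp]: "ev (prod f A) v = (\<Prod>a\<in>A. ev (f a) v)"
  by (induction A rule: infinite_finite_induct) auto

lemma ev_of_nat [simp]: "ev (of_nat n) v = of_nat n"
  by (induction n) auto

text \<open>The coefficient domain and the injection are left general so that one count of roots
  serves each level of the nested polynomials, and later polynomials over \<open>p3\<close> tested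
  at constants.\<close>

lemma poly_nonroot:
  fixes p :: "'a::idom poly" and f :: "complex \<Rightarrow> 'a"
  assumes "p \<noteq> 0" "inj f" shows "\<exists>c. poly p (f c) \<noteq> 0"
proof (rule ccontr)
  assume "\<not> ?thesis"
  then have "range f \<subseteq> {x. poly p x = 0}" by auto
  then have "finite (range f)" using poly_roots_finite[OF assms(1)] finite_subset by blast
  then show False using assms(2) by (simp add: finite_image_iff infinite_UNIV_char_0)
qed

lemma ev_nonzero:
  assumes "p \<noteq> 0" shows "\<exists>v. ev p v \<noteq> 0"
proof -
  obtain z where z: "poly p [:[:z:]:] \<noteq> 0"
    using poly_nonroot[OF assms, of "\<lambda>z. [:[:z:]:]"] by (auto simp: inj_def)
  obtain y where y: "poly (poly p [:[:z:]:]) [:y:] \<noteq> 0"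
    using poly_nonroot[OF z, of "\<lambda>y. [:y:]"] by (auto simp: inj_def)
  obtain x where "poly (poly (poly p [:[:z:]:]) [:y:]) x \<noteq> 0"
    using poly_nonroot[OF y, of "\<lambda>x. x"] by (auto simp: inj_def)
  then have "ev p (vector [x, y, z]) \<noteq> 0" by (simp add: ev_def)
  then show ?thesis ..
qed

lemma p3_eqI: "(\<And>v. ev p v = ev q v) \<Longrightarrow> p = q"
  using ev_nonzero[of "p - q"] by auto

lemma c3_simps [simp]: "c3 0 = 0" "c3 1 = 1"
  by (simp_all add: c3_def one_pCons)

lemma c3_eq_iff [simp]: "c3 a = c3 b \<longleftrightarrow> a = b" "c3 a = 0 \<longleftrightarrow> a = 0"
  by (simp_all add: c3_def)

lemma c3_hom: "c3 (a + b) = c3 a + c3 b" "c3 (a * b) = c3 a * c3 b" "c3 (- a) = - c3 a"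
    "c3 (a - b) = c3 a - c3 b"
  by (simp_all add: c3_def)

text \<open>Constants and variables generate the ring, so an operation that exists on them and is
  compatible with sums and products exists everywhere. Substitution, partial derivatives, dilation
  and restriction to curves are all obtained in this way.\<close>

lemma p3_induct [case_names const var add mult]:
  assumes c: "\<And>c. P (c3 c)" and x: "\<And>i. P (X i)"
    and a: "\<And>p q. P p \<Longrightarrow> P q \<Longrightarrow> P (p + q)" and m: "\<And>p q. P p \<Longrightarrow> P q \<Longrightarrow> P (p * q)"
  shows "P p"
proof -
  have 1: "P [:[:q:]:]" for q
  proof (induction q)
    case 0 then show ?case using c[of 0] by simp
  next
    case (pCons a p)
    have "[:[:pCons a p:]:] = c3 a + X 1 * [:[:p:]:]" by (simp add: c3_def X_def)
    with pCons show ?case by (metis c x a m)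
  qed
  have 2: "P [:q:]" for q
  proof (induction q)
    case 0 then show ?case using c[of 0] by simp
  next
    case (pCons a p)
    have "[:pCons a p:] = [:[:a:]:] + X 2 * [:p:]" by (simp add: X_def)
    with pCons show ?case by (metis 1 x a m)
  qed
  show ?thesis
  proof (induction p)
    case 0 then show ?case using c[of 0] by simp
  next
    case (pCons a p)
    have "pCons a p = [:a:] + X 3 * p" by (simp add: X_def)
    with pCons show ?case by (metis 2 x a m)
  qed
qed

section \<open>Substitution of a triple of polynomials\<close>

definition evv :: "p3 ^ 3 \<Rightarrow> complex ^ 3 \<Rightarrow> complex ^ 3" where
  "evv F v = (\<chi> i. ev (F $ i) v)"

lemma evv_nth [simp]: "evv F v $ i = ev (F $ i) v"
  by (simp add: evv_def)

text \<open>The composite is chosen by its values, which determine a polynomial by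
  \<open>p3_eqI\<close>; identities about it are then checked pointwise.\<close>

definition cmp :: "p3 \<Rightarrow> p3 ^ 3 \<Rightarrow> p3" where
  "cmp p F = (SOME q. \<forall>v. ev q v = ev p (evv F v))"

lemma ev_cmp [simp]: "ev (cmp p F) v = ev p (evv F v)"
proof -
  have "\<exists>q. \<forall>v. ev q v = ev p (evv F v)"
  proof (induction p rule: p3_induct)
    case (const c) show ?case by (rule exI[of _ "c3 c"]) simp
  next
    case (var i) show ?case by (rule exI[of _ "F $ i"]) simp
  next
    case (add p q) then show ?case by (metis ev_add)
  next
    case (mult p q) then show ?case by (metis ev_mult)
  qed
  from someI_ex[OF this] show ?thesis unfolding cmp_def by blast
qed

lemma cmp_simps [simp]: "cmp (p + q) F = cmp p F + cmp q F" "cmp (p * q) F = cmp p F * cmp q F"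
    "cmp (- p) F = - cmp p F" "cmp (p - q) F = cmp p F - cmp q F" "cmp (c3 c) F = c3 c"
    "cmp (X i) F = F $ i" "cmp 0 F = 0" "cmp 1 F = 1"
  by (rule p3_eqI; simp)+

lemma cmp_X [simp]: "cmp p (\<chi> i. X i) = p"
  by (rule p3_eqI) (auto simp: evv_def)

lemma cmp_cmp: "cmp (cmp p F) G = cmp p (\<chi> i. cmp (F $ i) G)"
  by (rule p3_eqI) (auto simp: evv_def)

lemma cmp_dvd: "p dvd q \<Longrightarrow> cmp p F dvd cmp q F"
  by (auto simp: dvd_def)

lemma curve_poly: "\<exists>P::complex poly. \<forall>t. poly P t = ev p (\<chi> i. poly (w i) t)"
proof (induction p rule: p3_induct)
  case (const c) show ?case by (rule exI[of _ "[:c:]"]) simp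
next
  case (var i) show ?case by (rule exI[of _ "w i"]) simp
next
  case (add p q) then show ?case by (metis ev_add poly_add)
next
  case (mult p q) then show ?case by (metis ev_mult poly_mult)
qed

lemma line_poly: "\<exists>P::complex poly. \<forall>t. poly P t = ev p (t *s v + w)"
proof -
  have "t *s v + w = (\<chi> i. poly [:w $ i, v $ i:] t)" for t
    by (simp add: vec_eq_iff)
  then show ?thesis using curve_poly[of p "\<lambda>i. [:w $ i, v $ i:]"] by simp
qed

text \<open>The difference times \<open>t - a\<close> vanishes everywhere. This recovers the value
  at a point left out because of a division.\<close>

lemma poly_eq_off_point:
  fixes P Q :: "complex poly"
  assumes "\<And>t. t \<noteq> a \<Longrightarrow> poly P t = poly Q t" shows "P = Q"
proof -
  have "(P - Q) * [:- a, 1:] = 0"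
    using assms by (intro poly_eq_poly_eq_iff[THEN iffD1] ext) auto
  then show ?thesis by (auto simp del: mult_pCons_right)
qed

subsection \<open>Partial derivatives\<close>

text \<open>The partial derivatives are read off from the Frechet derivative. The algebraic rules
  are inherited from analysis, and the open mapping theorem applies to polynomials without further
  translation.\<close>

definition pds :: "p3 \<Rightarrow> 3 \<Rightarrow> p3" where
  "pds p = (SOME q. \<forall>v. (ev p has_derivative (\<lambda>h. \<Sum>i\<in>UNIV. ev (q i) v * h $ i)) (at v))"

abbreviation pd :: "3 \<Rightarrow> p3 \<Rightarrow> p3" where "pd i p \<equiv> pds p i"

lemma has_derivative_ev: "(ev p has_derivative (\<lambda>h. \<Sum>i\<in>UNIV. ev (pd i p) v * h $ i)) (at v)"
proof -
  have "\<exists>q. \<forall>v. (ev p has_derivative (\<lambda>h. \<Sum>i\<in>UNIV. ev (q i) v * h $ i)) (at v)"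
  proof (induction p rule: p3_induct)
    case (const c)
    show ?case by (rule exI[of _ "\<lambda>_. 0"]) (auto simp: has_derivative_const)
  next
    case (var i)
    have "(ev (X i) has_derivative (\<lambda>h. h $ i)) (at v)" for v
      by (auto intro!: bounded_linear_imp_has_derivative bounded_linear_vec_nth simp: ev_X[abs_def])
    moreover have "(\<Sum>j\<in>UNIV. ev (if j = i then 1 else 0) v * h $ j) = h $ i" for v h
      using exhaust_3[of i] by (auto simp: sum_3)
    ultimately show ?case by (intro exI[of _ "\<lambda>j. if j = i then 1 else 0"] allI) (simp only:)
  next
    case (add p q)
    then obtain p' q' where
      "(ev p has_derivative (\<lambda>h. \<Sum>i\<in>UNIV. ev (p' i) v * h $ i)) (at v)"
      "(ev q has_derivative (\<lambda>h. \<Sum>i\<in>UNIV. ev (q' i) v * h $ i)) (at v)" for v by blast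
    from has_derivative_add[OF this] show ?case
      by (intro exI[of _ "\<lambda>i. p' i + q' i"])
        (simp add: sum_3 algebra_simps ev_add[abs_def])
  next
    case (mult p q)
    then obtain p' q' where
      "(ev p has_derivative (\<lambda>h. \<Sum>i\<in>UNIV. ev (p' i) v * h $ i)) (at v)"
      "(ev q has_derivative (\<lambda>h. \<Sum>i\<in>UNIV. ev (q' i) v * h $ i)) (at v)" for v by blast
    from has_derivative_mult[OF this] show ?case
      by (intro exI[of _ "\<lambda>i. p' i * q + p * q' i"])
        (simp add: sum_3 algebra_simps ev_mult[abs_def])
  qed
  from someI_ex[OF this] show ?thesis unfolding pds_def by blast
qed

lemma pd_unique:
  assumes "\<And>v. (ev p has_derivative (\<lambda>h. \<Sum>i\<in>UNIV. ev (q i) v * h $ i)) (at v)"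
  shows "pd i p = q i"
proof (rule p3_eqI)
  fix v
  from has_derivative_unique[OF has_derivative_ev[of p v] assms[of v]]
  have "(\<Sum>j\<in>UNIV. ev (pd j p) v * axis i 1 $ j) = (\<Sum>j\<in>UNIV. ev (q j) v * axis i 1 $ j)"
    by meson
  then show "ev (pd i p) v = ev (q i) v"
    using exhaust_3[of i] by (auto simp: sum_3 axis_def)
qed

lemma pd_c3 [simp]: "pd i (c3 c) = 0"
  by (rule pd_unique[where q = "\<lambda>_. 0"]) (auto simp: ev_c3[abs_def])

lemma pd_X [simp]: "pd i (X j) = (if i = j then 1 else 0)"
proof (rule pd_unique[where q = "\<lambda>i. if i = j then 1 else 0"])
  fix v
  have "(\<Sum>k\<in>UNIV. ev (if k = j then 1 else 0) v * h $ k) = h $ j" for h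
    using exhaust_3[of j] by (auto simp: sum_3)
  then show "(ev (X j) has_derivative (\<lambda>h. \<Sum>i\<in>UNIV. ev (if i = j then 1 else 0) v * h $ i)) (at v)"
    by (auto intro!: bounded_linear_imp_has_derivative bounded_linear_vec_nth simp: ev_X[abs_def])
qed

lemma pd_add [simp]: "pd i (p + q) = pd i p + pd i q"
proof (rule pd_unique[where q = "\<lambda>i. pd i p + pd i q"])
  fix v
  from has_derivative_add[OF has_derivative_ev[of p v] has_derivative_ev[of q v]]
  show "(ev (p + q) has_derivative (\<lambda>h. \<Sum>i\<in>UNIV. ev (pd i p + pd i q) v * h $ i)) (at v)"
    by (simp add: sum_3 algebra_simps ev_add[abs_def])
qed

lemma pd_mult [simp]: "pd i (p * q) = pd i p * q + p * pd i q"
proof (rule pd_unique[where q = "\<lambda>i. pd i p * q + p * pd i q"])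
  fix v
  from has_derivative_mult[OF has_derivative_ev[of p v] has_derivative_ev[of q v]]
  show "(ev (p * q) has_derivative (\<lambda>h. \<Sum>i\<in>UNIV. ev (pd i p * q + p * pd i q) v * h $ i)) (at v)"
    by (simp add: sum_3 algebra_simps ev_mult[abs_def])
qed

lemma pd_0 [simp]: "pd i 0 = 0" and pd_1 [simp]: "pd i 1 = 0"
  using pd_c3[of 0] pd_c3[of 1] by simp_all

lemma pd_minus [simp]: "pd i (- p) = - pd i p"
  using pd_add[of p "- p" i] by (simp add: eq_neg_iff_add_eq_0 add.commute)

lemma pd_diff [simp]: "pd i (p - q) = pd i p - pd i q"
  using pd_add[of p "- q" i] by simp

lemma pd_cmp: "pd i (cmp p F) = (\<Sum>j\<in>UNIV. cmp (pd j p) F * pd i (F $ j))"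
proof (induction p rule: p3_induct)
  case (var k) then show ?case using exhaust_3[of k] by (auto simp: sum_3)
qed (auto simp: sum_3 algebra_simps)

subsection \<open>Homogeneous polynomials\<close>

text \<open>A functional equation instead of a condition on monomials, so that it passes directly
  through composition and evaluation. The zero polynomial has every degree, and \<open>t = 0\<close>
  with \<open>n = 0\<close> (where \<open>0 ^ 0 = 1\<close>) forces constancy.\<close>

definition hom :: "nat \<Rightarrow> p3 \<Rightarrow> bool" where
  "hom n p \<longleftrightarrow> (\<forall>t v. ev p (t *s v) = t ^ n * ev p v)"

lemma homI_nonzero:
  assumes "\<And>t v. t \<noteq> 0 \<Longrightarrow> ev p (t *s v) = t ^ n * ev p v"
  shows "hom n p"
  unfolding hom_def
proof (intro allI)
  fix t v
  obtain P where P: "\<And>t. poly P t = ev p (t *s v + 0)" using line_poly by blast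
  have "P = monom (ev p v) n"
    by (rule poly_eq_off_point[of 0]) (simp add: P assms poly_monom)
  then show "ev p (t *s v) = t ^ n * ev p v" using P[of t] by (simp add: poly_monom mult.commute)
qed

lemma hom_0 [simp]: "hom n 0" and hom_1 [simp]: "hom 0 1" and hom_c3 [simp]: "hom 0 (c3 c)"
  and hom_X [simp]: "hom 1 (X i)" "hom (Suc 0) (X i)"
  by (auto simp: hom_def)

lemma hom_add: "hom n p \<Longrightarrow> hom n q \<Longrightarrow> hom n (p + q)"
  and hom_diff: "hom n p \<Longrightarrow> hom n q \<Longrightarrow> hom n (p - q)"
  and hom_minus: "hom n p \<Longrightarrow> hom n (- p)"
  by (auto simp: hom_def algebra_simps)

lemma hom_mult: "hom n p \<Longrightarrow> hom m q \<Longrightarrow> hom (n + m) (p * q)"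
  by (auto simp: hom_def power_add)

lemma hom_mult': "hom n p \<Longrightarrow> hom m q \<Longrightarrow> k = n + m \<Longrightarrow> hom k (p * q)"
  using hom_mult by blast

lemma hom_c3_mult: "hom n p \<Longrightarrow> hom n (c3 c * p)"
  by (rule hom_mult'[where n = 0]) auto

lemma hom_power: "hom n p \<Longrightarrow> hom (n * m) (p ^ m)"
  by (auto simp: hom_def power_mult_distrib power_mult)

lemma hom_sum: "(\<And>a. a \<in> A \<Longrightarrow> hom n (f a)) \<Longrightarrow> hom n (sum f A)"
  by (induction A rule: infinite_finite_induct) (auto intro: hom_add)

lemma evv_hom: "\<forall>i. hom d (F $ i) \<Longrightarrow> evv F (t *s v) = t ^ d *s evv F v"
  by (auto simp: hom_def vec_eq_iff)

lemma hom_cmp: "hom n p \<Longrightarrow> \<forall>i. hom d (F $ i) \<Longrightarrow> hom (d * n) (cmp p F)"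
  unfolding hom_def[of n p] hom_def[of "d * n" "cmp p F"] by (simp add: evv_hom power_mult)

lemma hom_unique: "hom n p \<Longrightarrow> hom m p \<Longrightarrow> p \<noteq> 0 \<Longrightarrow> n = m"
proof -
  assume *: "hom n p" "hom m p" "p \<noteq> 0"
  then obtain v where "ev p v \<noteq> 0" using ev_nonzero by blast
  with *(1,2) have "(2::complex) ^ n = 2 ^ m" unfolding hom_def by (metis mult_cancel_right)
  then have "(2::nat) ^ n = 2 ^ m" by (metis of_nat_eq_iff of_nat_numeral of_nat_power)
  then show ?thesis by simp
qed

lemma hom_0_const: "hom 0 p \<Longrightarrow> p = c3 (ev p 0)"
proof (rule p3_eqI)
  fix v assume "hom 0 p"
  then have "ev p (0 *s v) = 0 ^ 0 * ev p v" unfolding hom_def by blast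
  then show "ev p v = ev (c3 (ev p 0)) v" by simp
qed

lemma hom_at_0: "hom n p \<Longrightarrow> n > 0 \<Longrightarrow> ev p 0 = 0"
  unfolding hom_def by (metis mult_zero_left power_0_left vector_smult_lzero not_gr0)

lemma hom_pd: "hom n p \<Longrightarrow> hom (n - 1) (pd i p)"
proof (rule homI_nonzero)
  fix t v assume h: "hom n p" and t: "t \<noteq> (0::complex)"
  have "cmp p (\<chi> i. c3 t * X i) = c3 (t ^ n) * p"
    using h by (intro p3_eqI) (auto simp: hom_def evv_def vector_scalar_mult_def)
  \<comment> \<open>The chain rule puts one factor \<open>t\<close> on the left, which is cancelled
    below. For \<open>n = 0\<close> the truncated degree \<open>n - 1\<close> does no harm, since
    the derivative is zero.\<close>
  from arg_cong[OF this, of "pds", THEN fun_cong, of i]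
  have "c3 t * cmp (pd i p) (\<chi> i. c3 t * X i) = c3 (t ^ n) * pd i p"
    using exhaust_3[of i] by (auto simp: pd_cmp sum_3 mult.commute)
  from arg_cong[OF this, of "\<lambda>q. ev q v"]
  have *: "t * ev (pd i p) (t *s v) = t ^ n * ev (pd i p) v"
    by (simp add: evv_def vector_scalar_mult_def)
  show "ev (pd i p) (t *s v) = t ^ (n - 1) * ev (pd i p) v"
  proof (cases n)
    case 0
    then have "pd i p = 0" using hom_0_const h by (metis pd_c3)
    then show ?thesis by simp
  next
    case (Suc m) then show ?thesis using * t by simp
  qed
qed

text \<open>Both sides are the derivative of p(t v) = t^n p(v) at t = 1.\<close>

lemma euler: assumes "hom n p" shows "(\<Sum>i\<in>UNIV. X i * pd i p) = of_nat n * p"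
proof (rule p3_eqI)
  fix v :: "complex ^ 3"
  have 1: "((\<lambda>t. t *s v) has_derivative (\<lambda>s. s *s v)) (at 1)"
    by (rule bounded_linear_imp_has_derivative, rule linear_conv_bounded_linear[THEN iffD1], rule linearI)
      (simp_all add: vec_eq_iff algebra_simps)
  have "(ev p has_derivative (\<lambda>h. \<Sum>i\<in>UNIV. ev (pd i p) v * h $ i)) (at (1 *s v))"
    using has_derivative_ev[of p v] by simp
  from has_derivative_compose[OF 1 this]
  have "((\<lambda>t. ev p (t *s v)) has_field_derivative (\<Sum>i\<in>UNIV. v $ i * ev (pd i p) v)) (at 1)"
    unfolding has_field_derivative_def
    by (rule has_derivative_eq_rhs) (auto simp: fun_eq_iff sum_3 algebra_simps)
  moreover have "((\<lambda>t. ev p (t *s v)) has_field_derivative of_nat n * ev p v) (at 1)"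
    using assms unfolding hom_def by (auto intro!: derivative_eq_intros)
  ultimately show "ev (\<Sum>i\<in>UNIV. X i * pd i p) v = ev (of_nat n * p) v"
    by (simp add: DERIV_unique)
qed

text \<open>\<open>dil p\<close> is \<open>p(tx, ty, tz)\<close> as a polynomial in \<open>t\<close>; its coefficients are the homogeneous
  components of \<open>p\<close>.\<close>

definition dil :: "p3 \<Rightarrow> p3 poly" where
  "dil p = (SOME P. \<forall>t v. ev (poly P (c3 t)) v = ev p (t *s v))"

lemma ev_dil: "ev (poly (dil p) (c3 t)) v = ev p (t *s v)"
proof -
  have "\<exists>P::p3 poly. \<forall>t v. ev (poly P (c3 t)) v = ev p (t *s v)"
  proof (induction p rule: p3_induct)
    case (const c) show ?case by (rule exI[of _ "[:c3 c:]"]) simp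
  next
    case (var i) show ?case by (rule exI[of _ "[:0, X i:]"]) simp
  next
    case (add p q) then show ?case by (metis ev_add poly_add)
  next
    case (mult p q) then show ?case by (metis ev_mult poly_mult)
  qed
  from someI_ex[OF this] show ?thesis unfolding dil_def by blast
qed

lemma dil_unique: assumes "\<And>t v. ev (poly P (c3 t)) v = ev p (t *s v)" shows "dil p = P"
proof -
  have "dil p - P = 0"
  proof (rule ccontr)
    assume "dil p - P \<noteq> 0"
    then obtain c where "poly (dil p - P) (c3 c) \<noteq> 0"
      using poly_nonroot[of "dil p - P" c3] by (auto simp: inj_def)
    then show False using assms ev_dil by (auto intro: p3_eqI)
  qed
  then show ?thesis by simp
qed

lemma dil_add: "dil (p + q) = dil p + dil q" and dil_mult: "dil (p * q) = dil p * dil q"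
  by (rule dil_unique; simp add: ev_dil)+

lemma dil_hom: "hom n p \<longleftrightarrow> dil p = monom p n"
proof
  show "hom n p \<Longrightarrow> dil p = monom p n"
    by (rule dil_unique) (auto simp: hom_def poly_monom)
  show "dil p = monom p n \<Longrightarrow> hom n p"
    unfolding hom_def by (metis ev_dil poly_monom ev_mult ev_power ev_c3 mult.commute)
qed

lemma sum_coeff_dil: "poly (dil p) 1 = p"
  by (rule p3_eqI) (use ev_dil[of p 1] in simp)

text \<open>Over a domain one of the two constant coefficients vanishes if \<open>n > 0\<close>; the
  variable is split off that factor and \<open>n\<close> decreases.\<close>

lemma monom_factor:
  fixes P Q :: "'a::idom poly"
  assumes "P * Q = monom r n" "r \<noteq> 0"
  shows "\<exists>a b i j. P = monom a i \<and> Q = monom b j \<and> i + j = n"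
  using assms
proof (induction n arbitrary: P Q)
  case 0
  then have "P \<noteq> 0" "Q \<noteq> 0" by auto
  with 0 have "degree P = 0" "degree Q = 0"
    by (metis add_is_0 degree_monom_eq degree_mult_eq)+
  then show ?case by (metis add_0 degree_eq_zeroE monom_0)
next
  case (Suc n)
  have "coeff P 0 * coeff Q 0 = 0" using arg_cong[OF Suc.prems(1), of "\<lambda>p. coeff p 0"]
    by (simp add: coeff_mult)
  moreover have *: "\<exists>a b i j. P = monom a i \<and> Q = monom b j \<and> i + j = Suc n"
    if h: "P * Q = monom r (Suc n)" "coeff P 0 = 0" for P Q
  proof -
    obtain P' where P: "P = pCons 0 P'" using h(2) by (cases P) auto
    have "pCons 0 (P' * Q) = pCons 0 (monom r n)"
      using h(1) by (simp add: P monom_Suc)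
    then have "P' * Q = monom r n" by simp
    from Suc.IH[OF this Suc.prems(2)] obtain a b i j
      where "P' = monom a i" "Q = monom b j" "i + j = n" by blast
    then show ?thesis using P by (metis add_Suc monom_Suc)
  qed
  ultimately show ?case using *[of P Q] *[of Q P] Suc.prems(1)
    by (metis add.commute mult.commute mult_eq_0_iff)
qed

text \<open>Under the multiplicative map \<open>dil\<close> a form becomes a monomial in the
  dilation parameter with coefficient in \<open>p3\<close>, and factors of a monomial over a domain
  are monomials.\<close>

lemma hom_factor:
  assumes "hom n (p * q)" "p * q \<noteq> 0"
  shows "\<exists>i j. hom i p \<and> hom j q \<and> i + j = n"
proof -
  have "dil p * dil q = monom (p * q) n" using assms dil_hom dil_mult by metis
  from monom_factor[OF this assms(2)] obtain a b i j
    where *: "dil p = monom a i" "dil q = monom b j" "i + j = n" by blast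
  have "p = a" "q = b"
    using sum_coeff_dil[of p] sum_coeff_dil[of q] * by (simp_all add: poly_monom)
  with * show ?thesis using dil_hom by blast
qed

lemma hom_dvd: "hom n q \<Longrightarrow> q \<noteq> 0 \<Longrightarrow> p dvd q \<Longrightarrow> \<exists>i\<le>n. hom i p"
  by (metis dvdE hom_factor le_add1)

lemma hom_cancel: "hom n (p * q) \<Longrightarrow> hom i p \<Longrightarrow> p \<noteq> 0 \<Longrightarrow> q \<noteq> 0 \<Longrightarrow> hom (n - i) q \<and> i \<le> n"
  by (metis add_diff_cancel_left' hom_factor hom_unique le_add1 no_zero_divisors)

lemma hom_dvd_small: "hom n p \<Longrightarrow> hom m q \<Longrightarrow> p dvd q \<Longrightarrow> m < n \<Longrightarrow> q = 0"
  by (metis dvdE hom_cancel mult_zero_left mult_zero_right not_le)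

section \<open>Elimination and intersections of plane curves\<close>

lemma prime_divisor_pos_degree:
  fixes q :: "'a::{factorial_ring_gcd,semiring_gcd_mult_normalize} poly"
  assumes "degree q > 0" shows "\<exists>\<pi>. prime \<pi> \<and> \<pi> dvd q \<and> degree \<pi> > 0"
  using assms
proof (induction q rule: prime_divisors_induct)
  case (factor p x)
  then have "p \<noteq> 0" "x \<noteq> 0" by auto
  then have "degree p > 0 \<or> degree x > 0" using factor.prems by (simp add: degree_mult_eq)
  then show ?case using factor by (metis dvd_mult dvd_triv_left)
qed (auto simp: is_unit_poly_iff)

text \<open>A nonzero element of least degree in the ideal divides constant multiples of \<open>a\<close> and \<open>b\<close>,
  so it cannot have a prime factor of positive degree.\<close>

lemma elimination:
  fixes a b :: "'a::{factorial_ring_gcd,semiring_gcd_mult_normalize} poly"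
  assumes "coprime a b" shows "\<exists>u w r. u * a + w * b = [:r:] \<and> r \<noteq> 0"
proof -
  define J where "J q \<longleftrightarrow> (\<exists>u w. q = u * a + w * b)" for q
  have Ja: "J a" unfolding J_def by (rule exI[of _ 1], rule exI[of _ 0]) simp
  have Jb: "J b" unfolding J_def by (rule exI[of _ 0], rule exI[of _ 1]) simp
  have "\<exists>q. J q \<and> q \<noteq> 0" using Ja Jb assms by (cases "a = 0") auto
  then obtain q where q: "J q" "q \<noteq> 0" and min: "\<And>p. J p \<Longrightarrow> p \<noteq> 0 \<Longrightarrow> degree q \<le> degree p"
    using ex_has_least_nat[of "\<lambda>q. J q \<and> q \<noteq> 0" _ degree] by blast
  have ring: "C * (u * a + w * b) - s * (u' * a + w' * b) = (C * u - s * u') * a + (C * w - s * w') * b"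
    for C s u w u' w' :: "'a poly" by (simp add: algebra_simps)
  have div: "\<exists>c. c \<noteq> 0 \<and> q dvd [:c:] * f" if "J f" for f
  proof -
    obtain c s where cs: "c \<noteq> 0" "smult c f = q * s + pseudo_mod f q"
      using pseudo_mod(1)[OF q(2)] by blast
    obtain u w u' w' where "f = u * a + w * b" "q = u' * a + w' * b"
      using \<open>J f\<close> q(1) unfolding J_def by blast
    moreover have "pseudo_mod f q = [:c:] * f - s * q" using cs(2) by (simp add: algebra_simps)
    ultimately have "pseudo_mod f q = ([:c:] * u - s * u') * a + ([:c:] * w - s * w') * b"
      by (simp only: ring)
    then have "J (pseudo_mod f q)" unfolding J_def by blast
    then have "pseudo_mod f q = 0" using pseudo_mod(2)[OF q(2)] min by (metis not_le)
    then show ?thesis using cs by (intro exI[of _ c]) (simp add: dvd_def)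
  qed
  have "degree q = 0"
  proof (rule ccontr)
    assume "degree q \<noteq> 0"
    then obtain \<pi> where \<pi>: "prime \<pi>" "\<pi> dvd q" "degree \<pi> > 0" using prime_divisor_pos_degree by blast
    have "\<pi> dvd f" if "J f" for f
    proof -
      obtain c where c: "c \<noteq> 0" "q dvd [:c:] * f" using div[OF \<open>J f\<close>] by blast
      then have "\<pi> dvd [:c:] \<or> \<pi> dvd f" using dvd_trans[OF \<pi>(2) c(2)] \<pi>(1) prime_dvd_mult_iff by blast
      moreover have "\<not> \<pi> dvd [:c:]" using \<pi>(3) c(1) dvd_imp_degree_le[of \<pi> "[:c:]"] by auto
      ultimately show ?thesis by blast
    qed
    then have "is_unit \<pi>" using Ja Jb assms coprime_common_divisor by blast
    then show False using \<pi>(1) by (meson not_prime_unit)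
  qed
  then show ?thesis using q unfolding J_def by (metis degree_eq_zeroE pCons_eq_0_iff)
qed

text \<open>\<open>bf n c\<close> is the binary form of degree \<open>n\<close> with dehomogenization \<open>c\<close>, for \<open>degree c \<le> n\<close>.\<close>

definition bf :: "nat \<Rightarrow> complex poly \<Rightarrow> p3 \<Rightarrow> p3 \<Rightarrow> p3" where
  "bf n c m1 m2 = (\<Sum>i\<le>n. c3 (coeff c i) * m1 ^ i * m2 ^ (n - i))"

definition bfc :: "nat \<Rightarrow> complex poly \<Rightarrow> complex \<Rightarrow> complex \<Rightarrow> complex" where
  "bfc n c x y = (\<Sum>i\<le>n. coeff c i * x ^ i * y ^ (n - i))"

lemma ev_bf [simp]: "ev (bf n c m1 m2) v = bfc n c (ev m1 v) (ev m2 v)"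
  by (simp add: bf_def bfc_def)

lemma bfc_nonzero: "degree c \<le> n \<Longrightarrow> y \<noteq> 0 \<Longrightarrow> bfc n c x y = y ^ n * poly c (x / y)"
proof -
  assume "degree c \<le> n" "y \<noteq> 0"
  have "poly c z = (\<Sum>i\<le>n. coeff c i * z ^ i)" for z
    unfolding poly_altdef using \<open>degree c \<le> n\<close>
    by (intro sum.mono_neutral_left) (auto simp: coeff_eq_0)
  then show ?thesis using \<open>y \<noteq> 0\<close>
    by (auto simp: bfc_def sum_distrib_left power_diff power_divide intro!: sum.cong)
qed

lemma bfc_zero: "bfc n c x 0 = coeff c n * x ^ n"
proof -
  have "bfc n c x 0 = (\<Sum>i\<in>{n}. coeff c i * x ^ i * 0 ^ (n - i))"
    unfolding bfc_def by (intro sum.mono_neutral_right) auto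
  then show ?thesis by simp
qed

lemma coeff_mult_top:
  "degree c \<le> n \<Longrightarrow> degree e \<le> m \<Longrightarrow> coeff (c * e) (n + m) = coeff c n * coeff e m"
proof -
  assume *: "degree c \<le> n" "degree e \<le> m"
  have "coeff (c * e) (n + m) = (\<Sum>i\<in>{n}. coeff c i * coeff e (n + m - i))"
    unfolding coeff_mult
  proof (intro sum.mono_neutral_right ballI)
    fix i assume "i \<in> {..n + m} - {n}"
    then have "i > n \<or> n + m - i > m" by auto
    then show "coeff c i * coeff e (n + m - i) = 0" using * by (auto simp: coeff_eq_0)
  qed auto
  then show ?thesis by simp
qed

lemma bfc_mult:
  assumes "degree c \<le> n" "degree e \<le> m"
  shows "bfc (n + m) (c * e) x y = bfc n c x y * bfc m e x y"
proof (cases "y = 0")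
  case True then show ?thesis using assms by (simp add: bfc_zero coeff_mult_top power_add)
next
  case False
  have "degree (c * e) \<le> n + m" using assms degree_mult_le[of c e] by linarith
  then show ?thesis using False assms by (simp add: bfc_nonzero power_add)
qed

lemma bf_mult:
  "degree c \<le> n \<Longrightarrow> degree e \<le> m \<Longrightarrow> bf (n + m) (c * e) m1 m2 = bf n c m1 m2 * bf m e m1 m2"
  by (rule p3_eqI) (simp add: bfc_mult)

lemma bf_linear: "bf 1 [:b, a:] m1 m2 = c3 a * m1 + c3 b * m2"
  by (simp add: bf_def)

lemma bf_0: "bf 0 c m1 m2 = c3 (coeff c 0)"
  by (simp add: bf_def)

text \<open>The linear factor is \<open>m2\<close> itself if the dehomogenization has degree less
  than \<open>Suc n\<close> (a root at infinity); otherwise it comes from a complex root.\<close>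

lemma bf_split:
  assumes "c \<noteq> 0" "degree c \<le> Suc n"
  shows "\<exists>\<alpha> \<beta> c'. (\<alpha> \<noteq> 0 \<or> \<beta> \<noteq> 0) \<and> c' \<noteq> 0 \<and> degree c' \<le> n \<and>
    (\<forall>m1 m2. bf (Suc n) c m1 m2 = (c3 \<alpha> * m1 + c3 \<beta> * m2) * bf n c' m1 m2)"
proof (cases "degree c \<le> n")
  case True
  have "bf (Suc n) c m1 m2 = (c3 0 * m1 + c3 1 * m2) * bf n c m1 m2" for m1 m2
    using bf_mult[of "[:1:]" 1 c n m1 m2] True bf_linear[of 1 0 m1 m2] by simp
  then show ?thesis using assms True by - (rule exI[of _ 0], rule exI[of _ 1], rule exI[of _ c], auto)
next
  case False
  then have "\<not> constant (poly c)" using constant_degree[of c] by auto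
  then obtain \<rho> where "poly c \<rho> = 0" using fundamental_theorem_of_algebra by blast
  then obtain c' where c': "c = [:- \<rho>, 1:] * c'" by (metis dvdE poly_eq_0_iff_dvd)
  then have "c' \<noteq> 0" "degree c = Suc (degree c')" using assms(1) by (auto simp: degree_mult_eq simp del: mult_pCons_left)
  moreover have "bf (Suc n) c m1 m2 = (c3 1 * m1 + c3 (- \<rho>) * m2) * bf n c' m1 m2" for m1 m2
    using bf_mult[of "[:- \<rho>, 1:]" 1 c' n m1 m2] calculation assms bf_linear[of "- \<rho>" 1 m1 m2]
    by (simp add: c' del: mult_pCons_left)
  ultimately show ?thesis using assms by - (rule exI[of _ 1], rule exI[of _ "- \<rho>"], rule exI[of _ c'], auto)
qed

lemma cmp_power [simp]: "cmp (p ^ n) F = cmp p F ^ n"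
  by (rule p3_eqI) simp

lemma cmp_sum [simp]: "cmp (sum f A) F = (\<Sum>a\<in>A. cmp (f a) F)"
  by (rule p3_eqI) simp

lemma cmp_bf [simp]: "cmp (bf n c m1 m2) F = bf n c (cmp m1 F) (cmp m2 F)"
  by (rule p3_eqI) simp

lemma bf_add: "bf n (c + e) m1 m2 = bf n c m1 m2 + bf n e m1 m2"
  by (simp add: bf_def sum.distrib algebra_simps c3_hom)

lemma bf_zero [simp]: "bf n 0 m1 m2 = 0"
  by (simp add: bf_def)

lemma bf_monom: "i \<le> n \<Longrightarrow> bf n (monom k i) m1 m2 = c3 k * m1 ^ i * m2 ^ (n - i)"
proof -
  assume "i \<le> n"
  have "bf n (monom k i) m1 m2 = (\<Sum>j\<in>{i}. c3 (coeff (monom k i) j) * m1 ^ j * m2 ^ (n - j))"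
    unfolding bf_def using \<open>i \<le> n\<close> by (intro sum.mono_neutral_right) auto
  then show ?thesis by simp
qed

lemma bf_sum: "(\<And>a. a \<in> A \<Longrightarrow> \<exists>c. degree c \<le> n \<and> f a = bf n c m1 m2) \<Longrightarrow>
    \<exists>c. degree c \<le> n \<and> sum f A = bf n c m1 m2"
proof (induction A rule: infinite_finite_induct)
  case (insert x A)
  then obtain c e where "degree c \<le> n" "f x = bf n c m1 m2" "degree e \<le> n" "sum f A = bf n e m1 m2"
    by (metis insertI1 insertI2)
  then show ?case using insert by (intro exI[of _ "c + e"]) (auto simp: bf_add degree_add_le)
qed (auto intro!: exI[of _ 0])

text \<open>A constant polynomial in the outermost variable contains no \<open>X 3\<close>, so its
  homogeneous components are binary forms in the other two variables.\<close>

lemma coeff_dil_binary: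
  "\<exists>c. degree c \<le> n \<and> coeff (dil [:r:]) n = bf n c (X 1) (X 2)"
proof -
  define P where "P = (\<Sum>j\<le>degree r. \<Sum>i\<le>degree (coeff r j).
    monom (c3 (coeff (coeff r j) i) * X 1 ^ i * X 2 ^ j) (i + j))"
  have pc: "poly (sum f A) x = (\<Sum>a\<in>A. poly (f a) x)" for f :: "nat \<Rightarrow> p3 poly" and A x
    by (rule poly_sum)
  have pc2: "poly (sum f A) x = (\<Sum>a\<in>A. poly (f a) x)" for f :: "nat \<Rightarrow> complex poly" and A x
    by (rule poly_sum)
  have "dil [:r:] = P"
  proof (rule dil_unique)
    fix t and v :: "complex ^ 3"
    have "ev [:r:] (t *s v) = poly (poly r [:t * v $ 2:]) (t * v $ 1)" by (simp add: ev_def)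
    also have "\<dots> = (\<Sum>j\<le>degree r. \<Sum>i\<le>degree (coeff r j).
        coeff (coeff r j) i * (t * v $ 1) ^ i * (t * v $ 2) ^ j)"
      unfolding poly_altdef[of r] pc2 by (simp add: poly_altdef[of "coeff r _"] sum_distrib_right)
    also have "\<dots> = ev (poly P (c3 t)) v"
      unfolding P_def pc ev_sum
      by (simp add: poly_monom algebra_simps power_add power_mult_distrib)
    finally show "ev (poly P (c3 t)) v = ev [:r:] (t *s v)" ..
  qed
  moreover have "\<exists>c. degree c \<le> n \<and> coeff P n = bf n c (X 1) (X 2)"
    unfolding P_def coeff_sum
  proof (intro bf_sum)
    fix i j
    show "\<exists>c. degree c \<le> n \<and> coeff (monom (c3 (coeff (coeff r j) i) * X 1 ^ i * X 2 ^ j) (i + j)) n =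
        bf n c (X 1) (X 2)"
    proof (cases "i + j = n")
      case True
      then have "i \<le> n" "n - i = j" by auto
      then show ?thesis using True bf_monom[of i n "coeff (coeff r j) i" "X 1" "X 2"]
        by (intro exI[of _ "monom (coeff (coeff r j) i) i"]) (auto intro: order_trans[OF degree_monom_le])
    next
      case False then show ?thesis by (intro exI[of _ 0]) simp
    qed
  qed
  ultimately show ?thesis by simp
qed

text \<open>An ideal generated by forms contains the homogeneous components of its elements. The
  relation of \<open>elimination\<close>, from which \<open>X 3\<close> is eliminated, is replaced
  by one of its nonzero components.\<close>

lemma hom_elimination:
  assumes "coprime a b" "hom m a" "hom m' b"
  shows "\<exists>n c u w. c \<noteq> 0 \<and> degree c \<le> n \<and> bf n c (X 1) (X 2) \<noteq> 0 \<and>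
    bf n c (X 1) (X 2) = u * a + w * b"
proof -
  obtain u w r where r: "u * a + w * b = [:r:]" "r \<noteq> 0" using elimination[OF assms(1)] by blast
  have "dil [:r:] \<noteq> 0"
    using sum_coeff_dil[of "[:r:]"] r(2) by auto
  then obtain n where n: "coeff (dil [:r:]) n \<noteq> 0" by (metis leading_coeff_0_iff)
  obtain c where c: "degree c \<le> n" "coeff (dil [:r:]) n = bf n c (X 1) (X 2)"
    using coeff_dil_binary by blast
  have "dil [:r:] = monom a m * dil u + monom b m' * dil w"
    using assms(2,3) unfolding dil_hom r(1)[symmetric] by (simp add: dil_add dil_mult mult.commute)
  then have "\<exists>u' w'. coeff (dil [:r:]) n = u' * a + w' * b"
    by - (rule exI[of _ "if n < m then 0 else coeff (dil u) (n - m)"],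
          rule exI[of _ "if n < m' then 0 else coeff (dil w) (n - m')"],
          simp add: coeff_monom_mult mult.commute[of a] mult.commute[of b])
  then show ?thesis using n c by (metis bf_zero)
qed

lemma hom_bf: "hom j m1 \<Longrightarrow> hom j m2 \<Longrightarrow> hom (j * n) (bf n c m1 m2)"
  unfolding bf_def
proof (rule hom_sum)
  fix i assume *: "hom j m1" "hom j m2" "i \<in> {..n}"
  then have "j * n = 0 + j * i + j * (n - i)" by (metis add_0 add_mult_distrib2 atMost_iff le_add_diff_inverse)
  then show "hom (j * n) (c3 (coeff c i) * m1 ^ i * m2 ^ (n - i))"
    using * by (metis hom_mult hom_power hom_c3)
qed

text \<open>Without a zero, the dehomogenization \<open>P\<close> would be constant by the
  fundamental theorem of algebra; the reversed polynomial \<open>Q\<close> is then a multiple of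
  \<open>s ^ n\<close> and vanishes at \<open>s = 0\<close>, that is, at \<open>u\<close>.\<close>

lemma hom_zero_on_plane:
  assumes "hom n q" "n > 0"
  shows "\<exists>s t. (s \<noteq> 0 \<or> t \<noteq> 0) \<and> ev q (s *s u + t *s w) = 0"
proof (rule ccontr)
  assume neg: "\<not> ?thesis"
  obtain P where P: "\<And>t. poly P t = ev q (t *s u + w)" using line_poly by blast
  obtain Q where Q: "\<And>t. poly Q t = ev q (t *s w + u)" using line_poly by blast
  have "poly P t \<noteq> 0" for t using neg P[of t] by (metis one_neq_zero scale_one vector_smult_lid)
  then have "constant (poly P)" using fundamental_theorem_of_algebra by blast
  then obtain k where k: "\<And>t. poly P t = k" unfolding constant_def by metis
  have "Q = monom k n"
  proof (rule poly_eq_off_point[of 0])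
    fix s :: complex assume "s \<noteq> 0"
    then have "s *s w + u = s *s (inverse s *s u + w)" by (simp add: vec_eq_iff field_simps)
    then show "poly Q s = poly (monom k n) s"
      using assms(1) k P[of "inverse s"] unfolding hom_def Q by (metis mult.commute poly_monom)
  qed
  then have "ev q (1 *s u + 0 *s w) = 0" using Q[of 0] assms(2) by (simp add: poly_monom zero_power)
  then show False using neg by (metis one_neq_zero)
qed

section \<open>Vector algebra and linear forms in dimension three\<close>

definition crs :: "'a::comm_ring_1 ^ 3 \<Rightarrow> 'a ^ 3 \<Rightarrow> 'a ^ 3" where
  "crs u w = vector [u $ 2 * w $ 3 - u $ 3 * w $ 2, u $ 3 * w $ 1 - u $ 1 * w $ 3,
    u $ 1 * w $ 2 - u $ 2 * w $ 1]"

text \<open>Bilinear rather than hermitian, as it is also applied to vectors of polynomials. A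
  nonzero complex vector may be orthogonal to itself, so complex conjugates appear wherever a vector
  not orthogonal to a cross product is needed.\<close>

definition dot :: "'a::comm_ring_1 ^ 3 \<Rightarrow> 'a ^ 3 \<Rightarrow> 'a" where
  "dot u w = (\<Sum>i\<in>UNIV. u $ i * w $ i)"

lemma crs_nth [simp]: "crs u w $ 1 = u $ 2 * w $ 3 - u $ 3 * w $ 2"
    "crs u w $ 2 = u $ 3 * w $ 1 - u $ 1 * w $ 3" "crs u w $ 3 = u $ 1 * w $ 2 - u $ 2 * w $ 1"
  by (simp_all add: crs_def)

lemma vec3_eq: "u = w \<longleftrightarrow> u $ 1 = w $ 1 \<and> u $ 2 = w $ 2 \<and> u $ (3::3) = w $ 3"
  by (simp add: vec_eq_iff forall_3)

lemma crs_zero_parallel: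
  fixes u w :: "'a::field ^ 3"
  assumes "crs u w = 0" "u \<noteq> 0" shows "\<exists>c. w = c *s u"
proof -
  have e: "u $ 2 * w $ 3 = u $ 3 * w $ 2" "u $ 3 * w $ 1 = u $ 1 * w $ 3" "u $ 1 * w $ 2 = u $ 2 * w $ 1"
    using assms(1) by (auto simp: vec3_eq)
  consider "u $ 1 \<noteq> 0" | "u $ 2 \<noteq> 0" | "u $ 3 \<noteq> 0" using assms(2) by (auto simp: vec3_eq)
  then show ?thesis
  proof cases
    case 1 then show ?thesis using e by (intro exI[of _ "w $ 1 / u $ 1"]) (auto simp: vec3_eq field_simps)
  next
    case 2 then show ?thesis using e by (intro exI[of _ "w $ 2 / u $ 2"]) (auto simp: vec3_eq field_simps)
  next
    case 3 then show ?thesis using e by (intro exI[of _ "w $ 3 / u $ 3"]) (auto simp: vec3_eq field_simps)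
  qed
qed

lemma dot_crs: "dot u (crs u w) = 0" "dot w (crs u w) = 0" "dot a (crs u w) = dot (crs a u) w"
  by (simp_all add: dot_def sum_3 algebra_simps)

lemma orthogonal_parallel:
  fixes \<alpha> \<beta> w :: "'a::field ^ 3"
  assumes "dot \<alpha> w = 0" "dot \<beta> w = 0" "crs \<alpha> \<beta> \<noteq> 0" shows "\<exists>c. w = c *s crs \<alpha> \<beta>"
proof -
  have "crs (crs \<alpha> \<beta>) w = dot \<alpha> w *s \<beta> - dot \<beta> w *s \<alpha>"
    by (simp add: vec3_eq dot_def sum_3 algebra_simps)
  then show ?thesis using assms crs_zero_parallel[of "crs \<alpha> \<beta>" w] by simp
qed

definition lf :: "complex ^ 3 \<Rightarrow> p3" where "lf \<alpha> = (\<Sum>i\<in>UNIV. c3 (\<alpha> $ i) * X i)"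

lemma ev_lf [simp]: "ev (lf \<alpha>) v = dot \<alpha> v"
  by (simp add: lf_def dot_def)

lemma hom_lf [simp]: "hom (Suc 0) (lf \<alpha>)"
  unfolding lf_def by (rule hom_sum) (auto intro: hom_c3_mult)

lemma cmp_lf [simp]: "cmp (lf \<alpha>) F = (\<Sum>i\<in>UNIV. c3 (\<alpha> $ i) * F $ i)"
  by (simp add: lf_def)

lemma pd_lf [simp]: "pd i (lf \<alpha>) = c3 (\<alpha> $ i)"
  using exhaust_3[of i] by (auto simp: lf_def sum_3)

lemma hom_nonunit_pos: "hom j D \<Longrightarrow> \<not> is_unit D \<Longrightarrow> D \<noteq> 0 \<Longrightarrow> j > 0"
proof (rule ccontr)
  assume *: "hom j D" "\<not> is_unit D" "D \<noteq> 0" "\<not> j > 0"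
  then have D: "D = c3 (ev D 0)" using hom_0_const by simp
  then have "ev D 0 \<noteq> 0" using *(3) by (metis c3_simps(1))
  then have "1 = D * c3 (inverse (ev D 0))" by (subst D) (simp add: c3_hom[symmetric])
  then show False using *(2) by (metis dvdI)
qed

text \<open>Let \<open>r(x,y)\<close> be a form of least degree in the ideal \<open>(a, b)\<close> and \<open>l\<close> a linear factor of it.
  If there were no common zero on the line \<open>l = 0\<close>, then \<open>a\<close> and \<open>b\<close> would remain coprime there,
  the relation expressing \<open>r\<close> would be trivial modulo \<open>l\<close>, and \<open>r / l\<close> would be in the ideal.\<close>

theorem plane_curves_meet:
  assumes "hom m a" "m > 0" "hom m' b" "m' > 0"
  shows "\<exists>v. v \<noteq> 0 \<and> ev a v = 0 \<and> ev b v = 0"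
proof -
  \<comment> \<open>Since \<open>\<alpha> $ 3 = 0\<close>, the line passes through
    \<open>[0 : 0 : 1]\<close>; the two vectors below span its cone.\<close>
  have zero: "\<exists>v. v \<noteq> 0 \<and> dot \<alpha> v = 0 \<and> ev q v = 0" if h: "hom j q" "j > 0" "\<alpha> \<noteq> 0" "\<alpha> $ 3 = 0" for q j and \<alpha> :: "complex ^ 3"
  proof -
    obtain s t where st: "s \<noteq> 0 \<or> t \<noteq> 0" "ev q (s *s vector [\<alpha> $ 2, - \<alpha> $ 1, 0] + t *s vector [0, 0, 1]) = 0"
      using hom_zero_on_plane[OF h(1,2)] by blast
    then show ?thesis using h(3,4)
      by (intro exI[of _ "s *s vector [\<alpha> $ 2, - \<alpha> $ 1, 0] + t *s vector [0, 0, 1]"])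
        (auto simp: vec3_eq dot_def sum_3)
  qed
  have zero': "\<exists>v. v \<noteq> 0 \<and> ev q v = 0" if "hom j q" "j > 0" for q j
    using zero[OF that, of "axis 1 1"] by (auto simp: axis_def vec3_eq)
  consider "a = 0" | "b = 0" | "a \<noteq> 0" "b \<noteq> 0" "\<not> coprime a b" | "coprime a b" by blast
  then show ?thesis
  proof cases
    case 1 then show ?thesis using zero'[OF assms(3,4)] by auto
  next
    case 2 then show ?thesis using zero'[OF assms(1,2)] by auto
  next
    case 3
    then obtain D where D: "D dvd a" "D dvd b" "\<not> is_unit D" using not_coprimeE by blast
    then obtain j where "hom j D" using hom_dvd assms 3 by blast
    moreover have "D \<noteq> 0" using D(1) 3 by auto
    ultimately obtain v where "v \<noteq> 0" "ev D v = 0" using zero' hom_nonunit_pos D by blast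
    then show ?thesis using D(1,2) by (auto simp: dvd_def)
  next
    case 4
    define Q where "Q n \<longleftrightarrow> (\<exists>c u w. c \<noteq> 0 \<and> degree c \<le> n \<and> bf n c (X 1) (X 2) \<noteq> 0 \<and>
      bf n c (X 1) (X 2) = u * a + w * b)" for n
    have "\<exists>n. Q n" using hom_elimination[OF 4 assms(1,3)] unfolding Q_def by blast
    then obtain n where n: "Q n" "\<And>n'. n' < n \<Longrightarrow> \<not> Q n'" using exists_least_iff[of Q] by blast
    from n(1) obtain c u w where c: "c \<noteq> 0" "degree c \<le> n" "bf n c (X 1) (X 2) \<noteq> 0"
      "bf n c (X 1) (X 2) = u * a + w * b" unfolding Q_def by blast
    show ?thesis
    proof (rule ccontr)
      assume neg: "\<not> ?thesis"
      have "n \<noteq> 0"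
      proof
        assume "n = 0"
        then have "u * a + w * b = c3 (coeff c 0)" "coeff c 0 \<noteq> 0" using c(3,4) by (auto simp: bf_0)
        from arg_cong[OF this(1), of "\<lambda>q. ev q 0"] this(2) show False
          using hom_at_0 assms by simp
      qed
      then obtain k where k: "n = Suc k" by (cases n) auto
      obtain \<alpha> \<beta> c' where s: "\<alpha> \<noteq> 0 \<or> \<beta> \<noteq> 0" "c' \<noteq> 0" "degree c' \<le> k"
        "\<forall>m1 m2. bf (Suc k) c m1 m2 = (c3 \<alpha> * m1 + c3 \<beta> * m2) * bf k c' m1 m2"
        using bf_split[of c k] c k by blast
      define \<gamma> :: "complex ^ 3" where "\<gamma> = vector [\<alpha>, \<beta>, 0]"
      have \<gamma>: "\<gamma> \<noteq> 0" "\<gamma> $ 3 = 0" using s(1) by (auto simp: \<gamma>_def vec3_eq)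
      have bl: "bf n c (X 1) (X 2) = lf \<gamma> * bf k c' (X 1) (X 2)"
        using s(4) k by (simp add: lf_def \<gamma>_def sum_3)
      obtain e where e: "dot \<gamma> e = 1"
      proof (cases "\<alpha> = 0")
        case True then show ?thesis using s(1) that[of "vector [0, inverse \<beta>, 0]"]
          by (auto simp: \<gamma>_def dot_def sum_3)
      next
        case False then show ?thesis using that[of "vector [inverse \<alpha>, 0, 0]"]
          by (auto simp: \<gamma>_def dot_def sum_3)
      qed
      \<comment> \<open>Projection along \<open>e\<close> onto the plane
        \<open>lf \<gamma> = 0\<close>: substituting \<open>\<Lambda>\<close> computes a normal form
        modulo \<open>lf \<gamma>\<close>.\<close>
      define \<Lambda> where "\<Lambda> = (\<chi> i. X i - c3 (e $ i) * lf \<gamma>)"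
      have ev\<Lambda>: "evv \<Lambda> v = v - dot \<gamma> v *s e" for v by (simp add: vec_eq_iff \<Lambda>_def)
      have dot\<Lambda>: "dot \<gamma> (v - dot \<gamma> v *s e) = 0" for v
      proof -
        have "dot \<gamma> (v - dot \<gamma> v *s e) = dot \<gamma> v - dot \<gamma> v * dot \<gamma> e"
          by (simp add: dot_def sum_3 algebra_simps)
        then show ?thesis by (simp add: e)
      qed
      have hom\<Lambda>: "\<forall>i. hom 1 (\<Lambda> $ i)" unfolding \<Lambda>_def by (auto intro!: hom_diff hom_c3_mult)
      have modl: "\<exists>g. q = cmp q \<Lambda> + lf \<gamma> * g" for q
      proof (induction q rule: p3_induct)
        case (const c) show ?case by (rule exI[of _ 0]) simp
      next
        case (var i) show ?case by (rule exI[of _ "c3 (e $ i)"]) (simp add: \<Lambda>_def mult.commute)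
      next
        case (add p q)
        then obtain g h where "p = cmp p \<Lambda> + lf \<gamma> * g" "q = cmp q \<Lambda> + lf \<gamma> * h" by blast
        then have "p + q = cmp (p + q) \<Lambda> + lf \<gamma> * (g + h)" by (metis (no_types, lifting) add.assoc add.left_commute cmp_simps(1) distrib_left)
        then show ?case ..
      next
        case (mult p q)
        then obtain g h where gh: "p = cmp p \<Lambda> + lf \<gamma> * g" "q = cmp q \<Lambda> + lf \<gamma> * h" by blast
        have "p * q = (cmp p \<Lambda> + lf \<gamma> * g) * (cmp q \<Lambda> + lf \<gamma> * h)" using gh by simp
        also have "\<dots> = cmp (p * q) \<Lambda> + lf \<gamma> * (g * cmp q \<Lambda> + h * cmp p \<Lambda> + lf \<gamma> * g * h)"
          by (simp add: algebra_simps)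
        finally show ?case ..
      qed
      have ker: "ev (cmp q \<Lambda>) v = ev q v" if "dot \<gamma> v = 0" for q v
        using that by (simp add: ev\<Lambda>)
      define a' where "a' = cmp a \<Lambda>"
      define b' where "b' = cmp b \<Lambda>"
      have ha: "hom m a'" "hom m' b'" using hom_cmp[OF assms(1) hom\<Lambda>] hom_cmp[OF assms(3) hom\<Lambda>]
        by (simp_all add: a'_def b'_def)
      have a0: "a' \<noteq> 0"
      proof
        assume "a' = 0"
        then have "ev a v = 0" if "dot \<gamma> v = 0" for v using ker[OF that, of a] by (simp add: a'_def)
        then show False using zero[OF assms(3,4) \<gamma>] neg by blast
      qed
      have b0: "b' \<noteq> 0"
      proof
        assume "b' = 0"
        then have "ev b v = 0" if "dot \<gamma> v = 0" for v using ker[OF that, of b] by (simp add: b'_def)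
        then show False using zero[OF assms(1,2) \<gamma>] neg by blast
      qed
      have cop: "coprime a' b'"
      proof (rule ccontr)
        assume "\<not> coprime a' b'"
        then obtain D where D: "D dvd a'" "D dvd b'" "\<not> is_unit D" using not_coprimeE by blast
        then obtain j where "hom j D" using hom_dvd ha a0 by blast
        moreover have "D \<noteq> 0" using D(1) a0 by auto
        ultimately obtain v where v: "v \<noteq> 0" "dot \<gamma> v = 0" "ev D v = 0"
          using zero[OF _ _ \<gamma>] hom_nonunit_pos D by blast
        then have "ev a' v = 0" "ev b' v = 0" using D(1,2) by (auto simp: dvd_def)
        then have "ev a v = 0" "ev b v = 0" using ker[OF v(2)] by (auto simp: a'_def b'_def)
        then show False using neg v(1) by blast
      qed
      have "cmp (lf \<gamma>) \<Lambda> = 0"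
      proof (rule p3_eqI)
        fix v show "ev (cmp (lf \<gamma>) \<Lambda>) v = ev 0 v" unfolding ev_cmp ev_lf ev\<Lambda> by (simp add: dot\<Lambda>)
      qed
      then have "cmp u \<Lambda> * a' + cmp w \<Lambda> * b' = 0"
        using arg_cong[OF c(4)[unfolded bl], of "\<lambda>q. cmp q \<Lambda>"] by (simp add: a'_def b'_def del: cmp_lf cmp_bf)
      then have rel: "cmp u \<Lambda> * a' = - cmp w \<Lambda> * b'" by (simp add: add_eq_0_iff2)
      \<comment> \<open>A syzygy of the coprime pair \<open>a'\<close>, \<open>b'\<close> is a
        multiple \<open>f\<close> of the trivial one \<open>(- b', a')\<close>.\<close>
      then have "a' dvd cmp w \<Lambda> * b'" by (metis dvd_minus_iff dvd_triv_right mult_minus_left)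
      then have "a' dvd cmp w \<Lambda>" using cop by (simp add: coprime_dvd_mult_left_iff)
      then obtain f where f: "cmp w \<Lambda> = a' * f" by blast
      then have "cmp u \<Lambda> * a' = (- b' * f) * a'" using rel by (simp add: algebra_simps)
      then have "cmp u \<Lambda> = - b' * f" using a0 by (simp only: mult_cancel_right) simp
      obtain u1 where u1: "u = cmp u \<Lambda> + lf \<gamma> * u1" using modl by blast
      obtain w1 where w1: "w = cmp w \<Lambda> + lf \<gamma> * w1" using modl by blast
      obtain a1 where a1: "a = a' + lf \<gamma> * a1" using modl a'_def by blast
      obtain b1 where b1: "b = b' + lf \<gamma> * b1" using modl b'_def by blast
      have "u * a + w * b = (- b' * f + lf \<gamma> * u1) * a + (a' * f + lf \<gamma> * w1) * b"
        using u1 w1 f \<open>cmp u \<Lambda> = - b' * f\<close> by simp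
      \<comment> \<open>With \<open>a'\<close> and \<open>b'\<close> replaced by \<open>a\<close>
        and \<open>b\<close> modulo \<open>lf \<gamma>\<close>, the trivial syzygy cancels and
        \<open>lf \<gamma>\<close> factors out.\<close>
      also have "\<dots> = (- (b - lf \<gamma> * b1) * f + lf \<gamma> * u1) * a + ((a - lf \<gamma> * a1) * f + lf \<gamma> * w1) * b"
        using a1 b1 by (metis add_diff_cancel_right')
      also have "\<dots> = lf \<gamma> * ((b1 * f + u1) * a + (w1 - a1 * f) * b)" by (simp add: algebra_simps)
      finally have "lf \<gamma> * bf k c' (X 1) (X 2) = lf \<gamma> * ((b1 * f + u1) * a + (w1 - a1 * f) * b)"
        unfolding bl[symmetric] c(4) .
      moreover have "lf \<gamma> \<noteq> 0" using bl c(3) by auto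
      ultimately have "bf k c' (X 1) (X 2) = (b1 * f + u1) * a + (w1 - a1 * f) * b" by simp
      moreover have "bf k c' (X 1) (X 2) \<noteq> 0" using bl c(3) by auto
      ultimately have "Q k" using s unfolding Q_def by blast
      then show False using n(2) k by blast
    qed
  qed
qed

section \<open>Prime ideals containing coprime forms\<close>

definition pideal :: "(p3 \<Rightarrow> bool) \<Rightarrow> bool" where
  "pideal I \<longleftrightarrow> I 0 \<and> (\<forall>p q. I p \<longrightarrow> I q \<longrightarrow> I (p + q)) \<and> (\<forall>p q. I p \<longrightarrow> I (q * p)) \<and>
    (\<forall>p q. I (p * q) \<longrightarrow> I p \<or> I q)"

lemma pidealD:
  assumes "pideal I"
  shows "I 0" "I p \<Longrightarrow> I q \<Longrightarrow> I (p + q)" "I p \<Longrightarrow> I (q * p)" "I p \<Longrightarrow> I (p * q)"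
    "I (p * q) \<Longrightarrow> I p \<or> I q" "I 1 \<Longrightarrow> I p"
  using assms unfolding pideal_def
  by (blast, blast, blast, metis mult.commute, blast, metis mult_1_right)

text \<open>Over the complex numbers a binary form is a product of linear factors, and a prime ideal
  containing the product contains one of them.\<close>

lemma pideal_bf:
  assumes "pideal I" "I (bf n c m1 m2)" "c \<noteq> 0" "degree c \<le> n"
  shows "\<exists>\<alpha> \<beta>. (\<alpha> \<noteq> 0 \<or> \<beta> \<noteq> 0) \<and> I (c3 \<alpha> * m1 + c3 \<beta> * m2)"
  using assms(2-4)
proof (induction n arbitrary: c)
  case 0
  then have "coeff c 0 \<noteq> 0" by (metis degree_eq_zeroE coeff_pCons_0 le_zero_eq pCons_0_0)
  then have "1 = c3 (inverse (coeff c 0)) * bf 0 c m1 m2" by (simp add: bf_0 c3_hom[symmetric])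
  then have "I 1" using 0 pidealD(3)[OF assms(1)] by metis
  then show ?case using pidealD(6)[OF assms(1)] by (metis one_neq_zero)
next
  case (Suc n)
  obtain \<alpha> \<beta> c' where s: "\<alpha> \<noteq> 0 \<or> \<beta> \<noteq> 0" "c' \<noteq> 0" "degree c' \<le> n"
    "bf (Suc n) c m1 m2 = (c3 \<alpha> * m1 + c3 \<beta> * m2) * bf n c' m1 m2"
    using bf_split[of c n] Suc.prems by blast
  then have "I (c3 \<alpha> * m1 + c3 \<beta> * m2) \<or> I (bf n c' m1 m2)"
    using Suc.prems(1) pidealD(5)[OF assms(1)] by simp
  then show ?case using Suc.IH s by blast
qed

text \<open>\<open>P\<close> is a linear involution, in practice a permutation of the variables that
  brings the one to be eliminated to the third place. Being invertible, it preserves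
  coprimality.\<close>

lemma pideal_linear_form_in_two_variables:
  assumes I: "pideal I" "I a" "I b" and ab: "coprime a b" "hom m a" "hom m' b"
    and P: "\<And>q. cmp (cmp q P) P = q" "\<forall>i. hom 1 (P $ i)"
  shows "\<exists>\<alpha> \<beta>. (\<alpha> \<noteq> 0 \<or> \<beta> \<noteq> 0) \<and> I (c3 \<alpha> * P $ 1 + c3 \<beta> * P $ 2)"
proof -
  have "coprime (cmp a P) (cmp b P)"
  proof (rule ccontr)
    assume "\<not> ?thesis"
    then obtain D where D: "D dvd cmp a P" "D dvd cmp b P" "\<not> is_unit D" using not_coprimeE by blast
    then have "cmp D P dvd a" "cmp D P dvd b" using cmp_dvd P by metis+
    then have "is_unit (cmp D P)" using ab(1) coprime_common_divisor by blast
    then have "is_unit (cmp (cmp D P) P)" using cmp_dvd[of "cmp D P" 1 P] by simp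
    then show False using D(3) P by simp
  qed
  moreover have "hom m (cmp a P)" "hom m' (cmp b P)"
    using hom_cmp[OF ab(2) P(2)] hom_cmp[OF ab(3) P(2)] by simp_all
  ultimately obtain n c u w where c: "c \<noteq> 0" "degree c \<le> n"
    "bf n c (X 1) (X 2) = u * cmp a P + w * cmp b P" using hom_elimination by blast
  have "I (cmp (bf n c (X 1) (X 2)) P)"
    unfolding c(3) using I by (simp add: P(1) pidealD(2,3)[OF I(1)])
  then show ?thesis using pideal_bf[OF I(1) _ c(1,2)] by simp
qed

text \<open>Eliminating each of the three variables gives three linear forms, in two variables each.\<close>

lemma pideal_linear_forms:
  assumes I: "pideal I" "I a" "I b" and ab: "coprime a b" "hom m a" "hom m' b"
  shows "\<exists>\<alpha> \<beta>. crs \<alpha> \<beta> \<noteq> 0 \<and> I (lf \<alpha>) \<and> I (lf \<beta>)"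
proof -
  have swap: "cmp (cmp q P) P = q" "\<forall>i. hom 1 (P $ i)"
    if "P = vector [X 1, X 2, X 3] \<or> P = vector [X 3, X 2, X 1] \<or> P = vector [X 1, X 3, X 2]" for P q
  proof -
    have "(\<chi> i. cmp (P $ i) P) = (\<chi> i. X i)"
      unfolding vec3_eq using that by auto
    then show "cmp (cmp q P) P = q" by (simp only: cmp_cmp cmp_X)
    show "\<forall>i. hom 1 (P $ i)" using that by (auto simp: forall_3)
  qed
  obtain a1 b1 where 1: "a1 \<noteq> 0 \<or> b1 \<noteq> 0" "I (c3 a1 * X 1 + c3 b1 * X 2)"
    using pideal_linear_form_in_two_variables[OF assms swap, of "vector [X 1, X 2, X 3]"] by auto
  obtain a2 b2 where 2: "a2 \<noteq> 0 \<or> b2 \<noteq> 0" "I (c3 a2 * X 3 + c3 b2 * X 2)"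
    using pideal_linear_form_in_two_variables[OF assms swap, of "vector [X 3, X 2, X 1]"] by auto
  obtain a3 b3 where 3: "a3 \<noteq> 0 \<or> b3 \<noteq> 0" "I (c3 a3 * X 1 + c3 b3 * X 3)"
    using pideal_linear_form_in_two_variables[OF assms swap, of "vector [X 1, X 3, X 2]"] by auto
  define u v w :: "complex ^ 3" where "u = vector [a1, b1, 0]" and "v = vector [0, b2, a2]"
    and "w = vector [a3, 0, b3]"
  have "I (lf u)" "I (lf v)" "I (lf w)"
    using 1 2 3 by (simp_all add: u_def v_def w_def lf_def sum_3 add.commute)
  \<comment> \<open>Each of the three nonzero vectors lies in a different coordinate plane; if they
    were all parallel, they would lie in the intersection of the three planes.\<close>
  moreover have "crs u v \<noteq> 0 \<or> crs v w \<noteq> 0 \<or> crs u w \<noteq> 0"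
    using 1(1) 2(1) 3(1) by (auto simp: u_def v_def w_def vec3_eq)
  ultimately show ?thesis by blast
qed

definition cop3 :: "p3 ^ 3 \<Rightarrow> bool" where
  "cop3 w \<longleftrightarrow> (\<forall>D. (\<forall>i. D dvd w $ i) \<longrightarrow> is_unit D)"

text \<open>With \<open>e = gcd (w $ 1) (w $ 2)\<close>, primality produces a coprime pair in the
  ideal: either \<open>e\<close> and \<open>w $ 3\<close>, or the two cofactors of
  \<open>e\<close>.\<close>

lemma pideal_linear_forms3:
  assumes I: "pideal I" "\<forall>i. I (w $ i)" and w: "cop3 w" "\<forall>i. \<exists>n. hom n (w $ i)"
  shows "\<exists>\<alpha> \<beta>. crs \<alpha> \<beta> \<noteq> 0 \<and> I (lf \<alpha>) \<and> I (lf \<beta>)"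
proof (cases "I 1")
  case True
  have "crs (axis 1 1) (axis 2 (1::complex)) \<noteq> 0" by (auto simp: vec3_eq axis_def)
  then show ?thesis using pidealD(6)[OF I(1) True] by blast
next
  case False
  obtain n1 n2 n3 where n: "hom n1 (w $ 1)" "hom n2 (w $ 2)" "hom n3 (w $ 3)" using w(2) by metis
  define e where "e = gcd (w $ 1) (w $ 2)"
  have ce: "coprime e (w $ 3)"
  proof (rule coprimeI)
    fix D assume "D dvd e" "D dvd w $ 3"
    then have "\<forall>i. D dvd w $ i" by (auto simp: e_def forall_3)
    then show "is_unit D" using w(1) by (auto simp: cop3_def)
  qed
  have e0: "e \<noteq> 0"
  proof
    assume "e = 0"
    then have "is_unit (w $ 3)" using ce by simp
    then obtain g where "1 = w $ 3 * g" by (auto simp: dvd_def)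
    then have "I 1" using I pidealD(4)[OF I(1)] by metis
    then show False using False by blast
  qed
  obtain a b where ab: "w $ 1 = a * e" "w $ 2 = b * e" "coprime a b"
    using gcd_coprime_exists[of "w $ 1" "w $ 2"] e0 unfolding e_def by metis
  show ?thesis
  proof (cases "I e")
    case True
    have "\<exists>j. hom j e"
    proof (cases "w $ 1 = 0")
      case False then show ?thesis using hom_dvd[OF n(1)] by (metis e_def gcd_dvd1)
    next
      case True
      then have "w $ 2 \<noteq> 0" using e0 by (auto simp: e_def)
      then show ?thesis using hom_dvd[OF n(2)] by (metis e_def gcd_dvd2)
    qed
    then show ?thesis using pideal_linear_forms[OF I(1) True _ ce] I(2) n(3) by blast
  next
    case False
    then have "I a" "I b" using I ab pidealD(5)[OF I(1)] by metis+
    moreover have "\<exists>j. hom j f" if "f * e = w $ i" "hom k (w $ i)" for f k i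
      using that e0 hom_dvd by (metis dvd_triv_left hom_0 mult_eq_0_iff)
    ultimately show ?thesis using pideal_linear_forms[OF I(1) _ _ ab(3)] ab n by metis
  qed
qed

section \<open>Nondegenerate triples of forms\<close>

definition nondeg :: "nat \<Rightarrow> p3 ^ 3 \<Rightarrow> bool" where
  "nondeg d F \<longleftrightarrow> d > 0 \<and> (\<forall>i. hom d (F $ i)) \<and> (\<forall>v. evv F v = 0 \<longrightarrow> v = 0)"

text \<open>\<open>y\<close> is a multiple of \<open>crs \<alpha> \<beta>\<close>, whose pairing
  with its conjugate is a nonzero sum of squared moduli. So the conjugate serves as a third
  independent linear form.\<close>

lemma dot_evv_zero:
  assumes "dot \<alpha> y = 0" "dot \<beta> y = 0" "dot (\<chi> i. cnj (crs \<alpha> \<beta> $ i)) y = 0" "crs \<alpha> \<beta> \<noteq> 0"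
  shows "y = 0"
proof -
  obtain c where c: "y = c *s crs \<alpha> \<beta>" using orthogonal_parallel assms by blast
  have "c * (\<Sum>i\<in>UNIV. of_real ((cmod (crs \<alpha> \<beta> $ i))\<^sup>2)) = 0"
  proof -
    have "cnj a * (c * a) = c * of_real ((cmod a)\<^sup>2)" for a
      unfolding complex_norm_square by (simp only: ac_simps)
    then show ?thesis using assms(3) unfolding c by (simp only: dot_def sum_distrib_left vec_lambda_beta vector_smult_component)
  qed
  moreover have "(\<Sum>i\<in>UNIV. complex_of_real ((cmod (crs \<alpha> \<beta> $ i))\<^sup>2)) =
      of_real (\<Sum>i\<in>UNIV. (cmod (crs \<alpha> \<beta> $ i))\<^sup>2)" by simp
  moreover have "(\<Sum>i\<in>UNIV. (cmod (crs \<alpha> \<beta> $ i))\<^sup>2) \<noteq> 0"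
    using assms(4) by (simp add: sum_nonneg_eq_0_iff vec_eq_iff)
  ultimately have "c = 0" by (metis mult_eq_0_iff of_real_eq_0_iff)
  then show ?thesis using c by simp
qed

lemma ev_cmp_lf: "ev (cmp (lf \<alpha>) F) v = dot \<alpha> (evv F v)"
  by (simp only: ev_cmp ev_lf)

text \<open>A curve cannot be contracted to the point where two lines meet: it would meet the preimage
  of a third line.\<close>

lemma nondeg_no_common_divisor:
  assumes F: "nondeg d F" and H: "H dvd cmp (lf \<alpha>) F" "H dvd cmp (lf \<beta>) F" "\<not> is_unit H"
    and ab: "crs \<alpha> \<beta> \<noteq> 0"
  shows False
proof -
  define \<gamma> where "\<gamma> = (\<chi> i. cnj (crs \<alpha> \<beta> $ i))"
  have F': "d > 0" "\<forall>i. hom d (F $ i)" "\<And>v. evv F v = 0 \<Longrightarrow> v = 0" using F by (auto simp: nondeg_def)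
  have h: "hom d (cmp (lf \<delta>) F)" for \<delta> using hom_cmp[OF hom_lf F'(2)] by simp
  have "\<exists>v. v \<noteq> 0 \<and> ev (cmp (lf \<alpha>) F) v = 0 \<and> ev (cmp (lf \<beta>) F) v = 0 \<and> ev (cmp (lf \<gamma>) F) v = 0"
  proof (cases "cmp (lf \<alpha>) F = 0")
    case True
    then show ?thesis using plane_curves_meet[OF h F'(1) h F'(1), of \<beta> \<gamma>] by auto
  next
    case False
    then have "H \<noteq> 0" using H by auto
    obtain j where j: "hom j H" using hom_dvd h False H by blast
    obtain v where "v \<noteq> 0" "ev H v = 0" "ev (cmp (lf \<gamma>) F) v = 0"
      using plane_curves_meet[OF j hom_nonunit_pos[OF j H(3) \<open>H \<noteq> 0\<close>] h F'(1)] by blast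
    moreover from this have "ev (cmp (lf \<alpha>) F) v = 0" "ev (cmp (lf \<beta>) F) v = 0"
      using H(1,2) by (metis dvdE ev_mult mult_zero_left)+
    ultimately show ?thesis by blast
  qed
  then obtain v where "v \<noteq> 0" "evv F v = 0" using dot_evv_zero[OF _ _ _ ab]
    unfolding ev_cmp_lf \<gamma>_def by metis
  then show False using F'(3) by blast
qed

text \<open>For a prime \<open>H\<close>, the polynomials whose composite with \<open>F\<close> is
  divisible by \<open>H\<close> form a prime ideal. If it contained the triple \<open>w\<close>, it
  would contain two independent linear forms, and \<open>F\<close> would contract the curve
  \<open>H = 0\<close> to a point.\<close>

lemma cop3_cmp:
  assumes F: "nondeg d F" and w: "cop3 w" "\<forall>i. \<exists>n. hom n (w $ i)"
  shows "cop3 (\<chi> i. cmp (w $ i) F)"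
  unfolding cop3_def
proof (intro allI impI, rule ccontr)
  fix D assume D: "\<forall>i. D dvd (\<chi> i. cmp (w $ i) F) $ i" "\<not> is_unit D"
  \<comment> \<open>If \<open>D = 0\<close>, zero itself takes the role of the prime: divisibility
    by it means vanishing, and the ring is a domain.\<close>
  obtain H where H: "H dvd D" "\<not> is_unit H" "\<And>p q. H dvd p * q \<Longrightarrow> H dvd p \<or> H dvd q"
  proof (cases "D = 0")
    case True then show ?thesis using that[of 0] by auto
  next
    case False
    then obtain H where "prime H" "H dvd D" using prime_divisor_exists D(2) by blast
    then show ?thesis using that[of H] prime_dvd_mult_iff not_prime_unit by blast
  qed
  have "pideal (\<lambda>q. H dvd cmp q F)" unfolding pideal_def using H(3) by auto
  moreover have "\<forall>i. H dvd cmp (w $ i) F" using D(1) H(1) dvd_trans by auto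
  ultimately obtain \<alpha> \<beta> where "crs \<alpha> \<beta> \<noteq> 0" "H dvd cmp (lf \<alpha>) F" "H dvd cmp (lf \<beta>) F"
    using pideal_linear_forms3[OF _ _ w] by blast
  then show False using nondeg_no_common_divisor[OF F _ _ H(2)] by blast
qed

section \<open>Gradients, the Jacobian and formal trajectories\<close>

definition grad :: "p3 \<Rightarrow> p3 ^ 3" where "grad p = (\<chi> i. pd i p)"

lemma grad_nth [simp]: "grad p $ i = pd i p"
  by (simp add: grad_def)

definition jac :: "p3 ^ 3 \<Rightarrow> p3" where
  "jac F = dot (grad (F $ 1)) (crs (grad (F $ 2)) (grad (F $ 3)))"

lemma evv_dot: "ev (dot U W) v = dot (evv U v) (evv W v)"
  by (simp add: dot_def)

lemma evv_crs: "evv (crs U W) v = crs (evv U v) (evv W v)"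
  by (simp add: vec3_eq)

lemma evv_nonzero: "W \<noteq> 0 \<Longrightarrow> \<exists>v. v \<noteq> 0 \<and> evv W v \<noteq> 0"
proof -
  assume "W \<noteq> 0"
  then obtain i where "W $ i \<noteq> 0" by (auto simp: vec_eq_iff)
  moreover have "X 1 \<noteq> 0" by (simp add: X_def)
  ultimately obtain v where "ev (W $ i * X 1) v \<noteq> 0" using ev_nonzero[of "W $ i * X 1"] by auto
  then show ?thesis by (intro exI[of _ v]) (auto simp: vec_eq_iff)
qed

lemma euler_dot: "hom n p \<Longrightarrow> dot v (evv (grad p) v) = of_nat n * ev p v"
  using arg_cong[OF euler, of n p "\<lambda>q. ev q v"] by (simp add: dot_def)

definition lie :: "p3 ^ 3 \<Rightarrow> p3 \<Rightarrow> p3" where "lie V q = dot V (grad q)"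

lemma lie_add [simp]: "lie V (p + q) = lie V p + lie V q"
  and lie_mult: "lie V (p * q) = lie V p * q + p * lie V q"
  and lie_c3 [simp]: "lie V (c3 c) = 0"
  by (simp_all add: lie_def dot_def sum_3 algebra_simps)

text \<open>The Taylor series of \<open>q\<close> at \<open>p\<close> along the flow of \<open>V\<close>.\<close>

definition flow :: "p3 ^ 3 \<Rightarrow> complex ^ 3 \<Rightarrow> p3 \<Rightarrow> complex fps" where
  "flow V p q = Abs_fps (\<lambda>n. ev ((lie V ^^ n) q) p / fact n)"

lemma flow_nth: "fps_nth (flow V p q) n = ev ((lie V ^^ n) q) p / fact n"
  by (simp add: flow_def)

lemma flow_Suc: "of_nat (Suc n) * fps_nth (flow V p q) (Suc n) = fps_nth (flow V p (lie V q)) n"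
proof -
  have "(lie V ^^ Suc n) q = (lie V ^^ n) (lie V q)" by (simp add: funpow_swap1)
  then show ?thesis unfolding flow_nth by (simp add: field_simps del: funpow.simps of_nat_Suc)
qed

lemma fps_deriv_flow: "fps_deriv (flow V p q) = flow V p (lie V q)"
  by (rule fps_ext) (metis fps_deriv_nth flow_Suc Suc_eq_plus1)

lemma lie_funpow_add: "(lie V ^^ n) (q + q') = (lie V ^^ n) q + (lie V ^^ n) q'"
  by (induction n) auto

lemma flow_add: "flow V p (q + q') = flow V p q + flow V p q'"
  by (rule fps_ext) (simp add: flow_nth lie_funpow_add add_divide_distrib)

text \<open>The exponential of a derivation is a ring homomorphism: the Leibniz rule gives both
  sides the same recursion for their coefficients. As power series form a domain, the kernel of
  \<open>flow V p\<close> is a prime ideal.\<close>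

lemma flow_mult: "flow V p (q * q') = flow V p q * flow V p q'"
proof (rule fps_ext)
  fix n show "fps_nth (flow V p (q * q')) n = fps_nth (flow V p q * flow V p q') n"
  proof (induction n arbitrary: q q')
    case 0 show ?case by (simp add: flow_nth)
  next
    case (Suc n)
    have "of_nat (Suc n) * fps_nth (flow V p (q * q')) (Suc n) =
        fps_nth (flow V p (lie V q * q' + q * lie V q')) n"
      unfolding flow_Suc by (simp only: lie_mult)
    also have "\<dots> = fps_nth (fps_deriv (flow V p q * flow V p q')) n"
      by (simp add: flow_add Suc.IH fps_deriv_flow del: fps_deriv_nth)
    also have "\<dots> = of_nat (Suc n) * fps_nth (flow V p q * flow V p q') (Suc n)"
      by (metis fps_deriv_nth Suc_eq_plus1)
    finally show ?case by (simp del: of_nat_Suc)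
  qed
qed

text \<open>If the Jacobian vanished, some vector field \<open>V\<close> would be tangent to the fibres of \<open>F\<close>. The
  polynomials vanishing along the formal trajectory of \<open>V\<close> through a point \<open>p\<close> form a prime ideal,
  which contains two coprime forms \<open>l \<circ> F\<close>, hence two linear forms; so \<open>V\<close> is radial at \<open>p\<close>,
  against Euler's identity.\<close>

theorem nondeg_jac_nonzero:
  assumes F: "nondeg d F" shows "jac F \<noteq> 0"
proof
  assume J: "jac F = 0"
  have F': "d > 0" "\<forall>i. hom d (F $ i)" "\<And>v. evv F v = 0 \<Longrightarrow> v = 0" using F by (auto simp: nondeg_def)
  let ?g = "\<lambda>j. grad (F $ j)"
  \<comment> \<open>A cross product of two gradients is orthogonal to all three because the Jacobian
    vanishes. If all these products are zero, every gradient is parallel to one nonzero gradient,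
    and any vector orthogonal to it will do.\<close>
  have "\<exists>V. V \<noteq> 0 \<and> (\<forall>j. dot V (?g j) = 0)"
  proof (cases "crs (?g 2) (?g 3) = 0 \<and> crs (?g 3) (?g 1) = 0 \<and> crs (?g 1) (?g 2) = 0")
    case False
    have "dot (crs (?g 2) (?g 3)) (?g j) = 0 \<and> dot (crs (?g 3) (?g 1)) (?g j) = 0 \<and>
        dot (crs (?g 1) (?g 2)) (?g j) = 0" for j
      using J exhaust_3[of j] by (auto simp: jac_def dot_def sum_3 algebra_simps)
    then show ?thesis using False by blast
  next
    case True
    have "\<exists>j. ?g j \<noteq> 0"
    proof (rule ccontr)
      assume "\<not> ?thesis"
      then have "ev (F $ j) v = 0" for j v
        using euler_dot[of d "F $ j" v] F' by (auto simp: dot_def vec_eq_iff)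
      then have "evv F (axis 1 1) = 0" by (simp add: vec_eq_iff)
      from F'(3)[OF this] show False by (simp add: axis_eq_0_iff)
    qed
    then obtain j where j: "?g j \<noteq> 0" by blast
    have "\<exists>e :: p3 ^ 3. crs (?g j) e \<noteq> 0"
    proof (rule ccontr)
      assume "\<not> ?thesis"
      then have "crs (?g j) (axis 1 1) = 0" "crs (?g j) (axis 2 1) = 0" by auto
      then show False using j by (auto simp: vec3_eq axis_def)
    qed
    then obtain e where e: "crs (?g j) e \<noteq> 0" by blast
    have "crs (?g m) (?g j) = 0" for m
      using True exhaust_3[of m] exhaust_3[of j] by (auto simp: vec3_eq algebra_simps)
    then have "dot (crs (?g j) e) (?g m) = 0" for m
      using dot_crs(3)[of "?g m" "?g j" e] by (simp add: dot_def sum_3 algebra_simps)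
    then show ?thesis using e by blast
  qed
  then obtain V where V: "V \<noteq> 0" "\<And>j. dot V (?g j) = 0" by blast
  obtain p where p: "p \<noteq> 0" "evv V p \<noteq> 0" using evv_nonzero V(1) by blast
  \<comment> \<open>If \<open>V\<close> were \<open>c\<close> times the radial vector at
    \<open>p\<close>, Euler's identity would turn its tangency to the fibres into d c F(p) =
    0.\<close>
  have par: "crs p (evv V p) \<noteq> 0"
  proof
    assume "crs p (evv V p) = 0"
    then obtain c where c: "evv V p = c *s p" using crs_zero_parallel p by blast
    have "of_nat d * (c * ev (F $ j) p) = 0" for j
    proof -
      have "0 = dot (evv V p) (evv (?g j) p)" using V(2)[of j] by (metis evv_dot ev_0)
      also have "\<dots> = c * dot p (evv (?g j) p)" unfolding c by (simp add: dot_def sum_3 algebra_simps)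
      finally show ?thesis using euler_dot[of d "F $ j" p] F' by simp
    qed
    moreover have "c \<noteq> 0" using c p by auto
    ultimately have "evv F p = 0" using F' by (auto simp: vec_eq_iff)
    then show False using F'(3) p by blast
  qed
  define y where "y = evv F p"
  have "y \<noteq> 0" using F'(3) p by (auto simp: y_def)
  have "\<exists>\<alpha> \<beta>. dot \<alpha> y = 0 \<and> dot \<beta> y = 0 \<and> crs \<alpha> \<beta> \<noteq> 0"
  proof -
    define e where "e i = crs y (axis i 1)" for i :: 3
    have "dot (e i) y = 0" for i by (simp add: e_def dot_def sum_3 algebra_simps)
    moreover have "crs (e 2) (e 3) \<noteq> 0 \<or> crs (e 1) (e 3) \<noteq> 0 \<or> crs (e 1) (e 2) \<noteq> 0"
      using \<open>y \<noteq> 0\<close> by (auto simp: e_def vec3_eq axis_def)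
    ultimately show ?thesis by blast
  qed
  then obtain \<alpha> \<beta> where ab: "dot \<alpha> y = 0" "dot \<beta> y = 0" "crs \<alpha> \<beta> \<noteq> 0" by blast
  define I where "I q \<longleftrightarrow> flow V p q = 0" for q
  have I: "pideal I"
    unfolding pideal_def I_def
  proof (intro conjI allI impI)
    have "flow V p 0 + flow V p 0 = flow V p 0" by (metis flow_add add_0)
    then show "flow V p 0 = 0" by simp
  qed (auto simp: flow_add flow_mult)
  have IF: "I (cmp (lf \<delta>) F)" if "dot \<delta> y = 0" for \<delta>
  proof -
    have "lie V (cmp (lf \<delta>) F) = (\<Sum>j\<in>UNIV. c3 (\<delta> $ j) * dot V (?g j))"
      by (simp add: lie_def dot_def sum_3 algebra_simps)
    then have 1: "lie V (cmp (lf \<delta>) F) = c3 0" by (simp add: V(2))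
    have "(lie V ^^ n) (c3 0) = c3 0" for n by (induction n) (use lie_c3[of V 0] in simp_all)
    then have "(lie V ^^ Suc n) (cmp (lf \<delta>) F) = 0" for n
      unfolding funpow_Suc_right comp_def 1 by simp
    moreover have "ev (cmp (lf \<delta>) F) p = 0" using that by (simp only: ev_cmp_lf y_def)
    ultimately have "ev ((lie V ^^ n) (cmp (lf \<delta>) F)) p = 0" for n
      by (cases n) (simp_all del: cmp_lf funpow.simps(2))
    then show ?thesis unfolding I_def by (intro fps_ext) (simp only: flow_nth fps_zero_nth div_0)
  qed
  have "coprime (cmp (lf \<alpha>) F) (cmp (lf \<beta>) F)"
    using nondeg_no_common_divisor[OF F _ _ _ ab(3)] not_coprimeE by metis
  moreover have "hom (d * 1) (cmp (lf \<delta>) F)" for \<delta> using F'(2) by (intro hom_cmp) auto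
  ultimately obtain \<alpha>' \<beta>' where l: "crs \<alpha>' \<beta>' \<noteq> 0" "I (lf \<alpha>')" "I (lf \<beta>')"
    using pideal_linear_forms[OF I IF[OF ab(1)] IF[OF ab(2)]] by blast
  \<comment> \<open>The first two Taylor coefficients of a linear form along the trajectory are its
    values at the point and at the velocity.\<close>
  have "dot \<delta> p = 0 \<and> dot \<delta> (evv V p) = 0" if "I (lf \<delta>)" for \<delta>
  proof -
    have "fps_nth (flow V p (lf \<delta>)) 0 = 0" "fps_nth (flow V p (lf \<delta>)) 1 = 0"
      using that by (simp_all add: I_def)
    then show ?thesis by (simp add: flow_nth lie_def dot_def mult.commute)
  qed
  then have "dot \<alpha>' p = 0" "dot \<alpha>' (evv V p) = 0" "dot \<beta>' p = 0" "dot \<beta>' (evv V p) = 0"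
    using l by blast+
  then obtain s t where "p = s *s crs \<alpha>' \<beta>'" "evv V p = t *s crs \<alpha>' \<beta>'"
    using orthogonal_parallel l(1) by meson
  then have "crs p (evv V p) = 0" by (simp add: vec3_eq)
  then show False using par by blast
qed

section \<open>The foliation defined by an invariant pencil\<close>

definition omega :: "p3 \<Rightarrow> p3 \<Rightarrow> p3 ^ 3" where
  "omega A B = (\<chi> i. A * pd i B - B * pd i A)"

lemma omega_nth [simp]: "omega A B $ i = A * pd i B - B * pd i A"
  by (simp add: omega_def)

lemma crs_dual_basis:
  fixes a b :: "complex ^ 3"
  assumes "crs a b \<noteq> 0"
  shows "\<exists>p q. dot a p = 1 \<and> dot b p = 0 \<and> dot a q = 0 \<and> dot b q = 1"
proof -
  \<comment> \<open>\<open>g\<close> completes \<open>a\<close>, \<open>b\<close> to a basis;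
    \<open>crs b g\<close> and \<open>crs g a\<close>, divided by \<open>N\<close>, are the required
    members of the dual basis.\<close>
  define g where "g = (\<chi> i. cnj (crs a b $ i))"
  define N where "N = dot (crs a b) g"
  have "N \<noteq> 0"
  proof
    assume "N = 0"
    then have "dot g (crs a b) = 0" by (simp add: N_def dot_def mult.commute)
    then have "crs a b = 0"
      using dot_evv_zero[of a "crs a b" b] assms by (auto simp: dot_crs g_def)
    then show False using assms by simp
  qed
  then show ?thesis
  proof -
    have 1: "dot u (inverse N *s w) = inverse N * dot u w" for u w
      by (simp add: dot_def sum_3 algebra_simps)
    have "dot a (crs b g) = N" "dot b (crs g a) = N" "dot b (crs b g) = 0" "dot a (crs g a) = 0"
      unfolding N_def by (simp_all add: dot_def sum_3 algebra_simps)
    then show ?thesis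
      using \<open>N \<noteq> 0\<close> by - (rule exI[of _ "inverse N *s crs b g"], rule exI[of _ "inverse N *s crs g a"],
        simp add: 1)
  qed
qed

text \<open>The fibres of \<open>A / B\<close> are mapped into fibres of \<open>A / B\<close>, so \<open>E / G\<close> cannot be independent of
  \<open>A / B\<close> near any point: else, by the open mapping theorem, it would be nonconstant on a fibre.\<close>

lemma omega_parallel:
  assumes inv: "\<And>c. \<exists>s t. (s \<noteq> 0 \<or> t \<noteq> 0) \<and>
      (\<forall>v. ev A v = c * ev B v \<longrightarrow> s * ev E v + t * ev G v = 0)"
    and B: "B \<noteq> 0"
  shows "crs (omega A B) (omega E G) = 0"
proof (rule ccontr)
  assume "\<not> ?thesis"
  then have "(\<chi> i. B * crs (omega A B) (omega E G) $ i) \<noteq> 0" using B by (auto simp: vec_eq_iff)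
  then obtain v where "evv (\<chi> i. B * crs (omega A B) (omega E G) $ i) v \<noteq> 0" using evv_nonzero by blast
  then have v: "ev B v \<noteq> 0" "crs (evv (omega A B) v) (evv (omega E G) v) \<noteq> 0"
    unfolding evv_crs[symmetric] by (auto simp: vec_eq_iff)
  define c where "c = ev A v / ev B v"
  obtain s t where st: "s \<noteq> 0 \<or> t \<noteq> 0" "\<And>v. ev A v = c * ev B v \<Longrightarrow> s * ev E v + t * ev G v = 0"
    using inv by blast
  define \<psi> where "\<psi> = A - c3 c * B"
  define \<phi> where "\<phi> = c3 s * E + c3 t * G"
  define a where "a = evv (grad \<psi>) v"
  define b where "b = evv (grad \<phi>) v"
  have 0: "s * ev E v + t * ev G v = 0" using st(2)[of v] v(1) by (simp add: c_def)
  \<comment> \<open>The values of \<open>E\<close> and \<open>G\<close> at \<open>v\<close> form a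
    pair orthogonal to \<open>(s, t)\<close>, hence proportional to \<open>(t, - s)\<close>.\<close>
  have "\<exists>\<mu>. ev E v = \<mu> * t \<and> ev G v = - \<mu> * s"
  proof (cases "t = 0")
    case True then show ?thesis using 0 st(1) by (intro exI[of _ "- ev G v / s"]) auto
  next
    case False then show ?thesis using 0
      by (intro exI[of _ "ev E v / t"]) (auto simp: field_simps add_eq_0_iff2)
  qed
  then obtain \<mu> where \<mu>: "ev E v = \<mu> * t" "ev G v = - \<mu> * s" by blast
  \<comment> \<open>At a point with \<open>A = c B\<close>, the form A dB - B dA is a multiple of
    the differential of \<open>\<psi>\<close>. Likewise \<open>omega E G\<close> is one of the
    differential of \<open>\<phi>\<close>, so these differentials are independent at
    \<open>v\<close>.\<close>
  have "evv (omega A B) v = (- ev B v) *s a"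
    using v(1) by (simp add: vec_eq_iff a_def \<psi>_def c_def field_simps)
  moreover have "evv (omega E G) v = \<mu> *s b"
    by (simp add: vec_eq_iff b_def \<phi>_def \<mu> algebra_simps)
  ultimately have "crs a b \<noteq> 0" using v(2) by (auto simp: vec3_eq)
  then obtain p q where pq: "dot a p = 1" "dot b p = 0" "dot a q = 0" "dot b q = 1"
    using crs_dual_basis by blast
  define f where "f = (\<lambda>u. (ev \<psi> u, ev \<phi> u))"
  define g' where "g' = (\<lambda>xy::complex \<times> complex. fst xy *s p + snd xy *s q)"
  have "f v \<in> interior (f ` UNIV)"
  proof (rule sussmann_open_mapping[where S = UNIV and g' = g' and f' = "\<lambda>h. (dot a h, dot b h)"])
    have d: "(f has_derivative (\<lambda>h. (\<Sum>i\<in>UNIV. ev (pd i \<psi>) u * h $ i, \<Sum>i\<in>UNIV. ev (pd i \<phi>) u * h $ i))) (at u)" for u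
      unfolding f_def by (intro has_derivative_Pair has_derivative_ev)
    show "(f has_derivative (\<lambda>h. (dot a h, dot b h))) (at v)"
      using d[of v] by (simp add: dot_def a_def b_def)
    show "continuous_on UNIV f"
      using has_derivative_continuous[OF d] by (intro continuous_at_imp_continuous_on) blast
    show "bounded_linear g'"
      unfolding g'_def
      by (rule linear_conv_bounded_linear[THEN iffD1], rule linearI) (simp_all add: vec_eq_iff algebra_simps)
    have "dot a (x *s p + y *s q) = x * dot a p + y * dot a q" for a x y
      by (simp add: dot_def sum_3 algebra_simps)
    then show "(\<lambda>h. (dot a h, dot b h)) \<circ> g' = id" by (auto simp: g'_def pq)
  qed auto
  then obtain e where e: "e > 0" "ball (f v) e \<subseteq> range f" by (meson mem_interior)
  have "f v = (0, 0)" using v(1) 0 by (simp add: f_def \<psi>_def \<phi>_def c_def)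
  \<comment> \<open>A preimage of this point lies on the fibre of \<open>A / B\<close> through
    \<open>v\<close>, while the nonzero second coordinate contradicts the choice of \<open>s\<close>
    and \<open>t\<close>.\<close>
  then have "(0, of_real (e / 2)) \<in> ball (f v) e" using e(1) by (simp add: dist_Pair_Pair)
  then obtain u where u: "f u = (0, of_real (e / 2))" using e(2) by (metis imageE subsetD)
  then have "ev \<psi> u = 0" "ev \<phi> u = of_real (e / 2)" by (simp_all add: f_def)
  then have "ev A u = c * ev B u" "s * ev E u + t * ev G u \<noteq> 0"
    using e(1) by (simp_all add: \<psi>_def \<phi>_def del: of_real_divide)
  then show False using st(2) by blast
qed

lemma coprime_hom_nonzero: "coprime A B \<Longrightarrow> hom n A \<Longrightarrow> hom n B \<Longrightarrow> n > 0 \<Longrightarrow> A \<noteq> 0"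
proof
  assume *: "coprime A B" "hom n A" "hom n B" "n > 0" "A = 0"
  then have "is_unit B" by simp
  then obtain g where "1 = B * g" by (auto simp: dvd_def)
  from arg_cong[OF this, of "\<lambda>q. ev q 0"] show False using hom_at_0[OF *(3,4)] by simp
qed

text \<open>By coprimality \<open>A\<close> divides \<open>p\<close> and \<open>B\<close> divides
  \<open>q\<close>, whose degrees are too small. Applied when a derivation that lowers degrees
  annihilates the ratio \<open>A / B\<close>.\<close>

lemma hom_dvd_derivation_zero:
  assumes "coprime A B" "hom n A" "hom n B" "n > 0" and "A * q = B * p" "hom (n - 1) p" "hom (n - 1) q"
  shows "p = 0 \<and> q = 0"
proof -
  have "A dvd B * p" "B dvd A * q" using assms(5) by (metis dvd_triv_left)+
  then have "A dvd p" "B dvd q" using assms(1)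
    by (simp_all add: coprime_dvd_mult_right_iff coprime_commute)
  then show ?thesis using hom_dvd_small[of n A "n - 1" p] hom_dvd_small[of n B "n - 1" q] assms by auto
qed

lemma omega_nonzero:
  assumes "coprime E G" "hom n E" "hom n G" "n > 0" shows "omega E G \<noteq> 0"
proof
  assume "omega E G = 0"
  then have "E * pd i G = G * pd i E" for i by (metis eq_iff_diff_eq_0 omega_nth zero_index)
  then have "pd i E = 0" for i
    using hom_dvd_derivation_zero[OF assms] hom_pd assms by blast
  then have "of_nat n * E = 0" using euler[OF assms(2)] by simp
  then show False using assms coprime_hom_nonzero by simp
qed

abbreviation XX :: "p3 ^ 3" where "XX \<equiv> (\<chi> i. X i)"

lemma dot_XX_omega: "hom n A \<Longrightarrow> hom n B \<Longrightarrow> dot XX (omega A B) = 0"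
proof -
  assume *: "hom n A" "hom n B"
  have "dot XX (omega A B) = A * (\<Sum>i\<in>UNIV. X i * pd i B) - B * (\<Sum>i\<in>UNIV. X i * pd i A)"
    by (simp add: dot_def sum_3 algebra_simps)
  then show ?thesis using euler[OF *(1)] euler[OF *(2)] by simp
qed

lemma hom_omega: "hom n A \<Longrightarrow> hom n B \<Longrightarrow> n > 0 \<Longrightarrow> hom (2 * n - 1) (omega A B $ i)"
  by (auto intro!: hom_diff hom_mult' hom_pd)

section \<open>Triples of polynomials without common factor\<close>

lemma extract_gcd:
  fixes W :: "p3 ^ 3"
  assumes "W \<noteq> 0" shows "\<exists>D w. (\<forall>i. W $ i = D * w $ i) \<and> cop3 w \<and> D \<noteq> 0"
proof -
  define D where "D = gcd (W $ 1) (gcd (W $ 2) (W $ 3))"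
  have D0: "D \<noteq> 0" using assms by (auto simp: D_def vec3_eq)
  have "D dvd W $ i" for i
    using exhaust_3[of i] unfolding D_def
    by (elim disjE) (auto intro: dvd_trans[OF gcd_dvd2])
  then obtain w where w: "\<And>i. W $ i = D * w i" unfolding dvd_def by metis
  have "is_unit D'" if "\<And>i. D' dvd w i" for D'
  proof -
    have "D * D' dvd W $ i" for i unfolding w using that by (simp add: mult_dvd_mono)
    then have "D * D' dvd D * 1" by (simp add: D_def)
    then show ?thesis using D0 by simp
  qed
  then show ?thesis using w D0 by (intro exI[of _ D], intro exI[of _ "\<chi> i. w i"]) (auto simp: cop3_def)
qed

lemma cop3_dvd:
  assumes "cop3 w" "\<And>i. q dvd u * w $ i" shows "q dvd u"
proof -
  have g: "q dvd u * gcd a b" if "q dvd u * a" "q dvd u * b" for a b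
    using gcd_greatest[OF that] by (simp add: gcd_mult_left)
  have "q dvd u * gcd (w $ 1) (gcd (w $ 2) (w $ 3))" using assms(2) by (intro g)
  moreover have "is_unit (gcd (w $ 1) (gcd (w $ 2) (w $ 3)))"
  proof -
    have "\<forall>i. gcd (w $ 1) (gcd (w $ 2) (w $ 3)) dvd w $ i"
      unfolding forall_3 by (auto intro: dvd_trans[OF gcd_dvd2])
    then show ?thesis using assms(1) unfolding cop3_def by blast
  qed
  ultimately show ?thesis using dvd_mult_unit_iff by blast
qed

text \<open>Proportionality over the field of fractions has no denominator here:
  \<open>w $ i\<close> divides \<open>u $ i * w $ j\<close> for every \<open>j\<close>, hence
  divides \<open>u $ i\<close>.\<close>

lemma crs_zero_multiple:
  assumes "cop3 w" "crs w u = 0" shows "\<exists>S. \<forall>i. u $ i = S * w $ i"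
proof -
  have e: "u $ j * w $ i = u $ i * w $ j" for i j
    using assms(2) exhaust_3[of i] exhaust_3[of j] by (auto simp: vec3_eq algebra_simps)
  have "\<exists>i. w $ i \<noteq> 0" using assms(1) unfolding cop3_def by (metis dvd_0_right not_is_unit_0)
  then obtain i where i: "w $ i \<noteq> 0" by blast
  have "w $ i dvd u $ i" by (rule cop3_dvd[OF assms(1)]) (metis dvd_triv_right e)
  then obtain S where S: "u $ i = w $ i * S" by blast
  have "u $ j = S * w $ j" for j
  proof -
    have "u $ j * w $ i = (S * w $ j) * w $ i" unfolding e[of j i] S by (simp add: algebra_simps)
    then show ?thesis using i by simp
  qed
  then show ?thesis by blast
qed

section \<open>Action of the Jacobian matrix on forms and vector fields\<close>

definition pull :: "p3 ^ 3 \<Rightarrow> p3 ^ 3 \<Rightarrow> p3 ^ 3" where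
  "pull F u = (\<chi> i. \<Sum>j\<in>UNIV. u $ j * pd i (F $ j))"

text \<open>The cofactor matrix of the Jacobian matrix. It inverts the transposed matrix
  \<open>pull\<close> up to the factor \<open>jac F\<close>, and carries a cross product to the
  cross product of the images under \<open>push\<close>.\<close>

definition cof :: "p3 ^ 3 \<Rightarrow> p3 ^ 3 \<Rightarrow> p3 ^ 3" where
  "cof F u = vector [dot (crs (grad (F $ 2)) (grad (F $ 3))) u,
    dot (crs (grad (F $ 3)) (grad (F $ 1))) u, dot (crs (grad (F $ 1)) (grad (F $ 2))) u]"

definition push :: "p3 ^ 3 \<Rightarrow> p3 ^ 3 \<Rightarrow> p3 ^ 3" where
  "push F u = (\<chi> j. dot (grad (F $ j)) u)"

lemma cof_pull: "cof F (pull F u) $ i = jac F * u $ i"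
  using exhaust_3[of i]
  by (auto simp: cof_def pull_def jac_def dot_def sum_3) (simp_all add: algebra_simps)

lemma cof_crs: "cof F (crs a b) = crs (push F a) (push F b)"
  unfolding vec3_eq by (simp add: cof_def push_def dot_def sum_3 algebra_simps)

lemma cof_scale: "(\<And>i. u $ i = K * w $ i) \<Longrightarrow> cof F u $ i = K * cof F w $ i"
  using exhaust_3[of i] by (auto simp: cof_def dot_def sum_3 algebra_simps)

lemma hom_jac: assumes "\<forall>i. hom d (F $ i)" shows "hom (3 * (d - 1)) (jac F)"
proof -
  have h: "hom (d - 1) (pd i (F $ j))" for i j using assms hom_pd by blast
  show ?thesis unfolding jac_def dot_def sum_3 crs_nth grad_nth
    by (intro hom_add hom_diff hom_mult'[OF h hom_diff[OF hom_mult[OF h h] hom_mult[OF h h]]]) simp_all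
qed

lemma coprime_cmp:
  assumes F: "nondeg d F" and AB: "coprime A B" "hom k A" "hom k B"
  shows "coprime (cmp A F) (cmp B F)"
proof -
  have "cop3 (vector [A, B, 0])" using AB(1) by (auto simp: cop3_def forall_3 intro: coprime_common_divisor)
  moreover have "\<forall>i. \<exists>n. hom n (vector [A, B, 0] $ (i::3))"
    unfolding forall_3 using AB by (auto intro: exI[of _ k])
  ultimately have "cop3 (\<chi> i. cmp (vector [A, B, 0] $ i) F)" using cop3_cmp[OF F] by blast
  then show ?thesis by (auto simp: cop3_def forall_3 intro!: coprimeI)
qed

text \<open>\<open>omega E G\<close> is \<open>cmp D F\<close> times the pullback of
  \<open>w\<close>, and also a multiple of \<open>w\<close> because it defines the same foliation.
  Removing common factors leaves \<open>K\<close>. For \<open>n = 2\<close>, \<open>K\<close>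
  already has the degree \<open>3 (d - 1)\<close> of the Jacobian, so the quotient is
  constant.\<close>

theorem invariant_foliation:
  assumes F: "nondeg d F" and AB: "coprime A B" "hom k A" "hom k B" "k > 0"
    and inv: "\<And>c. \<exists>s t. (s \<noteq> 0 \<or> t \<noteq> 0) \<and>
      (\<forall>v. ev A v = c * ev B v \<longrightarrow> s * ev (cmp A F) v + t * ev (cmp B F) v = 0)"
    and w: "\<And>i. omega A B $ i = D * w $ i" "cop3 w" "\<And>i. hom n (w $ i)"
  shows "\<exists>K. (\<forall>i. jac F * cmp (w $ i) F = K * cof F w $ i) \<and> K \<noteq> 0 \<and>
    (d > 1 \<longrightarrow> n \<le> 2) \<and> (n = 2 \<longrightarrow> (\<exists>c. c \<noteq> 0 \<and> jac F = c3 c * K))"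
proof -
  have F': "d > 0" "\<forall>i. hom d (F $ i)" using F by (auto simp: nondeg_def)
  define E where "E = cmp A F"
  define G where "G = cmp B F"
  have hEG: "hom (d * k) E" "hom (d * k) G" using hom_cmp[OF _ F'(2)] AB by (auto simp: E_def G_def)
  have AB0: "A \<noteq> 0" "B \<noteq> 0" using coprime_hom_nonzero AB coprime_commute by blast+
  have cEG: "coprime E G" unfolding E_def G_def by (rule coprime_cmp[OF F AB(1-3)])
  define wF where "wF = (\<chi> i. cmp (w $ i) F)"
  have cwF: "cop3 wF" unfolding wF_def using cop3_cmp[OF F w(2)] w(3) by blast
  have om: "omega E G $ i = cmp D F * pull F wF $ i" for i
  proof -
    have "omega E G $ i = (\<Sum>j\<in>UNIV. cmp (omega A B $ j) F * pd i (F $ j))"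
      by (simp add: E_def G_def pd_cmp sum_3 algebra_simps)
    also have "\<dots> = cmp D F * pull F wF $ i"
      by (simp only: w(1)) (simp add: pull_def wF_def sum_3 algebra_simps)
    finally show ?thesis .
  qed
  have om0: "omega E G \<noteq> 0" using omega_nonzero[OF cEG hEG] F'(1) AB(4) by simp
  have omA0: "omega A B \<noteq> 0" using omega_nonzero AB by blast
  have "D \<noteq> 0" using omA0 w(1) by (auto simp: vec_eq_iff)
  have "crs (omega A B) (omega E G) = 0" using omega_parallel[OF inv AB0(2)] by (simp add: E_def G_def)
  then have "D * crs w (omega E G) $ i = 0" for i
    using exhaust_3[of i] by (auto simp: vec3_eq w(1) algebra_simps simp del: omega_nth)
  then have "crs w (omega E G) = 0" using \<open>D \<noteq> 0\<close> by (simp add: vec_eq_iff)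
  then obtain S where S: "\<And>i. omega E G $ i = S * w $ i" using crs_zero_multiple[OF w(2)] by blast
  have "cmp D F dvd S" by (rule cop3_dvd[OF w(2)]) (metis om S dvd_triv_left)
  then obtain K where K: "S = cmp D F * K" by blast
  have DF0: "cmp D F \<noteq> 0" using om0 om by (auto simp: vec_eq_iff)
  have K0: "K \<noteq> 0" using om0 S K by (auto simp: vec_eq_iff)
  have "cmp D F * pull F wF $ i = cmp D F * (K * w $ i)" for i using om[of i] S[of i] K by (simp add: mult.assoc)
  then have pw: "pull F wF $ i = K * w $ i" for i using DF0 by (simp only: mult_cancel_left) simp
  \<comment> \<open>The cofactor matrix undoes the pullback up to the Jacobian; as \<open>wF\<close>
    has no common factor, \<open>K\<close> divides the Jacobian.\<close>
  have jw: "jac F * wF $ i = K * cof F w $ i" for i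
    using cof_pull[of F wF i] cof_scale[OF pw, of F i] by simp
  have "K dvd jac F" by (rule cop3_dvd[OF cwF]) (metis jw dvd_triv_left)
  then obtain T where T: "jac F = K * T" by blast
  have J0: "jac F \<noteq> 0" using nondeg_jac_nonzero F by blast
  obtain j j' where j: "hom j K" "hom j' T" "j + j' = 3 * (d - 1)"
    using hom_factor hom_jac[OF F'(2)] T J0 by metis
  obtain i where i: "omega E G $ i \<noteq> 0" using om0 by (auto simp: vec_eq_iff)
  then have "omega A B $ i \<noteq> 0" using S[of i] w(1)[of i] \<open>D \<noteq> 0\<close> by (auto simp del: omega_nth)
  have wi: "w $ i \<noteq> 0" using i S[of i] by auto
  have "\<exists>\<delta>. hom \<delta> D \<and> \<delta> + n = 2 * k - 1"
  proof -
    have "hom (2 * k - 1) (D * w $ i)" "D * w $ i \<noteq> 0"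
      using hom_omega[OF AB(2,3,4), of i] w(1)[of i] \<open>omega A B $ i \<noteq> 0\<close> by (simp_all del: omega_nth)
    from hom_factor[OF this] obtain a b where "hom a D" "hom b (w $ i)" "a + b = 2 * k - 1" by blast
    then show ?thesis using hom_unique w(3) wi by metis
  qed
  then obtain \<delta> where \<delta>: "hom \<delta> D" "\<delta> + n = 2 * k - 1" by blast
  \<comment> \<open>The degree of a nonzero coefficient is computed from the factorization and from
    the degree \<open>d * k\<close> of \<open>E\<close> and \<open>G\<close>; this determines
    \<open>j\<close>.\<close>
  have "hom (d * \<delta> + j + n) (omega E G $ i)"
    unfolding S K by (intro hom_mult hom_cmp \<delta> F'(2) j w(3))
  moreover have "hom (2 * (d * k) - 1) (omega E G $ i)" using hom_omega[OF hEG] F'(1) AB(4) by simp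
  ultimately have "d * \<delta> + j + n = 2 * (d * k) - 1" using hom_unique i by blast
  moreover have "d * (\<delta> + n) = 2 * (d * k) - d" using \<delta>(2) by (simp add: right_diff_distrib' ac_simps)
  moreover have "2 * (d * k) \<ge> d" using AB(4) by (cases k) auto
  ultimately have "j + n + 1 = d * (n + 1)"
    using F'(1) unfolding distrib_left mult_1_right by linarith
  then have jn: "j = (d - 1) * (n + 1)" using F'(1) by (cases d) (auto simp: algebra_simps)
  have n2: "n \<le> 2" if "d > 1"
  proof -
    have "(d - 1) * (n + 1) \<le> (d - 1) * 3" using j(3) unfolding jn by linarith
    then have "n + 1 \<le> 3" using that by (metis nat_mult_le_cancel1 zero_less_diff)
    then show ?thesis by simp
  qed
  have "\<exists>c. c \<noteq> 0 \<and> jac F = c3 c * K" if "n = 2"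
  proof -
    have "hom 0 T" using j jn that by simp
    then have "T = c3 (ev T 0)" using hom_0_const by blast
    then show ?thesis using T J0 by (metis c3_simps(1) mult.commute mult_zero_left)
  qed
  then show ?thesis using jw K0 n2 unfolding wF_def by auto
qed

definition mv :: "complex ^ 3 ^ 3 \<Rightarrow> p3 ^ 3" where "mv M = (\<chi> i. lf (M $ i))"

lemma mv_nth [simp]: "mv M $ i = lf (M $ i)"
  by (simp add: mv_def)

lemma evv_mv: "evv (mv M) v = M *v v"
  by (simp add: vec_eq_iff dot_def matrix_vector_mult_def)

lemma cop3_nondeg: assumes "nondeg d F" shows "cop3 F"
  unfolding cop3_def
proof (intro allI impI, rule ccontr)
  fix D assume D: "\<forall>i. D dvd F $ i" "\<not> is_unit D"
  have e: "cmp (lf (axis 1 1)) F = F $ 1" "cmp (lf (axis 2 1)) F = F $ 2"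
    by (simp_all add: sum_3 axis_def)
  have "crs (axis 1 1) (axis 2 (1::complex)) \<noteq> 0" by (auto simp: vec3_eq axis_def)
  then show False using nondeg_no_common_divisor[OF assms _ _ D(2), of "axis 1 1" "axis 2 1"] D(1)
    unfolding e by blast
qed

text \<open>\<open>cof F\<close> of the cross product is
  \<open>crs (push F XX) (push F (mv M))\<close>, and \<open>push F XX\<close> is \<open>d\<close>
  times \<open>F\<close> by Euler. After cancelling \<open>K\<close>, c M F - d DF M is parallel to
  \<open>F\<close>; both have degree \<open>d\<close>, so the factor is constant. The resulting
  \<kappa> is d / c.\<close>

lemma linear_foliation_equivariance:
  assumes F: "nondeg d F" and AB: "coprime A B" "hom k A" "hom k B" "k > 0"
    and inv: "\<And>c. \<exists>s t. (s \<noteq> 0 \<or> t \<noteq> 0) \<and>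
      (\<forall>v. ev A v = c * ev B v \<longrightarrow> s * ev (cmp A F) v + t * ev (cmp B F) v = 0)"
    and w: "\<And>i. omega A B $ i = D * crs XX (mv M) $ i" "cop3 (crs XX (mv M))"
  shows "\<exists>\<kappa> h. \<kappa> \<noteq> 0 \<and> (\<forall>v. M *v evv F v = \<kappa> *s evv (push F (mv M)) v + h *s evv F v)"
proof -
  have F': "d > 0" "\<forall>i. hom d (F $ i)" using F by (auto simp: nondeg_def)
  have hw: "hom 2 (crs XX (mv M) $ i)" for i
    using exhaust_3[of i] by (auto intro!: hom_diff hom_mult'[where n = 1 and m = 1])
  obtain K c where K: "\<And>i. jac F * cmp (crs XX (mv M) $ i) F = K * cof F (crs XX (mv M)) $ i"
    "K \<noteq> 0" "c \<noteq> 0" "jac F = c3 c * K"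
    using invariant_foliation[OF F AB inv w hw] by blast
  define MF where "MF = (\<chi> j. cmp (lf (M $ j)) F)"
  define DM where "DM = push F (mv M)"
  have "push F XX $ j = of_nat d * F $ j" for j
    using euler[of d "F $ j"] F'(2) by (simp add: push_def dot_def mult.commute)
  then have pX: "push F XX = (\<chi> j. of_nat d * F $ j)" by (simp add: vec_eq_iff)
  have wF: "cmp (crs XX (mv M) $ i) F = crs F MF $ i" for i
    using exhaust_3[of i] by (auto simp: MF_def)
  have "K * (c3 c * crs F MF $ i) = K * (of_nat d * crs F DM $ i)" for i
  proof -
    have "K * (c3 c * crs F MF $ i) = K * crs (push F XX) DM $ i"
      using K(1)[of i] unfolding wF cof_crs DM_def[symmetric] by (simp add: K(4) ac_simps)
    then show ?thesis using exhaust_3[of i] by (auto simp: pX algebra_simps)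
  qed
  then have e: "c3 c * crs F MF $ i = of_nat d * crs F DM $ i" for i using K(2) by simp
  define U where "U = (\<chi> j. c3 c * MF $ j - of_nat d * DM $ j)"
  have "crs F U = 0"
    using e[of 1] e[of 2] e[of 3] unfolding vec3_eq by (simp add: U_def algebra_simps)
  then obtain h where h: "\<And>j. U $ j = h * F $ j" using crs_zero_multiple cop3_nondeg[OF F] by blast
  have "hom d (U $ j)" for j
  proof -
    have "hom d (MF $ j)" using hom_cmp[OF hom_lf F'(2)] by (simp add: MF_def)
    moreover have "hom d (DM $ j)"
      unfolding DM_def push_def dot_def vec_lambda_beta mv_nth grad_nth
      using F' by (intro hom_sum hom_mult'[OF hom_pd hom_lf]) auto
    moreover have "hom d (of_nat d * DM $ j)"
      by (rule hom_mult'[OF _ \<open>hom d (DM $ j)\<close>, of 0]) (auto simp: hom_def)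
    ultimately show ?thesis unfolding U_def by (auto intro!: hom_diff hom_c3_mult)
  qed
  then have "\<exists>h0. h = c3 h0"
  proof (cases "h = 0")
    case True then show ?thesis by (intro exI[of _ 0]) simp
  next
    case False
    obtain j where "F $ j \<noteq> 0" using cop3_nondeg[OF F] unfolding cop3_def by (metis dvd_0_right not_is_unit_0)
    then have "hom 0 h" using hom_cancel[of d "F $ j" h d] False F' \<open>\<And>j. hom d (U $ j)\<close> h
      by (metis mult.commute diff_self_eq_0)
    then show ?thesis using hom_0_const by blast
  qed
  then obtain h0 where h0: "h = c3 h0" by blast
  have "M *v evv F v = (of_nat d / c) *s evv DM v + (h0 / c) *s evv F v" for v
  proof -
    have "c * (M *v evv F v) $ j = of_nat d * ev (DM $ j) v + h0 * ev (F $ j) v" for j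
    proof -
      have "(M *v evv F v) $ j = ev (MF $ j) v"
        unfolding MF_def vec_lambda_beta ev_cmp_lf by (simp add: dot_def matrix_vector_mult_def)
      then show ?thesis using arg_cong[OF h[of j], of "\<lambda>q. ev q v"] by (simp add: U_def h0 algebra_simps)
    qed
    then show ?thesis using K(3) by (simp add: vec_eq_iff field_simps)
  qed
  moreover have "of_nat d / c \<noteq> 0" using F'(1) K(3) by simp
  ultimately show ?thesis unfolding DM_def by blast
qed

lemma hom_1_lf: assumes "hom 1 p" shows "p = lf (\<chi> i. ev (pd i p) 0)"
proof -
  have "pd i p = c3 (ev (pd i p) 0)" for i using hom_0_const hom_pd[OF assms] by simp
  then show ?thesis using euler[OF assms] unfolding lf_def by (metis (no_types, lifting) mult.commute mult_1 of_nat_1 sum.cong vec_lambda_beta)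
qed

section \<open>Contraction with the radial field\<close>

definition curl :: "p3 ^ 3 \<Rightarrow> p3 ^ 3" where
  "curl w = vector [pd 2 (w $ 3) - pd 3 (w $ 2), pd 3 (w $ 1) - pd 1 (w $ 3), pd 1 (w $ 2) - pd 2 (w $ 1)]"

text \<open>Cartan's formula for the radial field: it annihilates \<open>w\<close>, and its Lie
  derivative multiplies a form with coefficients of degree \<open>n\<close> by \<open>n + 1\<close>.
  The sign comes from the order of the cross product.\<close>

lemma crs_XX_curl:
  assumes "dot XX w = 0" "\<And>i. hom n (w $ i)"
  shows "crs XX (curl w) $ i = - of_nat (n + 1) * w $ i"
proof -
  have 1: "(\<Sum>j\<in>UNIV. X j * pd i (w $ j)) = - w $ i" for i
    using arg_cong[OF assms(1), of "pd i"] exhaust_3[of i]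
    by (auto simp: dot_def sum_3 eq_neg_iff_add_eq_0 algebra_simps)
  have 2: "(\<Sum>j\<in>UNIV. X j * pd j (w $ i)) = of_nat n * w $ i" for i using euler assms(2) by blast
  have "crs XX (curl w) $ i = (\<Sum>j\<in>UNIV. X j * pd i (w $ j)) - (\<Sum>j\<in>UNIV. X j * pd j (w $ i))"
    using exhaust_3[of i] by (auto simp: curl_def sum_3 algebra_simps)
  then show ?thesis unfolding 1 2 by (simp add: algebra_simps)
qed

theorem foliation_small_degree:
  assumes F: "nondeg d F" "d > 1" and AB: "coprime A B" "hom k A" "hom k B" "k > 0"
    and inv: "\<And>c. \<exists>s t. (s \<noteq> 0 \<or> t \<noteq> 0) \<and>
      (\<forall>v. ev A v = c * ev B v \<longrightarrow> s * ev (cmp A F) v + t * ev (cmp B F) v = 0)"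
  shows "(\<exists>m. m \<noteq> 0 \<and> lie (\<chi> i. c3 (m $ i)) A = 0 \<and> lie (\<chi> i. c3 (m $ i)) B = 0) \<or>
    (\<exists>M D c \<kappa> h. (\<forall>i. omega A B $ i = D * crs XX (mv M) $ i) \<and> cop3 (crs XX (mv M)) \<and>
      lie (mv M) A = c3 c * A \<and> lie (mv M) B = c3 c * B \<and>
      \<kappa> \<noteq> 0 \<and> (\<forall>v. M *v evv F v = \<kappa> *s evv (push F (mv M)) v + h *s evv F v))"
proof -
  have A0: "A \<noteq> 0" using coprime_hom_nonzero AB by blast
  obtain D w where w: "\<And>i. omega A B $ i = D * w $ i" "cop3 w" "D \<noteq> 0"
    using extract_gcd omega_nonzero AB by metis
  have "\<exists>i. w $ i \<noteq> 0" using w(2) unfolding cop3_def by (metis dvd_0_right not_is_unit_0)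
  then obtain i0 where i0: "w $ i0 \<noteq> 0" by blast
  have homD: "hom (2 * k - 1) (D * w $ i)" for i using hom_omega[OF AB(2-4), of i] unfolding w(1) .
  obtain \<delta> n where dn: "hom \<delta> D" "hom n (w $ i0)" "\<delta> + n = 2 * k - 1"
    using hom_factor[OF homD[of i0]] i0 w(3) by auto
  have hw: "hom n (w $ i)" for i
  proof (cases "w $ i = 0")
    case False
    then have "hom (2 * k - 1 - \<delta>) (w $ i)" using hom_cancel[OF homD dn(1) w(3)] by blast
    then show ?thesis using dn(3) by (metis diff_add_inverse)
  qed simp
  have Xw: "dot XX w = 0"
  proof -
    have "D * dot XX w = dot XX (omega A B)" unfolding dot_def w(1) by (simp add: sum_3 algebra_simps)
    then show ?thesis using dot_XX_omega[OF AB(2,3)] w(3) by simp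
  qed
  define V where "V = (\<chi> i. c3 (- 1 / of_nat (n + 1)) * curl w $ i)"
  have wV: "w = crs XX V"
  proof -
    have "crs XX V $ i = c3 (- 1 / of_nat (n + 1)) * crs XX (curl w) $ i" for i
      using exhaust_3[of i] by (auto simp: V_def algebra_simps)
    moreover have "c3 (- 1 / of_nat (n + 1)) * - of_nat (n + 1) = 1"
      by (rule p3_eqI) (simp del: of_nat_add of_nat_Suc)
    ultimately have "crs XX V $ i = w $ i" for i
      using crs_XX_curl[OF Xw hw, of i] by (simp only: mult.assoc[symmetric] mult_1)
    then show ?thesis by (simp add: vec_eq_iff)
  qed
  have hV: "hom (n - 1) (V $ i)" for i
    unfolding V_def vec_lambda_beta
    using exhaust_3[of i] hom_pd[OF hw] by (auto simp: curl_def intro!: hom_c3_mult hom_diff)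
  \<comment> \<open>A constant form annihilated by the radial field is zero.\<close>
  have "n \<noteq> 0"
  proof
    assume "n = 0"
    then have wc: "w $ i = c3 (ev (w $ i) 0)" for i using hw hom_0_const by blast
    have "w $ i = 0" for i
    proof -
      have pw: "pd i (w $ j) = 0" for j
        using arg_cong[OF wc[of j], of "pd i"] by (simp only: pd_c3)
      have "0 = pd i (dot XX w)" using Xw by simp
      also have "\<dots> = w $ i" using exhaust_3[of i] by (auto simp: dot_def sum_3 pw)
      finally show ?thesis by simp
    qed
    then show False using i0 by blast
  qed
  \<comment> \<open>\<open>V\<close> is tangent to the foliation, so it annihilates the ratio
    \<open>A / B\<close>.\<close>
  have lieVV: "A * lie V B = B * lie V A"
  proof -
    have "D * dot V w = (\<Sum>i\<in>UNIV. V $ i * (D * w $ i))"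
      by (simp add: dot_def sum_distrib_left mult.left_commute)
    also have "\<dots> = (\<Sum>i\<in>UNIV. V $ i * (A * pd i B - B * pd i A))"
      by (simp only: w(1)[symmetric] omega_nth)
    also have "\<dots> = A * lie V B - B * lie V A" by (simp add: lie_def dot_def sum_3 algebra_simps)
    finally have "D * dot V w = A * lie V B - B * lie V A" .
    moreover have "dot V w = 0" unfolding wV by (rule dot_crs)
    ultimately show ?thesis by simp
  qed
  have "n \<le> 2" using invariant_foliation[OF F(1) AB inv w(1,2) hw] F(2) by blast
  then consider "n = 1" | "n = 2" using \<open>n \<noteq> 0\<close> by linarith
  then show ?thesis
  proof cases
    case 1
    define m where "m = (\<chi> i. ev (V $ i) 0)"
    have Vm: "V = (\<chi> i. c3 (m $ i))" using hom_0_const hV 1 by (simp add: vec_eq_iff m_def)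
    have "m \<noteq> 0" using i0 exhaust_3[of i0] unfolding wV Vm by (auto simp: )
    have "hom (k - 1) (lie V p)" if "hom k p" for p
      unfolding lie_def dot_def Vm using hom_pd[OF that] by (auto intro!: hom_sum hom_c3_mult)
    then have "lie V A = 0 \<and> lie V B = 0"
      using hom_dvd_derivation_zero[OF AB lieVV] AB by blast
    then show ?thesis using \<open>m \<noteq> 0\<close> unfolding Vm by blast
  next
    case 2
    define M :: "complex ^ 3 ^ 3" where "M = (\<chi> i j. ev (pd j (V $ i)) 0)"
    have VM: "V = mv M" using hV 2 hom_1_lf by (simp add: vec_eq_iff M_def)
    \<comment> \<open>A linear field preserves degrees, so the quotient of \<open>lie V A\<close> by
      \<open>A\<close> will be a constant.\<close>
    have hl: "hom k (lie V p)" if "hom k p" for p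
      unfolding lie_def dot_def VM mv_nth grad_nth using hom_pd[OF that] AB(4)
      by (intro hom_sum hom_mult'[OF hom_lf]) auto
    have "A dvd B * lie V A" using lieVV by (metis dvd_triv_left)
    then have "A dvd lie V A" using AB(1) by (simp add: coprime_dvd_mult_right_iff)
    then obtain g where g: "lie V A = A * g" by blast
    have "\<exists>c. g = c3 c"
    proof (cases "g = 0")
      case True then show ?thesis by (intro exI[of _ 0]) simp
    next
      case False
      then have "hom 0 g" using hom_cancel[of k A g k] hl AB A0 unfolding g[symmetric] by force
      then show ?thesis using hom_0_const by blast
    qed
    then obtain c where c: "g = c3 c" by blast
    have "A * lie V B = A * (c3 c * B)" using lieVV g c by (simp add: ac_simps)
    then have "lie V B = c3 c * B" using A0 by simp
    moreover have "lie V A = c3 c * A" using g c by (simp add: ac_simps)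
    ultimately show ?thesis
      using linear_foliation_equivariance[OF F(1) AB inv, of D M] w wV unfolding VM by metis
  qed
qed

section \<open>Diagonalizing the linear vector field\<close>

lemma four_vectors_dependent:
  fixes a :: "nat \<Rightarrow> complex ^ 3"
  shows "\<exists>c. (\<exists>i<4. c i \<noteq> 0) \<and> (\<Sum>i<4. c i *s a i) = 0"
proof (cases "inj_on a {..<4}")
  case True
  have "vec.dependent (a ` {..<4})"
  proof (rule ccontr)
    assume "vec.independent (a ` {..<4})"
    from vec.independent_card_le_dim[OF _ this, of UNIV] show False
      using True by (simp add: card_image card_cart_basis)
  qed
  then obtain u where u: "\<exists>v\<in>a ` {..<4}. u v \<noteq> 0" "(\<Sum>v\<in>a ` {..<4}. u v *s v) = 0"
    using vec.dependent_finite[of "a ` {..<4}"] by auto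
  then show ?thesis using True by (intro exI[of _ "u \<circ> a"]) (auto simp: sum.reindex)
next
  case False
  then obtain i j where ij: "i < 4" "j < 4" "i \<noteq> j" "a i = a j" by (auto simp: inj_on_def)
  have "(\<Sum>k<4. (if k = i then 1 else if k = j then - 1 else 0) *s a k) =
      (\<Sum>k\<in>{i, j}. (if k = i then 1 else if k = j then - 1 else 0) *s a k)"
    using ij by (intro sum.mono_neutral_right) auto
  also have "\<dots> = 0" using ij by simp
  finally show ?thesis using ij
    by (intro exI[of _ "\<lambda>k. if k = i then 1 else if k = j then - 1 else 0"]) auto
qed

definition shift :: "complex ^ 3 ^ 3 \<Rightarrow> complex \<Rightarrow> complex ^ 3 \<Rightarrow> complex ^ 3" where
  "shift M \<mu> v = M *v v - \<mu> *s v"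

lemma shift_simps: "shift M \<mu> (u + v) = shift M \<mu> u + shift M \<mu> v"
    "shift M \<mu> (c *s v) = c *s shift M \<mu> v" "shift M \<mu> (u - v) = shift M \<mu> u - shift M \<mu> v"
    "shift M \<mu> 0 = 0"
  by (simp_all add: shift_def vec3_eq matrix_vector_mult_def sum_3 algebra_simps)

lemma shift_power_simps: "(shift M \<mu> ^^ n) (u + v) = (shift M \<mu> ^^ n) u + (shift M \<mu> ^^ n) v"
    "(shift M \<mu> ^^ n) (c *s v) = c *s (shift M \<mu> ^^ n) v" "(shift M \<mu> ^^ n) 0 = 0"
  by (induction n) (simp_all add: shift_simps)

text \<open>A longer chain contains \<open>y\<close> with \<open>T ^^ 3\<close> nonzero and
  \<open>T ^^ 4\<close> zero on it. Then \<open>y\<close> and its first three images are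
  independent: \<open>T ^^ (3 - m)\<close>, applied to a relation whose first \<open>m\<close>
  coefficients vanish, isolates the next one.\<close>

lemma nilpotent_chain_length:
  assumes "(shift M \<mu> ^^ N) x \<noteq> 0" "(shift M \<mu> ^^ Suc N) x = 0" shows "N \<le> 2"
proof (rule ccontr)
  assume "\<not> N \<le> 2"
  define T where "T = shift M \<mu>"
  define y where "y = (T ^^ (N - 3)) x"
  have Ty: "(T ^^ i) y = (T ^^ (i + N - 3)) x" for i
    using \<open>\<not> N \<le> 2\<close> unfolding y_def by (simp add: funpow_add[symmetric, THEN fun_cong, unfolded comp_def])
  have y3: "(T ^^ 3) y \<noteq> 0" and y4: "(T ^^ 4) y = 0"
    using assms \<open>\<not> N \<le> 2\<close> Ty[of 3] Ty[of 4] by (simp_all add: T_def numeral_eq_Suc)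
  have z: "(T ^^ i) y = 0" if "i \<ge> 4" for i
  proof -
    have "(T ^^ i) y = (T ^^ (i - 4)) ((T ^^ 4) y)"
      using that funpow_add[of "i - 4" 4 T] by (simp add: fun_eq_iff)
    then show ?thesis unfolding y4 by (simp add: T_def shift_power_simps)
  qed
  obtain c where c: "\<exists>i<4. c i \<noteq> 0" "(\<Sum>i<4. c i *s (T ^^ i) y) = 0"
    using four_vectors_dependent[of "\<lambda>i. (T ^^ i) y"] by blast
  have lin: "(T ^^ n) (\<Sum>i<m. c i *s (T ^^ i) y) = (\<Sum>i<m. c i *s (T ^^ (n + i)) y)" for n m :: nat
    by (induction m) (simp_all add: T_def shift_power_simps funpow_add)
  have "\<forall>i<m. c i = 0" if "m \<le> 4" for m
    using that
  proof (induction m)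
    case (Suc m)
    then have IH: "\<forall>i<m. c i = 0" by simp
    have "0 = (\<Sum>i<4. c i *s (T ^^ (3 - m + i)) y)"
      using arg_cong[OF c(2), of "T ^^ (3 - m)"] unfolding lin by (simp add: T_def shift_power_simps)
    also have "\<dots> = (\<Sum>i\<in>{m}. c i *s (T ^^ (3 - m + i)) y)"
    proof (intro sum.mono_neutral_right ballI)
      fix i assume "i \<in> {..<4} - {m}"
      then show "c i *s (T ^^ (3 - m + i)) y = 0"
        using IH z Suc.prems by (cases "i < m") auto
    qed (use Suc.prems in auto)
    finally have "c m *s (T ^^ 3) y = 0" using Suc.prems by simp
    then have "c m = 0" using y3 by simp
    then show ?case using IH less_Suc_eq by auto
  qed simp
  then show False using c(1) by blast
qed

section \<open>Polynomial trajectories of a linear vector field\<close>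

definition res :: "(3 \<Rightarrow> complex poly) \<Rightarrow> p3 \<Rightarrow> complex poly" where
  "res w q = (SOME P. \<forall>t. poly P t = ev q (\<chi> i. poly (w i) t))"

lemma poly_res: "poly (res w q) t = ev q (\<chi> i. poly (w i) t)"
  unfolding res_def using someI_ex[OF curve_poly[of q w]] by blast

lemma res_simps: "res w (p + q) = res w p + res w q" "res w (p * q) = res w p * res w q"
    "res w (c3 c) = [:c:]" "res w (X i) = w i" "res w 0 = 0" "res w 1 = 1"
  by (rule poly_eq_poly_eq_iff[THEN iffD1], rule ext, simp add: poly_res)+

lemma pderiv_res: "pderiv (res w q) = (\<Sum>i\<in>UNIV. res w (pd i q) * pderiv (w i))"
proof (induction q rule: p3_induct)
  case (var k) then show ?case using exhaust_3[of k] by (auto simp: sum_3 res_simps)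
qed (simp_all add: res_simps sum_3 pderiv_add pderiv_mult algebra_simps)

text \<open>A trajectory of the linear field that is a polynomial curve of degree \<open>r\<close> is mapped by \<open>F\<close> to a
  polynomial curve of degree at least \<open>rd\<close> which solves a linear differential equation, whence a
  long nilpotent chain.\<close>

lemma polynomial_trajectory:
  assumes F: "nondeg d F" and \<kappa>: "\<kappa> \<noteq> 0"
    and eq: "\<And>v. M *v evv F v = \<kappa> *s evv (push F (mv M)) v + h *s evv F v"
    and w: "\<And>t. (\<chi> i. poly (pderiv (w i)) t) = shift M \<eta> (\<chi> i. poly (w i) t)"
    and deg: "\<And>i. degree (w i) \<le> r" and lead: "(\<chi> i. coeff (w i) r) \<noteq> 0" and r: "r > 0"
  shows "\<exists>N \<mu> x. N \<ge> r * d \<and> (shift M \<mu> ^^ N) x \<noteq> 0 \<and> (shift M \<mu> ^^ Suc N) x = 0"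
proof -
  have F': "\<forall>i. hom d (F $ i)" "\<And>v. evv F v = 0 \<Longrightarrow> v = 0" using F by (auto simp: nondeg_def)
  define p where "p j = res w (F $ j)" for j
  \<comment> \<open>By Euler's identity the derivative of \<open>F\<close> in the radial direction
    is \<open>d\<close> times \<open>F\<close>, so subtracting \<open>\<eta>\<close> on the source
    changes the eigenvalue by \<open>\<kappa> * \<eta> * d\<close> on the target.\<close>
  define \<mu> where "\<mu> = h + \<kappa> * \<eta> * of_nat d"
  have pp: "(\<chi> j. poly (p j) t) = evv F (\<chi> i. poly (w i) t)" for t
    by (simp add: p_def poly_res evv_def)
  have dp: "(\<chi> j. poly (pderiv (p j)) t) = (1 / \<kappa>) *s shift M \<mu> (\<chi> j. poly (p j) t)" for t
  proof -
    let ?v = "\<chi> i. poly (w i) t"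
    have "poly (pderiv (p j)) t = dot (evv (grad (F $ j)) ?v) (shift M \<eta> ?v)" for j
    proof -
      have "poly (pderiv (p j)) t = (\<Sum>i\<in>UNIV. ev (pd i (F $ j)) ?v * (\<chi> i. poly (pderiv (w i)) t) $ i)"
        unfolding p_def pderiv_res by (simp add: poly_sum poly_res)
      then show ?thesis unfolding w by (simp add: dot_def)
    qed
    moreover have "dot (evv (grad (F $ j)) v) (shift M \<eta> v) =
        evv (push F (mv M)) v $ j - \<eta> * of_nat d * ev (F $ j) v" for j v
    proof -
      have "dot (evv (grad (F $ j)) v) (shift M \<eta> v) =
          dot (evv (grad (F $ j)) v) (M *v v) - \<eta> * dot v (evv (grad (F $ j)) v)"
        by (simp add: shift_def dot_def sum_3 algebra_simps)
      then show ?thesis using euler_dot[of d "F $ j" v] F'(1)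
        by (simp add: push_def evv_dot evv_mv)
    qed
    ultimately have "(\<chi> j. poly (pderiv (p j)) t) = evv (push F (mv M)) ?v - (\<eta> * of_nat d) *s evv F ?v"
      by (simp add: vec_eq_iff)
    moreover have k: "\<kappa> *s evv (push F (mv M)) ?v = M *v evv F ?v - h *s evv F ?v"
      using eq[of ?v] by simp
    then have "evv (push F (mv M)) ?v = (1 / \<kappa>) *s (M *v evv F ?v - h *s evv F ?v)"
      unfolding k[symmetric] using \<kappa> by (simp add: vector_smult_assoc)
    ultimately show ?thesis
      unfolding pp shift_def \<mu>_def using \<kappa> by (simp add: vec_eq_iff field_simps)
  qed
  \<comment> \<open>The differential equation as a condition on triples of polynomials. It is linear
    with constant coefficients, hence inherited by derivatives, and repeated derivatives are powers
    of \<open>shift M \<mu>\<close> up to powers of \<open>\<kappa>\<close>.\<close>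
  define G where "G q \<longleftrightarrow> (\<forall>j. pderiv (q j) =
    smult (1 / \<kappa>) ((\<Sum>l\<in>UNIV. smult (M $ j $ l) (q l)) - smult \<mu> (q j)))" for q :: "3 \<Rightarrow> complex poly"
  have Gp: "G p"
    unfolding G_def
  proof (intro allI, rule poly_eq_poly_eq_iff[THEN iffD1], rule ext)
    fix j t
    have "poly (pderiv (p j)) t = ((1 / \<kappa>) *s shift M \<mu> (\<chi> j. poly (p j) t)) $ j"
      using arg_cong[OF dp[of t], of "\<lambda>v. v $ j"] by simp
    then show "poly (pderiv (p j)) t =
        poly (smult (1 / \<kappa>) ((\<Sum>l\<in>UNIV. smult (M $ j $ l) (p l)) - smult \<mu> (p j))) t"
      by (simp add: shift_def matrix_vector_mult_def sum_3 diff_divide_distrib)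
  qed
  have GS: "G (\<lambda>j. pderiv (q j))" if "G q" for q
    unfolding G_def
  proof
    fix j
    have "pderiv (pderiv (q j)) = pderiv (smult (1 / \<kappa>) ((\<Sum>l\<in>UNIV. smult (M $ j $ l) (q l)) - smult \<mu> (q j)))"
      using \<open>G q\<close> unfolding G_def by metis
    also have "\<dots> = smult (1 / \<kappa>) ((\<Sum>l\<in>UNIV. smult (M $ j $ l) (pderiv (q l))) - smult \<mu> (pderiv (q j)))"
      by (simp only: pderiv_smult pderiv_diff pderiv_add sum_3)
    finally show "pderiv (pderiv (q j)) = \<dots>" .
  qed
  have Gt: "(\<chi> j. poly (pderiv (q j)) t) = (1 / \<kappa>) *s shift M \<mu> (\<chi> j. poly (q j) t)" if "G q" for q t
  proof -
    have "pderiv (q j) = smult (1 / \<kappa>) ((\<Sum>l\<in>UNIV. smult (M $ j $ l) (q l)) - smult \<mu> (q j))" for j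
      using \<open>G q\<close> unfolding G_def by blast
    then show ?thesis by (simp add: vec_eq_iff shift_def matrix_vector_mult_def sum_3 diff_divide_distrib)
  qed
  have dpn: "(\<chi> j. poly ((pderiv ^^ n) (q j)) t) = (1 / \<kappa> ^ n) *s (shift M \<mu> ^^ n) (\<chi> j. poly (q j) t)"
    if "G q" for q n t
    using that
  proof (induction n arbitrary: q)
    case (Suc n)
    have "(\<chi> j. poly ((pderiv ^^ Suc n) (q j)) t) = (\<chi> j. poly ((pderiv ^^ n) (pderiv (q j))) t)"
      by (simp only: funpow_Suc_right comp_def)
    also have "\<dots> = (1 / \<kappa> ^ n) *s (shift M \<mu> ^^ n) ((1 / \<kappa>) *s shift M \<mu> (\<chi> j. poly (q j) t))"
      unfolding Suc.IH[OF GS[OF Suc.prems]] Gt[OF Suc.prems] ..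
    also have "\<dots> = (1 / \<kappa> ^ Suc n) *s (shift M \<mu> ^^ Suc n) (\<chi> j. poly (q j) t)"
      unfolding shift_power_simps by (simp only: funpow_Suc_right comp_def vector_smult_assoc) (simp add: mult.commute)
    finally show ?case .
  qed simp
  \<comment> \<open>The coefficient of \<open>t ^ (r * d)\<close> in the image curve is
    \<open>F\<close> applied to the vector of leading coefficients, which is not zero. It is read
    off at \<open>s = 0\<close> after reversing the polynomials.\<close>
  have big: "\<exists>j. degree (p j) \<ge> r * d"
  proof (rule ccontr)
    assume "\<not> ?thesis"
    then have small: "degree (p j) < r * d" for j by (auto simp: not_le)
    define w' where "w' i = (\<Sum>k\<le>r. monom (coeff (w i) k) (r - k))" for i
    define p' where "p' j = (\<Sum>k\<le>r * d. monom (coeff (p j) k) (r * d - k))" for j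
    have pw': "poly (w' i) s = bfc r (w i) 1 s" for i s by (simp add: w'_def bfc_def poly_sum poly_monom)
    have pp': "poly (p' j) s = bfc (r * d) (p j) 1 s" for j s by (simp add: p'_def bfc_def poly_sum poly_monom)
    have "res w' (F $ j) = p' j" for j
    proof (rule poly_eq_off_point[of 0])
      fix s :: complex assume s: "s \<noteq> 0"
      have "(\<chi> i. poly (w' i) s) = s ^ r *s (\<chi> i. poly (w i) (1 / s))"
        using s deg by (simp add: vec_eq_iff pw' bfc_nonzero)
      then have "poly (res w' (F $ j)) s = (s ^ r) ^ d * poly (p j) (1 / s)"
        using F'(1) unfolding p_def poly_res hom_def by metis
      also have "\<dots> = poly (p' j) s"
        using s small[of j] by (simp add: pp' bfc_nonzero power_mult)
      finally show "poly (res w' (F $ j)) s = poly (p' j) s" .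
    qed
    then have "ev (F $ j) (\<chi> i. poly (w' i) 0) = poly (p' j) 0" for j
      by (metis poly_res)
    then have "ev (F $ j) (\<chi> i. coeff (w i) r) = 0" for j
      using small[of j] by (simp add: pw' pp' bfc_zero coeff_eq_0)
    then have "evv F (\<chi> i. coeff (w i) r) = 0" by (simp add: vec_eq_iff)
    then show False using F'(2) lead by blast
  qed
  \<comment> \<open>For the largest degree \<open>N\<close>, the derivative of order
    \<open>N\<close> is not zero and the next one is; evaluated at 0, they give the end of a chain
    starting at \<open>x\<close>.\<close>
  define N where "N = Max (range (\<lambda>j. degree (p j)))"
  have Nge: "degree (p j) \<le> N" for j unfolding N_def by (intro Max_ge) auto
  have "N \<in> range (\<lambda>j. degree (p j))" unfolding N_def by (intro Max_in) auto
  then obtain j0 where j0: "N = degree (p j0)" by blast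
  have rdN: "r * d \<le> N" using big Nge order_trans by blast
  have "d > 0" using F by (simp add: nondeg_def)
  then have "N > 0" using rdN r by (metis le_zero_eq mult_eq_0_iff neq0_conv)
  then have lc: "coeff (p j0) N \<noteq> 0" unfolding j0 by (metis degree_0 leading_coeff_0_iff less_numeral_extra(3))
  define x where "x = (\<chi> j. poly (p j) 0)"
  have "poly ((pderiv ^^ N) (p j0)) 0 = fact N * coeff (p j0) N"
    by (simp add: poly_0_coeff_0 coeff_higher_pderiv pochhammer_fact)
  then have "(\<chi> j. poly ((pderiv ^^ N) (p j)) 0) \<noteq> 0" using lc
    by (auto simp: vec_eq_iff intro!: exI[of _ j0])
  then have 1: "(shift M \<mu> ^^ N) x \<noteq> 0" unfolding dpn[OF Gp] x_def by auto
  have "(pderiv ^^ Suc N) (p j) = 0" for j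
    by (rule poly_eqI) (use Nge[of j] in \<open>simp add: coeff_higher_pderiv coeff_eq_0 del: funpow.simps\<close>)
  then have "(1 / \<kappa> ^ Suc N) *s (shift M \<mu> ^^ Suc N) x = 0"
    unfolding x_def dpn[OF Gp, symmetric] by (simp add: vec_eq_iff del: funpow.simps)
  then have "(shift M \<mu> ^^ Suc N) x = 0" using \<kappa> by (simp del: funpow.simps)
  then show ?thesis using 1 rdN by blast
qed

text \<open>Two rounds: a generalized eigenvector gives a trajectory of degree 1, hence a chain with
  \<open>N \<ge> d\<close>, which leaves only \<open>N = 2\<close>. That chain gives a trajectory of
  degree 2, hence one with \<open>N \<ge> 2 * d\<close>, beyond the bound 2.\<close>

lemma no_generalized_eigenvector:
  assumes F: "nondeg d F" "d > 1" and \<kappa>: "\<kappa> \<noteq> 0"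
    and eq: "\<And>v. M *v evv F v = \<kappa> *s evv (push F (mv M)) v + h *s evv F v"
    and w: "shift M \<eta> (shift M \<eta> w) = 0"
  shows "shift M \<eta> w = 0"
proof (rule ccontr)
  assume u: "shift M \<eta> w \<noteq> 0"
  have "\<exists>N \<mu> x. N \<ge> 1 * d \<and> (shift M \<mu> ^^ N) x \<noteq> 0 \<and> (shift M \<mu> ^^ Suc N) x = 0"
  proof (rule polynomial_trajectory[OF F(1) \<kappa> eq, of "\<lambda>i. [:w $ i, shift M \<eta> w $ i:]" \<eta>])
    fix t
    have "(\<chi> i. poly [:w $ i, shift M \<eta> w $ i:] t) = w + t *s shift M \<eta> w" by (simp add: vec_eq_iff)
    then show "(\<chi> i. poly (pderiv [:w $ i, shift M \<eta> w $ i:]) t) =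
        shift M \<eta> (\<chi> i. poly [:w $ i, shift M \<eta> w $ i:] t)"
      using w by (simp add: shift_simps pderiv_pCons)
  qed (use u in \<open>auto simp: vec_lambda_eta\<close>)
  then obtain N \<mu> x where N: "N \<ge> d" "(shift M \<mu> ^^ N) x \<noteq> 0" "(shift M \<mu> ^^ Suc N) x = 0" by auto
  have N2: "N = 2" using nilpotent_chain_length[OF N(2,3)] N(1) F(2) by linarith
  define y where "y = shift M \<mu> x"
  define z where "z = shift M \<mu> y"
  have z: "z \<noteq> 0" "shift M \<mu> z = 0" using N(2,3) unfolding N2 z_def y_def by (simp_all add: numeral_2_eq_2)
  \<comment> \<open>The exponential series x + t y + t^2/2 z, which stops there because
    \<open>shift M \<mu> z = 0\<close>.\<close>
  let ?w = "\<lambda>i. [:x $ i, y $ i, z $ i / 2:]"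
  have "\<exists>N \<mu> x. N \<ge> 2 * d \<and> (shift M \<mu> ^^ N) x \<noteq> 0 \<and> (shift M \<mu> ^^ Suc N) x = 0"
  proof (rule polynomial_trajectory[OF F(1) \<kappa> eq, of ?w \<mu>])
    fix t
    have "(\<chi> i. poly (?w i) t) = x + t *s (y + (t / 2) *s z)" by (simp add: vec_eq_iff algebra_simps)
    then have "shift M \<mu> (\<chi> i. poly (?w i) t) = y + t *s z"
      using z by (simp add: shift_simps flip: y_def z_def)
    then show "(\<chi> i. poly (pderiv (?w i)) t) = shift M \<mu> (\<chi> i. poly (?w i) t)"
      by (simp add: vec_eq_iff pderiv_pCons algebra_simps)
  qed (use z in \<open>auto simp: vec_eq_iff numeral_2_eq_2\<close>)
  then obtain N \<mu> x where N: "N \<ge> 2 * d" "(shift M \<mu> ^^ N) x \<noteq> 0" "(shift M \<mu> ^^ Suc N) x = 0" by auto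
  then show False using nilpotent_chain_length[OF N(2,3)] F(2) by linarith
qed

section \<open>Existence of a basis of eigenvectors\<close>

definition papp :: "complex ^ 3 ^ 3 \<Rightarrow> complex poly \<Rightarrow> complex ^ 3 \<Rightarrow> complex ^ 3" where
  "papp M q v = (\<Sum>i\<le>degree q. coeff q i *s (((*v) M) ^^ i) v)"

lemma papp_bound: "degree q \<le> n \<Longrightarrow> papp M q v = (\<Sum>i\<le>n. coeff q i *s (((*v) M) ^^ i) v)"
  unfolding papp_def by (intro sum.mono_neutral_left) (auto simp: coeff_eq_0)

lemma papp_linear_factor: "papp M ([:- \<mu>, 1:] * q) v = papp M q (shift M \<mu> v)"
proof -
  define n where "n = degree q"
  let ?T = "\<lambda>i. (((*v) M) ^^ i)"
  have lin: "?T i (shift M \<mu> v) = ?T (Suc i) v - \<mu> *s ?T i v" for i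
  proof (induction i)
    case 0 show ?case by (simp add: shift_def)
  next
    case (Suc i) then show ?case
      by (simp add: matrix_vector_mult_diff_distrib vector_scalar_commute)
  qed
  have "degree ([:- \<mu>, 1:] * q) \<le> Suc n" unfolding n_def
    using degree_mult_le[of "[:- \<mu>, 1:]" q] by simp
  then have "papp M ([:- \<mu>, 1:] * q) v = (\<Sum>i\<le>Suc n. coeff ([:- \<mu>, 1:] * q) i *s ?T i v)"
    by (rule papp_bound)
  also have "[:- \<mu>, 1:] * q = pCons 0 q - smult \<mu> q" by simp
  also have "(\<Sum>i\<le>Suc n. coeff (pCons 0 q - smult \<mu> q) i *s ?T i v) =
      (\<Sum>i\<le>Suc n. coeff (pCons 0 q) i *s ?T i v) - (\<Sum>i\<le>Suc n. (\<mu> * coeff q i) *s ?T i v)"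
    by (simp only: coeff_diff coeff_smult vector_sub_rdistrib sum_subtractf)
  also have "(\<Sum>i\<le>Suc n. coeff (pCons 0 q) i *s ?T i v) = (\<Sum>i\<le>n. coeff q i *s ?T (Suc i) v)"
    by (subst sum.atMost_Suc_shift) simp
  also have "(\<Sum>i\<le>Suc n. (\<mu> * coeff q i) *s ?T i v) = (\<Sum>i\<le>n. coeff q i *s (\<mu> *s ?T i v))"
    by (simp add: n_def coeff_eq_0 vector_smult_assoc mult.commute)
  also have "(\<Sum>i\<le>n. coeff q i *s ?T (Suc i) v) - (\<Sum>i\<le>n. coeff q i *s (\<mu> *s ?T i v)) =
      (\<Sum>i\<le>n. coeff q i *s ?T i (shift M \<mu> v))"
    unfolding lin by (simp only: vector_ssub_ldistrib sum_subtractf)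
  finally show ?thesis by (simp add: papp_def n_def)
qed

text \<open>The linear factors of \<open>q\<close> are applied to \<open>v\<close> one after the
  other; the last vector before entering \<open>W\<close> is the wanted one.\<close>

lemma eigenvector_modulo_subspace:
  assumes W: "vec.subspace W" and v: "v \<notin> W" and q: "q \<noteq> 0" "papp M q v \<in> W"
  shows "\<exists>w \<mu>. w \<notin> W \<and> shift M \<mu> w \<in> W"
  using v q
proof (induction "degree q" arbitrary: q v)
  case 0
  then obtain a where a: "q = [:a:]" by (metis degree_eq_zeroE)
  then have "a *s v \<in> W" "a \<noteq> 0" using 0 by (auto simp: papp_def)
  then have "inverse a *s (a *s v) \<in> W" using vec.subspace_scale[OF W] by blast
  then show ?case using \<open>a \<noteq> 0\<close> 0 by (simp add: vector_smult_assoc)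
next
  case (Suc n)
  then have "\<not> constant (poly q)" using constant_degree[of q] by auto
  then obtain \<mu> where "poly q \<mu> = 0" using fundamental_theorem_of_algebra by blast
  then obtain q' where q': "q = [:- \<mu>, 1:] * q'" by (metis dvdE poly_eq_0_iff_dvd)
  then have "q' \<noteq> 0" using Suc.prems by auto
  moreover from this have "n = degree q'" using Suc(2) unfolding q' by (simp add: degree_mult_eq del: mult_pCons_left)
  moreover have "papp M q' (shift M \<mu> v) \<in> W" using Suc.prems(3) unfolding q' papp_linear_factor .
  ultimately show ?case using Suc.hyps(1)[of q' "shift M \<mu> v"] Suc.prems(1) by blast
qed

definition basis3 :: "(3 \<Rightarrow> complex ^ 3) \<Rightarrow> bool" where
  "basis3 u \<longleftrightarrow> (\<forall>x. (\<Sum>i\<in>UNIV. x i *s u i) = 0 \<longrightarrow> (\<forall>i. x i = 0))"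

text \<open>If the span \<open>W\<close> of the eigenvectors were proper, some \<open>w\<close>
  outside it would be an eigenvector modulo \<open>W\<close>. Corrected by an element of
  \<open>W\<close>, it becomes a generalized eigenvector of order two, hence an eigenvector by
  hypothesis.\<close>

theorem eigenbasis:
  assumes no: "\<And>\<eta> w. shift M \<eta> (shift M \<eta> w) = 0 \<Longrightarrow> shift M \<eta> w = 0"
  shows "\<exists>u a. basis3 u \<and> (\<forall>i. M *v u i = a i *s u i)"
proof -
  define Eig where "Eig = {u. \<exists>a. M *v u = a *s u}"
  define W where "W = vec.span Eig"
  have sW: "vec.subspace W" unfolding W_def by simp
  have "W = UNIV"
  proof (rule ccontr)
    assume "W \<noteq> UNIV"
    then obtain v where v: "v \<notin> W" by blast
    obtain c where c: "\<exists>i<4. c i \<noteq> 0" "(\<Sum>i<4. c i *s (((*v) M) ^^ i) v) = 0"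
      using four_vectors_dependent[of "\<lambda>i. (((*v) M) ^^ i) v"] by blast
    define q where "q = (\<Sum>i<4. monom (c i) i)"
    have cq: "coeff q i = (if i < 4 then c i else 0)" for i
      by (simp add: q_def coeff_sum)
    have q0: "q \<noteq> 0" using c(1) cq by (metis coeff_0)
    have "degree q \<le> 3" by (rule degree_le) (auto simp: cq)
    then have "papp M q v = (\<Sum>i\<le>3. coeff q i *s (((*v) M) ^^ i) v)" by (rule papp_bound)
    also have "\<dots> = (\<Sum>i<4. c i *s (((*v) M) ^^ i) v)"
      by (intro sum.cong) (auto simp: cq)
    finally have "papp M q v \<in> W" using c(2) vec.subspace_0[OF sW] by simp
    then obtain w \<mu> where w: "w \<notin> W" "shift M \<mu> w \<in> W"
      using eigenvector_modulo_subspace[OF sW v q0] by blast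
    \<comment> \<open>On \<open>W\<close> an element is a sum of eigenvectors: those for
      \<open>\<mu>\<close> go into \<open>y0\<close>, and for another eigenvalue \<open>a\<close>
      division by \<open>a - \<mu>\<close> gives the contribution to \<open>y1\<close>.\<close>
    have "\<exists>y0 y1. y = y0 + shift M \<mu> y1 \<and> shift M \<mu> y0 = 0 \<and> y1 \<in> W" if "y \<in> W" for y
      using that unfolding W_def
    proof (induction rule: vec.span_induct_alt)
      case base
      show ?case by (rule exI[of _ 0], rule exI[of _ 0]) (simp add: shift_simps vec.span_zero)
    next
      case (step c x y)
      then obtain a where a: "M *v x = a *s x" by (auto simp: Eig_def)
      obtain y0 y1 where y: "y = y0 + shift M \<mu> y1" "shift M \<mu> y0 = 0" "y1 \<in> vec.span Eig"
        using step by blast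
      have x: "x \<in> vec.span Eig" using step vec.span_base by blast
      have sx: "shift M \<mu> x = (a - \<mu>) *s x" by (simp add: shift_def a vector_sub_rdistrib)
      show ?case
      proof (cases "a = \<mu>")
        case True
        then show ?thesis using y sx
          by - (rule exI[of _ "c *s x + y0"], rule exI[of _ y1], simp add: shift_simps)
      next
        case False
        then have "c *s x + y = y0 + shift M \<mu> ((c / (a - \<mu>)) *s x + y1)"
          unfolding y(1) shift_simps sx vector_smult_assoc by (simp add: add_ac)
        moreover have "(c / (a - \<mu>)) *s x + y1 \<in> vec.span Eig"
          using x y(3) by (intro vec.span_add vec.span_scale)
        ultimately show ?thesis using y(2) by blast
      qed
    qed
    then obtain y0 y1 where y: "shift M \<mu> w = y0 + shift M \<mu> y1" "shift M \<mu> y0 = 0" "y1 \<in> W"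
      using w(2) by blast
    then have "shift M \<mu> (w - y1) = y0" by (simp add: shift_simps)
    then have "shift M \<mu> (w - y1) = 0" using no y(2) by metis
    then have "w - y1 \<in> Eig" by (auto simp: Eig_def shift_def)
    then have "w - y1 \<in> W" unfolding W_def by (rule vec.span_base)
    then have "w \<in> W" using y(3) vec.subspace_add[OF sW, of "w - y1" y1] by simp
    then show False using w(1) by blast
  qed
  obtain B where B: "B \<subseteq> Eig" "vec.independent B" "Eig \<subseteq> vec.span B"
    using vec.maximal_independent_subset[of Eig] by blast
  then have "vec.span B = UNIV" using \<open>W = UNIV\<close> unfolding W_def
    by (metis vec.span_mono vec.span_span top.extremum_uniqueI)
  then have "card B = 3" using vec.dim_eq_card[of B UNIV] B(2) by (simp add: card_cart_basis)
  then have fB: "finite B" by (metis card.infinite zero_neq_numeral)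
  obtain b where b: "bij_betw b (UNIV :: 3 set) B"
    using finite_same_card_bij[of "UNIV :: 3 set" B] fB \<open>card B = 3\<close> by auto
  have "basis3 b"
    unfolding basis3_def
  proof (intro allI impI)
    fix x i assume s: "(\<Sum>i\<in>UNIV. x i *s b i) = 0"
    have inv: "inv_into UNIV b (b j) = j" for j using b by (simp add: bij_betw_def)
    have "(\<Sum>v\<in>B. x (inv_into UNIV b v) *s v) = (\<Sum>i\<in>UNIV. x (inv_into UNIV b (b i)) *s b i)"
      by (rule sum.reindex_bij_betw[OF b, symmetric])
    also have "\<dots> = 0" using s by (simp only: inv)
    finally have z: "(\<Sum>v\<in>B. x (inv_into UNIV b v) *s v) = 0" .
    have "x (inv_into UNIV b v) = 0" if "v \<in> B" for v
      using vec.independentD[where u = "\<lambda>v. x (inv_into UNIV b v)", OF B(2) fB subset_refl z that] .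
    then show "x i = 0" using b inv by (metis bij_betwE UNIV_I)
  qed
  moreover have "\<forall>i. \<exists>a. M *v b i = a *s b i" using b B(1) by (auto simp: Eig_def bij_betw_def)
  ultimately show ?thesis by metis
qed

section \<open>Monomials\<close>

definition cf :: "p3 \<Rightarrow> nat \<times> nat \<times> nat \<Rightarrow> complex" where
  "cf p e = (case e of (i, j, l) \<Rightarrow> coeff (coeff (coeff p l) j) i)"

definition mono3 :: "complex \<Rightarrow> nat \<times> nat \<times> nat \<Rightarrow> p3" where
  "mono3 c e = (case e of (i, j, l) \<Rightarrow> c3 c * X 1 ^ i * X 2 ^ j * X 3 ^ l)"

lemma cf_simps: "cf (p + q) e = cf p e + cf q e" "cf 0 e = 0" "cf (p - q) e = cf p e - cf q e"
  by (auto simp: cf_def split: prod.splits)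

lemma cf_sum: "cf (sum f A) e = (\<Sum>a\<in>A. cf (f a) e)"
  by (induction A rule: infinite_finite_induct) (auto simp: cf_simps)

lemma mono3_monom: "mono3 c (i, j, l) = monom (monom (monom c i) j) l"
  by (rule p3_eqI) (simp add: mono3_def ev_def poly_monom c3_def X_def algebra_simps)

lemma cf_mono3: "cf (mono3 c e) e' = (if e = e' then c else 0)"
  by (cases e; cases e') (auto simp: mono3_monom cf_def)

lemma cf_eqI: "(\<And>e. cf p e = cf q e) \<Longrightarrow> p = q"
  by (auto simp: cf_def poly_eq_iff split: prod.splits)

lemma p3_monomial_induct [case_names mono add]:
  assumes m: "\<And>c e. P (mono3 c e)" and a: "\<And>p q. P p \<Longrightarrow> P q \<Longrightarrow> P (p + q)"
  shows "P p"
proof -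
  have 0: "P 0" using m[of 0 "(0, 0, 0)"] by (simp add: mono3_def)
  have 1: "P ([:[:q:]:] * X 1 ^ i * X 2 ^ j * X 3 ^ l)" for q i j l
  proof (induction q arbitrary: i)
    case (pCons a q)
    have "[:[:pCons a q:]:] = c3 a + X 1 * [:[:q:]:]" by (simp add: c3_def X_def)
    then have "[:[:pCons a q:]:] * X 1 ^ i * X 2 ^ j * X 3 ^ l =
        mono3 a (i, j, l) + [:[:q:]:] * X 1 ^ Suc i * X 2 ^ j * X 3 ^ l"
      by (simp only: mono3_def prod.case) (simp add: algebra_simps)
    then show ?case using a m pCons.IH by metis
  qed (simp add: 0)
  have 2: "P ([:r:] * X 2 ^ j * X 3 ^ l)" for r j l
  proof (induction r arbitrary: j)
    case (pCons b r)
    have "[:pCons b r:] = [:[:b:]:] + X 2 * [:r:]" by (simp add: X_def)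
    then have "[:pCons b r:] * X 2 ^ j * X 3 ^ l =
        [:[:b:]:] * X 1 ^ 0 * X 2 ^ j * X 3 ^ l + [:r:] * X 2 ^ Suc j * X 3 ^ l"
      by (simp only: ) (simp add: algebra_simps)
    then show ?case using a 1 pCons.IH by metis
  qed (simp add: 0)
  have "P (p * X 3 ^ l)" for l
  proof (induction p arbitrary: l)
    case (pCons b p)
    have "pCons b p = [:b:] + X 3 * p" by (simp add: X_def)
    then have "pCons b p * X 3 ^ l = [:b:] * X 2 ^ 0 * X 3 ^ l + p * X 3 ^ Suc l"
      by (simp only: ) (simp add: algebra_simps)
    then show ?case using a 2 pCons.IH by metis
  qed (simp add: 0)
  from this[of 0] show ?thesis by simp
qed

definition supp :: "p3 \<Rightarrow> (nat \<times> nat \<times> nat) set" where "supp p = {e. cf p e \<noteq> 0}"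

lemma finite_supp: "finite (supp p)"
proof (induction p rule: p3_monomial_induct)
  case (mono c e)
  have "supp (mono3 c e) \<subseteq> {e}" by (auto simp: supp_def cf_mono3 split: if_splits)
  then show ?case by (rule finite_subset) simp
next
  case (add p q)
  have "supp (p + q) \<subseteq> supp p \<union> supp q" by (auto simp: supp_def cf_simps)
  then show ?case using add finite_subset by blast
qed

lemma monomial_expansion: "p = (\<Sum>e\<in>supp p. mono3 (cf p e) e)"
proof (rule cf_eqI)
  fix e
  show "cf p e = cf (\<Sum>e\<in>supp p. mono3 (cf p e) e) e"
    using finite_supp by (simp add: cf_sum cf_mono3 supp_def)
qed

definition expo :: "nat \<times> nat \<times> nat \<Rightarrow> 3 \<Rightarrow> nat" where
  "expo e i = (if i = 1 then fst e else if i = 2 then fst (snd e) else snd (snd e))"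

lemma expo_simps [simp]: "expo (i, j, l) 1 = i" "expo (i, j, l) 2 = j" "expo (i, j, l) 3 = l"
  by (simp_all add: expo_def)

lemma X_pd_power: "X i * pd i (X j ^ n) = (if i = j then of_nat n * X j ^ n else 0)"
  by (induction n) (auto simp: algebra_simps)

lemma cf_X_pd: "cf (c3 a * X i * pd i p) e = a * of_nat (expo e i) * cf p e"
proof (induction p rule: p3_monomial_induct)
  case (mono c e')
  obtain j k l where e': "e' = (j, k, l)" by (cases e')
  have "pd i (mono3 c e') = c3 c * (pd i (X 1 ^ j) * X 2 ^ k * X 3 ^ l + X 1 ^ j * pd i (X 2 ^ k) * X 3 ^ l
      + X 1 ^ j * X 2 ^ k * pd i (X 3 ^ l))"
    by (simp add: mono3_def e' algebra_simps)
  then have "c3 a * X i * pd i (mono3 c e') = c3 a * c3 c * ((X i * pd i (X 1 ^ j)) * X 2 ^ k * X 3 ^ l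
      + X 1 ^ j * (X i * pd i (X 2 ^ k)) * X 3 ^ l + X 1 ^ j * X 2 ^ k * (X i * pd i (X 3 ^ l)))"
    by (simp only: ) (simp add: algebra_simps)
  also have "\<dots> = mono3 (a * of_nat (expo e' i) * c) e'"
    unfolding X_pd_power using exhaust_3[of i]
    by (intro p3_eqI) (auto simp: mono3_def e' c3_hom)
  finally show ?case by (simp add: cf_mono3)
next
  case (add p q) then show ?case by (simp add: cf_simps algebra_simps)
qed

text \<open>A diagonal field multiplies each monomial by its weight, so all monomials of an
  eigenfunction have the eigenvalue as weight.\<close>

lemma cf_weight:
  assumes "(\<Sum>i\<in>UNIV. c3 (a $ i) * X i * pd i p) = c3 b * p" "e \<in> supp p"
  shows "(\<Sum>i\<in>UNIV. a $ i * of_nat (expo e i)) = b"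
proof -
  have "cf (c3 b * p) e = b * cf p e"
    by (cases e) (simp add: cf_def c3_def)
  moreover have "cf (\<Sum>i\<in>UNIV. c3 (a $ i) * X i * pd i p) e = (\<Sum>i\<in>UNIV. a $ i * of_nat (expo e i)) * cf p e"
    by (simp only: cf_sum cf_X_pd sum_distrib_right)
  ultimately show ?thesis using assms by (simp add: supp_def)
qed

lemma hom_supp: assumes "hom k p" "e \<in> supp p" shows "(\<Sum>i\<in>UNIV. expo e i) = k"
proof -
  have "(\<Sum>i\<in>UNIV. c3 ((\<chi> i. 1) $ i) * X i * pd i p) = c3 (of_nat k) * p"
    using euler[OF assms(1)] by (intro p3_eqI) (auto dest: arg_cong[where f = "\<lambda>q. ev q _"])
  from cf_weight[OF this assms(2)] have "(of_nat (\<Sum>i\<in>UNIV. expo e i) :: complex) = of_nat k" by simp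
  then show ?thesis by (simp only: of_nat_eq_iff)
qed

lemma X_dvd: assumes "\<And>e. e \<in> supp p \<Longrightarrow> expo e i \<noteq> 0" shows "X i dvd p"
proof -
  have "X i dvd mono3 (cf p e) e" if "e \<in> supp p" for e
  proof -
    have d: "X j dvd X j ^ n" if "n \<noteq> 0" for j n using that by (simp add: dvd_power)
    obtain j k l where "e = (j, k, l)" by (cases e)
    then show ?thesis using assms[OF that] exhaust_3[of i] d[of _ i]
      by (auto simp: mono3_def)
  qed
  then have "X i dvd (\<Sum>e\<in>supp p. mono3 (cf p e) e)" by (rule dvd_sum)
  then show ?thesis using monomial_expansion[of p] by simp
qed

lemma X_not_unit: "\<not> is_unit (X i)"
proof
  assume "is_unit (X i)"
  then obtain g where "1 = X i * g" by (auto simp: dvd_def)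
  from arg_cong[OF this, of "\<lambda>q. ev q 0"] show False by simp
qed

lemma coprime_supp:
  assumes "coprime p q" shows "\<exists>e\<in>supp p \<union> supp q. expo e i = 0"
proof (rule ccontr)
  assume "\<not> ?thesis"
  then have "X i dvd p" "X i dvd q" by (auto intro!: X_dvd)
  then show False using assms X_not_unit coprime_common_divisor by blast
qed

text \<open>The source of composite pencils: \<open>U\<close> and \<open>V\<close> will be two basic
  monomials, and \<open>A\<close> and \<open>B\<close> become binary forms in them.\<close>

lemma supp_bf:
  assumes "\<And>e. e \<in> supp p \<Longrightarrow> \<exists>i\<le>g. \<forall>c. mono3 c e = c3 c * U ^ i * V ^ (g - i)"
  shows "\<exists>c. degree c \<le> g \<and> p = bf g c U V"
proof -
  have "\<exists>c. degree c \<le> g \<and> (\<Sum>e\<in>supp p. mono3 (cf p e) e) = bf g c U V"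
  proof (rule bf_sum)
    fix e assume "e \<in> supp p"
    then obtain i where i: "i \<le> g" "\<And>c. mono3 c e = c3 c * U ^ i * V ^ (g - i)" using assms by blast
    show "\<exists>c. degree c \<le> g \<and> mono3 (cf p e) e = bf g c U V"
      unfolding i(2) using bf_monom[OF i(1)] i(1) order_trans[OF degree_monom_le i(1)] by metis
  qed
  then show ?thesis using monomial_expansion[of p] by simp
qed

section \<open>Composite pencils are reducible\<close>

text \<open>The two points show that neither zero set contains the other. A factorization alone
  would not be enough, since irreducibility of a curve refers to its support, and a power of a form
  has the same support as the form.\<close>

definition reducible :: "p3 \<Rightarrow> bool" where
  "reducible p \<longleftrightarrow> (\<exists>P Q n m v w. hom n P \<and> hom m Q \<and> p = P * Q \<and> v \<noteq> 0 \<and> w \<noteq> 0 \<and>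
    ev P v = 0 \<and> ev Q v \<noteq> 0 \<and> ev P w \<noteq> 0 \<and> ev Q w = 0)"

lemma bf_smult: "bf n (smult a c) U V = c3 a * bf n c U V"
  by (simp add: bf_def sum_distrib_left c3_hom algebra_simps)

lemma bf_diff: "bf n (c - e) U V = bf n c U V - bf n e U V"
  by (simp add: bf_def sum_subtractf algebra_simps c3_hom)

lemma bfc_1: "degree c \<le> n \<Longrightarrow> bfc n c r 1 = poly c r"
  by (simp add: bfc_nonzero)

text \<open>The full power of \<open>t - r1\<close> is split off, so the cofactor does not vanish
  where \<open>U / V\<close> equals \<open>r1\<close>; points over \<open>r1\<close> and
  \<open>r2\<close> then separate the two factors.\<close>

lemma reducible_bf:
  assumes UV: "hom j U" "hom j V" "j > 0" "\<And>r. \<exists>v. ev U v = r \<and> ev V v = 1"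
    and c: "c \<noteq> 0" "poly c r1 = 0" "poly c r2 = 0" "r1 \<noteq> r2"
  shows "reducible (bf (degree c) c U V)"
proof -
  define m where "m = order r1 c"
  obtain e where e: "c = [:- r1, 1:] ^ m * e" "\<not> [:- r1, 1:] dvd e"
    using order_decomp[OF c(1)] unfolding m_def by blast
  have m0: "m > 0" using c(1,2) by (simp add: m_def order_root)
  have e0: "e \<noteq> 0" using e(2) by auto
  have dl: "degree ([:- r1, 1:] ^ m) = m" by (simp add: degree_power_eq)
  then have dc: "degree c = m + degree e" unfolding e(1) using e0 by (simp add: degree_mult_eq)
  define P where "P = bf m ([:- r1, 1:] ^ m) U V"
  define Q where "Q = bf (degree e) e U V"
  have PQ: "bf (degree c) c U V = P * Q"
    unfolding P_def Q_def dc using bf_mult[of "[:- r1, 1:] ^ m" m e "degree e" U V] dl e(1) by simp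
  have at: "ev P v = (r - r1) ^ m \<and> ev Q v = poly e r" if "ev U v = r" "ev V v = 1" for v r
    using that dl by (simp add: P_def Q_def bfc_1)
  have nz: "v \<noteq> 0" if "ev V v = 1" for v using that hom_at_0[OF UV(2,3)] by auto
  obtain v w where v: "ev U v = r1" "ev V v = 1" and w: "ev U w = r2" "ev V w = 1" using UV(4) by metis
  have "poly e r1 \<noteq> 0" using e(2) by (simp add: poly_eq_0_iff_dvd)
  moreover have "poly e r2 = 0" using c(3,4) unfolding e(1) by simp
  ultimately have "ev P v = 0" "ev Q v \<noteq> 0" "ev P w \<noteq> 0" "ev Q w = 0"
    using at[OF v] at[OF w] m0 c(4) by auto
  then show ?thesis
    unfolding reducible_def PQ using nz[OF v(2)] nz[OF w(2)] hom_bf[OF UV(1,2)] P_def Q_def by metis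
qed

lemma linear_dvd_bf:
  assumes "degree c \<le> g" "poly c r = 0" "g > 0" shows "U - c3 r * V dvd bf g c U V"
proof (cases "c = 0")
  case False
  obtain e where e: "c = [:- r, 1:] * e" using assms(2) by (metis dvdE poly_eq_0_iff_dvd)
  then have "e \<noteq> 0" using False by auto
  then have "degree e \<le> g - 1" using assms(1) unfolding e by (simp add: degree_mult_eq del: mult_pCons_left)
  then have "bf (1 + (g - 1)) c U V = bf 1 [:- r, 1:] U V * bf (g - 1) e U V"
    unfolding e by (intro bf_mult) auto
  moreover have "1 + (g - 1) = g" using assms(3) by simp
  moreover have "bf 1 [:- r, 1:] U V = U - c3 r * V" unfolding bf_linear by (simp add: c3_hom)
  ultimately show ?thesis by simp
qed simp

text \<open>For all but one \<open>c\<close> the polynomial \<open>\<alpha> - c\<beta>\<close> has degree \<open>g\<close>. If it has only one root, this root is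
  multiple, hence a zero of the Wronskian of \<open>\<alpha>\<close> and \<open>\<beta>\<close>, and it determines \<open>c\<close>.\<close>

lemma composite_reducible:
  assumes UV: "hom j U" "hom j V" "j > 0" "\<And>r. \<exists>v. ev U v = r \<and> ev V v = 1"
    and \<alpha>: "degree \<alpha> \<le> g" and \<beta>: "degree \<beta> \<le> g" and g: "g \<ge> 2"
    and cop: "coprime (bf g \<alpha> U V) (bf g \<beta> U V)"
  shows "finite {c. \<not> reducible (bf g \<alpha> U V - c3 c * bf g \<beta> U V)}"
proof -
  have nounit: "\<not> is_unit p" if "ev p v = 0" for p v
  proof
    assume "is_unit p"
    then obtain q where "1 = p * q" by (auto simp: dvd_def)
    from arg_cong[OF this, of "\<lambda>p. ev p v"] show False using that by simp
  qed
  have noroot: False if "poly \<alpha> r = 0" "poly \<beta> r = 0" for r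
  proof -
    obtain v where "ev U v = r" "ev V v = 1" using UV(4) by blast
    then have "\<not> is_unit (U - c3 r * V)" by (intro nounit[of _ v]) simp
    moreover have "U - c3 r * V dvd bf g \<alpha> U V" "U - c3 r * V dvd bf g \<beta> U V"
      using linear_dvd_bf \<alpha> \<beta> that g by simp_all
    ultimately show False using cop coprime_common_divisor by blast
  qed
  have top: "coeff \<alpha> g \<noteq> 0 \<or> coeff \<beta> g \<noteq> 0"
  proof (rule ccontr)
    assume *: "\<not> ?thesis"
    have "V dvd bf g c U V" if "degree c \<le> g" "coeff c g = 0" for c
    proof -
      have "degree c \<le> g - 1"
        using that g by (intro degree_le) (metis Suc_pred' coeff_eq_0 le_neq_implies_less less_Suc_eq_le not_less_eq order_trans pos2 less_le_trans linorder_not_less)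
      then have "bf (1 + (g - 1)) ([:1:] * c) U V = bf 1 [:1:] U V * bf (g - 1) c U V"
        by (intro bf_mult) auto
      then show ?thesis using bf_linear[of 1 0 U V] g by simp
    qed
    then have "V dvd bf g \<alpha> U V" "V dvd bf g \<beta> U V" using * \<alpha> \<beta> by auto
    moreover have "\<not> is_unit V" using nounit hom_at_0[OF UV(2,3)] by blast
    ultimately show False using cop coprime_common_divisor by blast
  qed
  have cab: "coprime \<alpha> \<beta>"
  proof (rule coprimeI)
    fix D assume D: "D dvd \<alpha>" "D dvd \<beta>"
    have "constant (poly D)"
    proof (rule ccontr)
      assume "\<not> ?thesis"
      then obtain r where "poly D r = 0" using fundamental_theorem_of_algebra by blast
      then show False using D noroot[of r] by (auto simp: dvd_def)
    qed
    then obtain k where k: "D = [:k:]" using constant_degree[of D] degree_eq_zeroE by metis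
    have "k \<noteq> 0" using D top unfolding k by auto
    then show "is_unit D" unfolding k by (simp add: is_unit_const_poly_iff dvd_field_iff)
  qed
  define W where "W = pderiv \<alpha> * \<beta> - \<alpha> * pderiv \<beta>"
  have "W \<noteq> 0"
  proof
    assume "W = 0"
    then have e: "pderiv \<alpha> * \<beta> = \<alpha> * pderiv \<beta>" by (simp add: W_def)
    have "\<alpha> dvd pderiv \<alpha> * \<beta>" "\<beta> dvd \<alpha> * pderiv \<beta>" using e by (metis dvd_triv_left dvd_triv_right)+
    then have "\<alpha> dvd pderiv \<alpha>" "\<beta> dvd pderiv \<beta>" using cab
      by (simp_all add: coprime_dvd_mult_left_iff coprime_dvd_mult_right_iff coprime_commute del: dvd_pderiv_iff)
    then have "degree \<alpha> = 0" "degree \<beta> = 0" by simp_all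
    then show False using top g by (auto simp: coeff_eq_0)
  qed
  then have fin: "finite {r. poly W r = 0}" by (rule poly_roots_finite)
  have "c \<in> insert (coeff \<alpha> g / coeff \<beta> g) ((\<lambda>r. poly \<alpha> r / poly \<beta> r) ` {r. poly W r = 0})"
    if c: "\<not> reducible (bf g \<alpha> U V - c3 c * bf g \<beta> U V)" for c
  proof (rule ccontr)
    assume n: "\<not> ?thesis"
    define \<gamma> where "\<gamma> = \<alpha> - smult c \<beta>"
    have cg: "coeff \<gamma> g \<noteq> 0" using n top by (auto simp: \<gamma>_def field_simps)
    have "degree \<gamma> \<le> g" unfolding \<gamma>_def using \<alpha> \<beta>
      by (intro degree_diff_le) (auto intro: order_trans[OF degree_smult_le])
    then have dg: "degree \<gamma> = g" using le_degree[OF cg] by simp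
    have g0: "\<gamma> \<noteq> 0" using cg by auto
    have bfe: "bf g \<alpha> U V - c3 c * bf g \<beta> U V = bf (degree \<gamma>) \<gamma> U V"
      unfolding dg by (simp add: \<gamma>_def bf_diff bf_smult)
    have rt: "\<exists>r. poly q r = 0" if "degree q > 0" for q :: "complex poly"
      using that fundamental_theorem_of_algebra[of q] constant_degree[of q] by auto
    obtain r where r: "poly \<gamma> r = 0" using rt dg g by fastforce
    then obtain \<delta> where \<delta>: "\<gamma> = [:- r, 1:] * \<delta>" by (metis dvdE poly_eq_0_iff_dvd)
    then have "\<delta> \<noteq> 0" using g0 by auto
    then have "degree \<delta> = g - 1" using dg unfolding \<delta> by (simp add: degree_mult_eq del: mult_pCons_left)
    then obtain r' where r': "poly \<delta> r' = 0" using rt[of \<delta>] g by auto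
    have "r' = r"
    proof (rule ccontr)
      assume "r' \<noteq> r"
      moreover have "poly \<gamma> r' = 0" using r' by (simp add: \<delta>)
      ultimately have "reducible (bf (degree \<gamma>) \<gamma> U V)" using reducible_bf[OF UV g0 r, of r'] by auto
      then show False using c bfe by simp
    qed
    then have "poly (pderiv \<gamma>) r = 0" using r' unfolding \<delta> by (simp add: pderiv_mult pderiv_pCons del: mult_pCons_left)
    then have 1: "poly (pderiv \<alpha>) r = c * poly (pderiv \<beta>) r" by (simp add: \<gamma>_def pderiv_diff pderiv_smult)
    have 2: "poly \<alpha> r = c * poly \<beta> r" using r by (simp add: \<gamma>_def)
    have "poly \<beta> r \<noteq> 0" using noroot[of r] 2 by auto
    then have "c = poly \<alpha> r / poly \<beta> r" using 2 by simp
    moreover have "poly W r = 0" unfolding W_def using 1 2 by simp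
    ultimately show False using n by blast
  qed
  then have "{c. \<not> reducible (bf g \<alpha> U V - c3 c * bf g \<beta> U V)} \<subseteq>
      insert (coeff \<alpha> g / coeff \<beta> g) ((\<lambda>r. poly \<alpha> r / poly \<beta> r) ` {r. poly W r = 0})" by blast
  then show ?thesis using fin finite_subset by blast
qed

text \<open>In a composite pencil almost all members are reducible, while by hypothesis only
  finitely many are.\<close>

lemma not_composite:
  assumes UV: "hom j U" "hom j V" "j > 0" "\<And>r. \<exists>v. ev U v = r \<and> ev V v = 1"
    and A: "\<And>e. e \<in> supp A \<union> supp B \<Longrightarrow> \<exists>i\<le>g. \<forall>c. mono3 c e = c3 c * U ^ i * V ^ (g - i)"
    and cop: "coprime A B" and fin: "finite {c. reducible (A - c3 c * B)}"
  shows "g < 2"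
proof (rule ccontr)
  assume g: "\<not> g < 2"
  obtain \<alpha> where \<alpha>: "degree \<alpha> \<le> g" "A = bf g \<alpha> U V" using supp_bf[of A g U V] A by blast
  obtain \<beta> where \<beta>: "degree \<beta> \<le> g" "B = bf g \<beta> U V" using supp_bf[of B g U V] A by blast
  have "finite {c. \<not> reducible (A - c3 c * B)}"
    unfolding \<alpha>(2) \<beta>(2)
    using composite_reducible[OF UV \<alpha>(1) \<beta>(1)] g cop \<alpha>(2) \<beta>(2) by simp
  with fin have "finite ({c. reducible (A - c3 c * B)} \<union> {c. \<not> reducible (A - c3 c * B)})" by simp
  moreover have "{c. reducible (A - c3 c * B)} \<union> {c. \<not> reducible (A - c3 c * B)} = UNIV" by auto
  ultimately show False using infinite_UNIV_char_0[where 'a = complex] by simp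
qed

lemma two_variable_pencil:
  assumes A: "hom k A" "hom k B" "k > 0" and cop: "coprime A B"
    and fin: "finite {c. reducible (A - c3 c * B)}"
    and q: "\<And>e. e \<in> supp A \<union> supp B \<Longrightarrow> expo e q = 0"
  shows "k = 1"
proof -
  obtain p r where pr: "p \<noteq> r" "\<And>e c. expo e q = 0 \<Longrightarrow> (\<Sum>i\<in>UNIV. expo e i) = k \<Longrightarrow>
      expo e p \<le> k \<and> mono3 c e = c3 c * X p ^ (expo e p) * X r ^ (k - expo e p)"
  proof -
    consider "q = 1" | "q = 2" | "q = 3" using exhaust_3[of q] by blast
    then show ?thesis
    proof cases
      case 1 show ?thesis by (rule that[of 2 3]) (auto simp: 1 sum_3 mono3_def expo_def split: prod.splits)
    next
      case 2 show ?thesis by (rule that[of 1 3]) (auto simp: 2 sum_3 mono3_def expo_def split: prod.splits)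
    next
      case 3 show ?thesis by (rule that[of 1 2]) (auto simp: 3 sum_3 mono3_def expo_def split: prod.splits)
    qed
  qed
  have "k < 2"
  proof (rule not_composite[of 1 "X p" "X r", OF _ _ _ _ _ cop fin])
    fix s show "\<exists>v. ev (X p) v = s \<and> ev (X r) v = 1"
      using pr(1) by (intro exI[of _ "\<chi> i. if i = p then s else 1"]) auto
  next
    fix e assume e: "e \<in> supp A \<union> supp B"
    then have "(\<Sum>i\<in>UNIV. expo e i) = k" using hom_supp A by blast
    then show "\<exists>i\<le>k. \<forall>c. mono3 c e = c3 c * X p ^ i * X r ^ (k - i)" using pr(2) q[OF e] by blast
  qed auto
  then show ?thesis using A(3) by linarith
qed

text \<open>For each variable, coprimality gives a monomial without it; if no weight is zero, the
  other two weights have a negative real ratio. Around the cycle of the three variables the ratios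
  multiply to 1, but a product of three negative numbers is negative.\<close>

lemma zero_weight:
  assumes A: "hom k A" "hom k B" "k > 0" and cop: "coprime A B"
    and w: "\<And>e. e \<in> supp A \<union> supp B \<Longrightarrow> (\<Sum>i\<in>UNIV. a i * of_nat (expo e i)) = (0::complex)"
  shows "\<exists>i. a i = 0"
proof (rule ccontr)
  assume "\<not> ?thesis"
  then have nz: "a i \<noteq> 0" for i by blast
  have "\<exists>\<rho>>0. a p = - of_real \<rho> * a r" if pqr: "{p, q, r} = UNIV" "p \<noteq> q" "p \<noteq> r" "q \<noteq> r" for p q r
  proof -
    obtain e where e: "e \<in> supp A \<union> supp B" "expo e q = 0" using coprime_supp cop by blast
    have sum: "(\<Sum>i\<in>UNIV. f i) = f p + f q + f r" for f :: "3 \<Rightarrow> 'b::comm_monoid_add"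
      unfolding pqr(1)[symmetric] using pqr(2-4) by (simp add: add.assoc)
    have k: "expo e p + expo e r = k" using hom_supp[OF A(1), of e] hom_supp[OF A(2), of e] e by (auto simp: sum)
    have 0: "a p * of_nat (expo e p) + a r * of_nat (expo e r) = 0" using w[OF e(1)] e(2) by (simp add: sum)
    have "expo e p \<noteq> 0" using 0 k nz[of r] A(3) by (intro notI) auto
    moreover have "expo e r \<noteq> 0" using 0 k nz[of p] A(3) by (intro notI) auto
    ultimately show ?thesis using 0
      by (intro exI[of _ "real (expo e r) / real (expo e p)"]) (auto simp: field_simps add_eq_0_iff2)
  qed
  note * = this
  have u: "{1, 3, 2} = (UNIV :: 3 set)" "{2, 1, 3} = (UNIV :: 3 set)" "{3, 2, 1} = (UNIV :: 3 set)"
    unfolding UNIV_3 by blast+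
  obtain r1 where 1: "r1 > 0" "a 1 = - of_real r1 * a 2" using *[OF u(1)] three_neq by blast
  obtain r2 where 2: "r2 > 0" "a 2 = - of_real r2 * a 3" using *[OF u(2)] three_neq by blast
  obtain r3 where 3: "r3 > 0" "a 3 = - of_real r3 * a 1" using *[OF u(3)] three_neq by blast
  have "(1 + s * t * z) * x = 0" if "x = - s * y" "y = - t * w" "w = - z * x" for x y w s t z :: complex
  proof -
    have "x = - s * (- t * (- z * x))" using that by simp
    moreover have "(1 + s * t * z) * x = x - (- s * (- t * (- z * x)))" by (simp add: algebra_simps)
    ultimately show ?thesis by simp
  qed
  from this[OF 1(2) 2(2) 3(2)] have "(1 + of_real (r1 * r2 * r3)) * a 1 = 0" by simp
  then have "1 + complex_of_real (r1 * r2 * r3) = 0" using nz by simp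
  then have "1 + r1 * r2 * r3 = 0" by (metis of_real_1 of_real_add of_real_eq_0_iff)
  then show False using 1(1) 2(1) 3(1) by (smt (verit) mult_pos_pos)
qed

lemma complex_root_exists: "n > 0 \<Longrightarrow> \<exists>x::complex. x ^ n = r"
proof -
  assume n: "n > 0"
  have "coeff (monom 1 n - [:r:]) n = 1" using n by (cases n) auto
  then have "degree (monom 1 n - [:r:]) \<noteq> 0" using n le_degree[of "monom 1 n - [:r:]" n] by auto
  then have "\<not> constant (poly (monom 1 n - [:r:]))" using constant_degree[of "monom 1 n - [:r:]"] by simp
  then obtain x where "poly (monom 1 n - [:r:]) x = 0" using fundamental_theorem_of_algebra by blast
  then show ?thesis by (intro exI[of _ x]) (simp add: poly_monom)
qed

text \<open>The exponents of a monomial without \<open>X 3\<close>, in lowest terms, are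
  \<open>h\<close> and \<open>j\<close>. The weight condition makes every monomial a product of
  \<open>g\<close> factors \<open>U\<close> or \<open>V\<close>, so the pencil is composite unless
  \<open>g = 1\<close>.\<close>

lemma binomial_supp:
  assumes A: "hom k A" "hom k B" "k > 1" and cop: "coprime A B"
    and fin: "finite {c. reducible (A - c3 c * B)}"
    and w: "\<And>e. e \<in> supp A \<union> supp B \<Longrightarrow> (\<Sum>i\<in>UNIV. a i * of_nat (expo e i)) = (0::complex)"
    and a: "a 3 = 0" "a 1 \<noteq> 0 \<or> a 2 \<noteq> 0"
  shows "\<exists>h a1 a0 b1 b0. 0 < h \<and> h < k \<and> gcd h k = 1 \<and>
    A = c3 a1 * (X 1 ^ h * X 2 ^ (k - h)) + c3 a0 * X 3 ^ k \<and>
    B = c3 b1 * (X 1 ^ h * X 2 ^ (k - h)) + c3 b0 * X 3 ^ k"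
proof -
  have k0: "k > 0" using A by simp
  have w': "a 1 * of_nat (expo e 1) + a 2 * of_nat (expo e 2) = 0" "expo e 1 + expo e 2 + expo e 3 = k"
    if "e \<in> supp A \<union> supp B" for e
    using w[OF that] a(1) hom_supp[OF A(1), of e] hom_supp[OF A(2), of e] that by (auto simp: sum_3)
  have a1: "a 1 \<noteq> 0"
  proof
    assume "a 1 = 0"
    then have "expo e 2 = 0" if "e \<in> supp A \<union> supp B" for e using w'(1)[OF that] a(2) by simp
    then show False using two_variable_pencil[OF A(1,2) k0 cop fin, of 2] A(3) by simp
  qed
  have a2: "a 2 \<noteq> 0"
  proof
    assume "a 2 = 0"
    then have "expo e 1 = 0" if "e \<in> supp A \<union> supp B" for e using w'(1)[OF that] a(2) by simp
    then show False using two_variable_pencil[OF A(1,2) k0 cop fin, of 1] A(3) by simp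
  qed
  obtain e0 where e0: "e0 \<in> supp A \<union> supp B" "expo e0 3 = 0" using coprime_supp cop by blast
  define h0 where "h0 = expo e0 1"
  define j0 where "j0 = expo e0 2"
  have hj: "h0 + j0 = k" "a 1 * of_nat h0 + a 2 * of_nat j0 = 0"
    using w'[OF e0(1)] e0(2) by (simp_all add: h0_def j0_def)
  have h0: "h0 > 0" using hj a2 k0 by (cases "h0 = 0") auto
  have j0: "j0 > 0" using hj a1 k0 by (cases "j0 = 0") auto
  define g where "g = gcd h0 j0"
  obtain h j where h: "h0 = h * g" "j0 = j * g" "coprime h j"
    using gcd_coprime_exists[of h0 j0] h0 unfolding g_def by auto
  have g0: "g > 0" "h > 0" "j > 0" using h0 j0 h by (auto intro: Nat.gr0I)
  have kg: "k = (h + j) * g" using hj(1) h by (simp add: algebra_simps)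
  define U where "U = X 1 ^ h * X 2 ^ j"
  define V where "V = X 3 ^ (h + j)"
  have ex: "\<exists>i\<le>g. \<forall>c. mono3 c e = c3 c * U ^ i * V ^ (g - i)" if e: "e \<in> supp A \<union> supp B" for e
  proof -
    obtain x y z where xyz: "e = (x, y, z)" by (cases e)
    have 1: "a 1 * of_nat x + a 2 * of_nat y = 0" "x + y + z = k" using w'[OF e] by (simp_all add: xyz)
    have "a 1 * (of_nat x * of_nat j0) = (a 1 * of_nat x) * of_nat j0" by simp
    also have "\<dots> = - (a 2 * of_nat j0) * of_nat y" using 1(1) by (simp add: add_eq_0_iff2)
    also have "\<dots> = a 1 * (of_nat y * of_nat h0)"
    proof -
      have "a 2 * of_nat j0 = - (a 1 * of_nat h0)" using hj(2) by (simp add: add_eq_0_iff)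
      then show ?thesis by simp
    qed
    finally have "of_nat (x * j0) = (of_nat (y * h0) :: complex)" using a1 by simp
    then have "x * j0 = y * h0" by (simp only: of_nat_eq_iff)
    then have xj: "x * j = y * h" using g0 by (simp add: h(1,2))
    then have "h dvd x * j" by simp
    then have "h dvd x" using h(3) by (simp add: coprime_dvd_mult_left_iff)
    then obtain s where s: "x = h * s" by blast
    then have y: "y = j * s" using xj g0 by (simp add: mult.commute)
    have "(h + j) * s \<le> (h + j) * g" using 1(2) unfolding kg s y by (simp add: algebra_simps)
    then have sg: "s \<le> g" using g0 by simp
    have "z + (h + j) * s = (h + j) * g" using 1(2) unfolding kg s y by (simp add: algebra_simps)
    then have z: "z = (h + j) * (g - s)" unfolding diff_mult_distrib2 by linarith
    have "mono3 c e = c3 c * U ^ s * V ^ (g - s)" for c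
      unfolding xyz s y z mono3_def U_def V_def prod.case power_mult power_mult_distrib
      by (simp only: mult.assoc)
    then show ?thesis using sg by blast
  qed
  have hU: "hom (h + j) U" unfolding U_def
    by (rule hom_mult'[OF hom_power[OF hom_X(1)] hom_power[OF hom_X(1)]]) simp
  have hV: "hom (h + j) V" unfolding V_def using hom_power[OF hom_X(1)[of 3], of "h + j"] by simp
  have surj: "\<exists>v. ev U v = r \<and> ev V v = 1" for r
  proof -
    obtain x where "x ^ h = r" using complex_root_exists g0(2) by blast
    then show ?thesis by (intro exI[of _ "vector [x, 1, 1]"]) (simp add: U_def V_def)
  qed
  have "g < 2" using not_composite[OF hU hV _ surj ex cop fin] g0 by simp
  then have g1: "g = 1" using g0 by simp
  then have kh: "k = h + j" using kg by simp
  have "gcd h (h + j) = 1" using h(3) by (simp add: gcd_add2)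
  obtain \<alpha> where \<alpha>: "degree \<alpha> \<le> 1" "A = bf 1 \<alpha> U V" using supp_bf[of A 1 U V] ex unfolding g1 by blast
  obtain \<beta> where \<beta>: "degree \<beta> \<le> 1" "B = bf 1 \<beta> U V" using supp_bf[of B 1 U V] ex unfolding g1 by blast
  have b1: "bf 1 c U V = c3 (coeff c 1) * (X 1 ^ h * X 2 ^ (k - h)) + c3 (coeff c 0) * X 3 ^ k" for c
    by (simp add: bf_def kh U_def V_def add.commute)
  show ?thesis
    by (rule exI[of _ h], rule exI[of _ "coeff \<alpha> 1"], rule exI[of _ "coeff \<alpha> 0"],
        rule exI[of _ "coeff \<beta> 1"], rule exI[of _ "coeff \<beta> 0"])
      (use \<open>gcd h (h + j) = 1\<close> g0 kh \<alpha>(2) \<beta>(2) b1 in simp)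
qed

section \<open>Classification of the invariant pencils\<close>

definition colmat :: "(3 \<Rightarrow> complex ^ 3) \<Rightarrow> complex ^ 3 ^ 3" where
  "colmat u = (\<chi> i j. u j $ i)"

lemma colmat_mult: "colmat u *v x = (\<Sum>j\<in>UNIV. x $ j *s u j)"
  by (simp add: colmat_def matrix_vector_mult_def vec_eq_iff mult.commute)

lemma invertibleI_inj:
  fixes M :: "complex ^ 'n ^ 'n"
  assumes "\<And>v. M *v v = 0 \<Longrightarrow> v = 0" shows "invertible M"
proof -
  have "inj ((*v) M)"
  proof (rule injI)
    fix x y assume "M *v x = M *v y"
    then have "M *v (x - y) = 0" by (simp add: matrix_vector_mult_diff_distrib)
    then show "x = y" using assms by fastforce
  qed
  then show ?thesis by (simp add: invertible_left_inverse matrix_left_invertible_injective)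
qed

lemma invertible_colmat: "basis3 u \<Longrightarrow> invertible (colmat u)"
  by (rule invertibleI_inj) (simp add: colmat_mult basis3_def vec_eq_iff)

lemma cmp_mv_cmp_mv: "P ** Q = mat 1 \<Longrightarrow> cmp (cmp q (mv P)) (mv Q) = q"
  by (rule p3_eqI) (simp add: evv_mv matrix_vector_mul_assoc)

lemma hom_mv: "\<forall>i. hom 1 (mv P $ i)"
  by simp

lemma hom_cmp_mv: "hom k A \<Longrightarrow> hom k (cmp A (mv P))"
  using hom_cmp[OF _ hom_mv, of k A P] by simp

lemma coprime_cmp_mv:
  assumes "invertible P" "coprime A B" shows "coprime (cmp A (mv P)) (cmp B (mv P))"
proof (rule coprimeI)
  obtain Q where Q: "P ** Q = mat 1" "Q ** P = mat 1" using assms(1) by (auto simp: invertible_def)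
  fix D assume D: "D dvd cmp A (mv P)" "D dvd cmp B (mv P)"
  have "cmp D (mv Q) dvd A" "cmp D (mv Q) dvd B"
    using cmp_dvd[OF D(1), of "mv Q"] cmp_dvd[OF D(2), of "mv Q"] cmp_mv_cmp_mv[OF Q(1)] by simp_all
  then have "is_unit (cmp D (mv Q))" using assms(2) coprime_common_divisor by blast
  from cmp_dvd[OF this, of "mv P"] show "is_unit D" using cmp_mv_cmp_mv[OF Q(2)] by simp
qed

lemma reducible_cmp_mv:
  assumes "invertible P" "reducible (cmp p (mv P))" shows "reducible p"
proof -
  obtain Q where Q: "P ** Q = mat 1" "Q ** P = mat 1" using assms(1) by (auto simp: invertible_def)
  obtain p1 p2 n m v w where r: "hom n p1" "hom m p2" "cmp p (mv P) = p1 * p2" "v \<noteq> 0" "w \<noteq> 0"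
    "ev p1 v = 0" "ev p2 v \<noteq> 0" "ev p1 w \<noteq> 0" "ev p2 w = 0"
    using assms(2) unfolding reducible_def by blast
  have "p = cmp p1 (mv Q) * cmp p2 (mv Q)"
    using arg_cong[OF r(3), of "\<lambda>q. cmp q (mv Q)"] cmp_mv_cmp_mv[OF Q(1)] by simp
  moreover have "Q *v (P *v x) = x" for x using Q(2) by (simp add: matrix_vector_mul_assoc)
  moreover from this have "P *v x \<noteq> 0" if "x \<noteq> 0" for x using that by (metis matrix_vector_mult_0_right)
  ultimately show ?thesis
    unfolding reducible_def using r hom_cmp_mv[of n p1 Q] hom_cmp_mv[of m p2 Q]
    by - (rule exI[of _ "cmp p1 (mv Q)"], rule exI[of _ "cmp p2 (mv Q)"], rule exI[of _ n], rule exI[of _ m],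
        rule exI[of _ "P *v v"], rule exI[of _ "P *v w"], simp add: evv_mv)
qed

text \<open>Chain rule: the numbers \<open>b\<close> are the components of \<open>V\<close> in the
  basis \<open>u\<close>, hence those of the derivation in the new coordinates.\<close>

lemma lie_colmat:
  assumes "evv V (colmat u *v v) = (\<Sum>i\<in>UNIV. b i *s u i)"
  shows "ev (lie V A) (colmat u *v v) = (\<Sum>i\<in>UNIV. b i * ev (pd i (cmp A (mv (colmat u)))) v)"
proof -
  have "ev (lie V A) (colmat u *v v) =
      (\<Sum>j\<in>UNIV. evv V (colmat u *v v) $ j * ev (pd j A) (colmat u *v v))"
    by (simp add: lie_def dot_def)
  also have "\<dots> = (\<Sum>i\<in>UNIV. b i * ev (pd i (cmp A (mv (colmat u)))) v)"
    unfolding assms by (simp add: pd_cmp evv_mv colmat_def sum_3 algebra_simps)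
  finally show ?thesis .
qed

theorem pencil_classification:
  assumes F: "nondeg d F" "d > 1" and AB: "coprime A B" "hom k A" "hom k B" "k > 0"
    and inv: "\<And>c. \<exists>s t. (s \<noteq> 0 \<or> t \<noteq> 0) \<and>
      (\<forall>v. ev A v = c * ev B v \<longrightarrow> s * ev (cmp A F) v + t * ev (cmp B F) v = 0)"
    and fin: "finite {c. reducible (A - c3 c * B)}"
  shows "k = 1 \<or> (\<exists>P h a1 a0 b1 b0. invertible P \<and> 0 < h \<and> h < k \<and> gcd h k = 1 \<and>
    cmp A (mv P) = c3 a1 * (X 1 ^ h * X 2 ^ (k - h)) + c3 a0 * X 3 ^ k \<and>
    cmp B (mv P) = c3 b1 * (X 1 ^ h * X 2 ^ (k - h)) + c3 b0 * X 3 ^ k)"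
proof (cases "k = 1")
  case False
  then have k1: "k > 1" using AB(4) by simp
  have tr: "coprime (cmp A (mv P)) (cmp B (mv P))" "hom k (cmp A (mv P))" "hom k (cmp B (mv P))"
    "finite {c. reducible (cmp A (mv P) - c3 c * cmp B (mv P))}" if "invertible P" for P
  proof -
    have "{c. reducible (cmp A (mv P) - c3 c * cmp B (mv P))} \<subseteq> {c. reducible (A - c3 c * B)}"
    proof safe
      fix c assume "reducible (cmp A (mv P) - c3 c * cmp B (mv P))"
      then have "reducible (cmp (A - c3 c * B) (mv P))" by simp
      then show "reducible (A - c3 c * B)" using reducible_cmp_mv that by blast
    qed
    then show "finite {c. reducible (cmp A (mv P) - c3 c * cmp B (mv P))}" using fin finite_subset by blast
  qed (use coprime_cmp_mv hom_cmp_mv AB that in auto)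
  from foliation_small_degree[OF F AB inv] show ?thesis
  proof (elim disjE exE conjE)
    fix m assume m: "m \<noteq> 0" "lie (\<chi> i. c3 (m $ i)) A = 0" "lie (\<chi> i. c3 (m $ i)) B = 0"
    \<comment> \<open>With \<open>m\<close> as third basis vector the constant field becomes the
      third partial derivative, so \<open>X 3\<close> disappears from both polynomials.\<close>
    have "\<exists>u. basis3 u \<and> u 3 = m"
    proof -
      consider "m $ 1 \<noteq> 0" | "m $ 2 \<noteq> 0" | "m $ 3 \<noteq> 0" using m(1) by (auto simp: vec3_eq)
      then show ?thesis
      proof cases
        case 1 then show ?thesis
          by (intro exI[of _ "\<lambda>i. if i = 1 then axis 2 1 else if i = 2 then axis 3 1 else m"])
            (auto simp: basis3_def sum_3 vec3_eq axis_def forall_3)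
      next
        case 2 then show ?thesis
          by (intro exI[of _ "\<lambda>i. if i = 1 then axis 1 1 else if i = 2 then axis 3 1 else m"])
            (auto simp: basis3_def sum_3 vec3_eq axis_def forall_3)
      next
        case 3 then show ?thesis
          by (intro exI[of _ "\<lambda>i. if i = 1 then axis 1 1 else if i = 2 then axis 2 1 else m"])
            (auto simp: basis3_def sum_3 vec3_eq axis_def forall_3)
      qed
    qed
    then obtain u where u: "basis3 u" "u 3 = m" by blast
    have z: "pd 3 (cmp p (mv (colmat u))) = 0" if "lie (\<chi> i. c3 (m $ i)) p = 0" for p
    proof (rule p3_eqI)
      fix v
      have "evv (\<chi> i. c3 (m $ i)) (colmat u *v v) = (\<Sum>i\<in>UNIV. ((if i = 3 then 1 else 0) * 1) *s u i)"
        by (simp add: vec_eq_iff sum_3 u(2))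
      from lie_colmat[where b = "\<lambda>i. (if i = 3 then 1 else 0) * 1", OF this, of p] show "ev (pd 3 (cmp p (mv (colmat u)))) v = ev 0 v"
        using that by (simp add: sum_3)
    qed
    have "expo e 3 = 0" if e: "e \<in> supp (cmp A (mv (colmat u))) \<union> supp (cmp B (mv (colmat u)))" for e
    proof -
      have "expo e 3 = 0" if "pd 3 p = 0" "e \<in> supp p" for p
        using cf_weight[of "axis 3 1" p 0 e] that by (simp add: sum_3 axis_def)
      then show ?thesis using e z[OF m(2)] z[OF m(3)] by blast
    qed
    then show ?thesis
      using two_variable_pencil[OF tr(2,3) AB(4) tr(1,4), of "colmat u" 3] invertible_colmat[OF u(1)] by blast
  next
    fix M D c \<kappa> h
    assume M: "\<forall>i. omega A B $ i = D * crs XX (mv M) $ i" "cop3 (crs XX (mv M))"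
      "lie (mv M) A = c3 c * A" "lie (mv M) B = c3 c * B" "\<kappa> \<noteq> 0"
      "\<forall>v. M *v evv F v = \<kappa> *s evv (push F (mv M)) v + h *s evv F v"
    have no: "shift M \<eta> w = 0" if "shift M \<eta> (shift M \<eta> w) = 0" for \<eta> w
      using no_generalized_eigenvector[OF F M(5) _ that] M(6) by blast
    obtain u a where u: "basis3 u" "\<And>i. M *v u i = a i *s u i" using eigenbasis[OF no] by blast
    \<comment> \<open>A multiple of the radial field is subtracted from \<open>M\<close>; on forms
      of degree \<open>k\<close> this moves the common eigenvalue \<open>c\<close> of
      \<open>A\<close> and \<open>B\<close> to zero.\<close>
    define a' where "a' i = a i - c / of_nat k" for i
    have wt: "(\<Sum>i\<in>UNIV. a' (\<tau> i) * of_nat (expo e i)) = 0"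
      if \<tau>: "bij \<tau>" and e: "e \<in> supp (cmp A (mv (colmat (u \<circ> \<tau>)))) \<union> supp (cmp B (mv (colmat (u \<circ> \<tau>))))" for \<tau> e
    proof -
      let ?P = "colmat (u \<circ> \<tau>)"
      have "(\<Sum>i\<in>UNIV. a' (\<tau> i) * of_nat (expo e i)) = 0"
        if p: "lie (mv M) p = c3 c * p" "hom k p" "e \<in> supp (cmp p (mv ?P))" for p
      proof -
        have "(\<Sum>i\<in>UNIV. c3 ((\<chi> i. a (\<tau> i)) $ i) * X i * pd i (cmp p (mv ?P))) = c3 c * cmp p (mv ?P)"
        proof (rule p3_eqI)
          fix v
          have "evv (mv M) (?P *v v) = (\<Sum>i\<in>UNIV. (a (\<tau> i) * v $ i) *s (u \<circ> \<tau>) i)"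
            unfolding evv_mv colmat_mult
            by (simp add: sum_3 matrix_vector_right_distrib vector_scalar_commute u(2) vector_smult_assoc mult.commute)
          from lie_colmat[where b = "\<lambda>i. a (\<tau> i) * v $ i", OF this, of p]
          show "ev (\<Sum>i\<in>UNIV. c3 ((\<chi> i. a (\<tau> i)) $ i) * X i * pd i (cmp p (mv ?P))) v = ev (c3 c * cmp p (mv ?P)) v"
            by (simp add: p(1) evv_mv)
        qed
        from cf_weight[OF this p(3)] have 1: "(\<Sum>i\<in>UNIV. a (\<tau> i) * of_nat (expo e i)) = c" by simp
        have "(\<Sum>i\<in>UNIV. expo e i) = k" using hom_supp[OF hom_cmp_mv[OF p(2)] p(3)] .
        then have 2: "(\<Sum>i\<in>UNIV. (of_nat (expo e i) :: complex)) = of_nat k" by (metis of_nat_sum)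
        have "(\<Sum>i\<in>UNIV. a' (\<tau> i) * of_nat (expo e i)) = c - (c / of_nat k) * of_nat k"
          unfolding a'_def left_diff_distrib sum_subtractf 1 sum_distrib_left[symmetric] 2 ..
        then show ?thesis using AB(4) by simp
      qed
      then show ?thesis using e M(3,4) AB by blast
    qed
    have bas: "basis3 (u \<circ> \<tau>)" if "bij \<tau>" for \<tau>
      unfolding basis3_def
    proof (intro allI impI)
      fix x i assume "(\<Sum>i\<in>UNIV. x i *s (u \<circ> \<tau>) i) = 0"
      moreover have "(\<Sum>i\<in>UNIV. x i *s (u \<circ> \<tau>) i) = (\<Sum>i\<in>UNIV. x (inv \<tau> (\<tau> i)) *s u (\<tau> i))"
        using that by (simp add: bij_is_inj)
      moreover have "\<dots> = (\<Sum>i\<in>UNIV. x (inv \<tau> i) *s u i)"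
        using that by (intro sum.reindex_bij_betw)
      ultimately have "(\<Sum>i\<in>UNIV. x (inv \<tau> i) *s u i) = 0" by simp
      then have "x (inv \<tau> (\<tau> i)) = 0"
        using u(1)[unfolded basis3_def, THEN spec, of "\<lambda>i. x (inv \<tau> i)"] by blast
      then show "x i = 0" using that by (simp add: bij_is_inj)
    qed
    obtain i0 where i0: "a' i0 = 0"
      using zero_weight[OF tr(2,3) AB(4) tr(1), of "colmat u" a'] wt[of id] invertible_colmat[OF u(1)]
      by auto
    define \<tau> where "\<tau> = Transposition.transpose i0 3"
    have \<tau>: "bij \<tau>" by (simp add: \<tau>_def)
    have \<tau>3: "a' (\<tau> 3) = 0" using i0 by (simp add: \<tau>_def)
    \<comment> \<open>If all weights vanished, \<open>M\<close> would be scalar and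
      \<open>crs XX (mv M)\<close> zero, which is not free of common factors.\<close>
    have "a' (\<tau> 1) \<noteq> 0 \<or> a' (\<tau> 2) \<noteq> 0"
    proof (rule ccontr)
      assume "\<not> ?thesis"
      then have az: "a' (\<tau> i) = 0" for i using \<tau>3 exhaust_3[of i] by auto
      obtain Q where Q: "colmat (u \<circ> \<tau>) ** Q = mat 1"
        using invertible_colmat[OF bas[OF \<tau>]] by (auto simp: invertible_def)
      have "M *v x = (c / of_nat k) *s x" for x
      proof -
        define y where "y = Q *v x"
        have x: "x = colmat (u \<circ> \<tau>) *v y" using Q by (simp add: y_def matrix_vector_mul_assoc)
        have "M *v u (\<tau> i) = (c / of_nat k) *s u (\<tau> i)" for i using az[of i] u(2) by (simp add: a'_def)
        then show ?thesis unfolding x colmat_mult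
          by (simp add: sum_3 matrix_vector_right_distrib vector_scalar_commute vector_smult_assoc
              vector_add_ldistrib mult.commute)
      qed
      then have "evv (crs XX (mv M)) x = 0" for x
        unfolding evv_crs evv_mv by (simp add: vec3_eq)
      then have "\<forall>i. crs XX (mv M) $ i = 0" by (auto intro!: p3_eqI simp: vec_eq_iff)
      then show False using M(2) unfolding cop3_def by (metis dvd_refl not_is_unit_0)
    qed
    moreover have "invertible (colmat (u \<circ> \<tau>))" using invertible_colmat[OF bas[OF \<tau>]] .
    ultimately show ?thesis
      using binomial_supp[OF tr(2,3) k1 tr(1,4) wt[OF \<tau>] \<tau>3] by metis
  qed
qed simp

section \<open>The polynomials of the statement\<close>

lemma eval_superset:
  fixes F :: "'n::finite mpoly"
  assumes "finite S" "Poly_Mapping.keys F \<subseteq> S"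
  shows "eval F v = (\<Sum>m\<in>S. Poly_Mapping.lookup F m * (\<Prod>i\<in>UNIV. (v $ i) ^ Poly_Mapping.lookup m i))"
  unfolding eval_def using assms by (intro sum.mono_neutral_left) (auto simp: in_keys_iff)

lemma eval_add [simp]: "eval (F + G) v = eval F v + eval G v"
proof -
  let ?S = "Poly_Mapping.keys F \<union> Poly_Mapping.keys G"
  have "eval H v = (\<Sum>m\<in>?S. Poly_Mapping.lookup H m * (\<Prod>i\<in>UNIV. (v $ i) ^ Poly_Mapping.lookup m i))"
    if "H \<in> {F, G, F + G}" for H
    using that keys_add[of F G] by (intro eval_superset) auto
  then show ?thesis by (simp add: lookup_add algebra_simps sum.distrib)
qed

lemma eval_0 [simp]: "eval 0 v = 0"
  by (simp add: eval_def)

lemma eval_single: "eval (Poly_Mapping.single m c) v = c * (\<Prod>i\<in>UNIV. (v $ i) ^ Poly_Mapping.lookup m i)"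
  by (simp add: eval_def)

lemma eval_sum [simp]: "eval (sum f A) v = (\<Sum>a\<in>A. eval (f a) v)"
  by (induction A rule: infinite_finite_induct) auto

lemma mpoly_expansion: "(\<Sum>m\<in>Poly_Mapping.keys F. Poly_Mapping.single m (Poly_Mapping.lookup F m)) = F"
  by (rule poly_mapping_eqI) (auto simp: lookup_sum lookup_single when_def in_keys_iff)

lemma eval_mult [simp]: "eval (F * G) v = eval F v * eval G v"
proof -
  let ?s = "\<lambda>F m. Poly_Mapping.single m (Poly_Mapping.lookup F m)"
  have s: "eval (Poly_Mapping.single m c * Poly_Mapping.single n d) v =
      eval (Poly_Mapping.single m c) v * eval (Poly_Mapping.single n d) v" for m n c d
    by (simp add: mult_single eval_single lookup_add power_add prod.distrib)
  have "F * G = (\<Sum>m\<in>Poly_Mapping.keys F. \<Sum>n\<in>Poly_Mapping.keys G. ?s F m * ?s G n)"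
    by (simp only: sum_product[symmetric] mpoly_expansion)
  then have "eval (F * G) v = (\<Sum>m\<in>Poly_Mapping.keys F. eval (?s F m) v) * (\<Sum>n\<in>Poly_Mapping.keys G. eval (?s G n) v)"
    by (simp only: eval_sum s sum_product)
  then show ?thesis by (simp only: eval_sum[symmetric] mpoly_expansion)
qed

lemma eval_Const [simp]: "eval (Const c) v = c"
  by (simp add: Const_def eval_single)

lemma eval_Var [simp]: "eval (Var i) v = v $ i"
proof -
  have "(\<Prod>j\<in>UNIV. (v $ j) ^ Poly_Mapping.lookup (Poly_Mapping.single i 1) j) =
      (\<Prod>j\<in>UNIV. if j = i then v $ i else 1)"
    by (intro prod.cong) (auto simp: lookup_single when_def)
  then show ?thesis by (simp add: Var_def eval_single)
qed

lemma eval_1 [simp]: "eval 1 v = 1"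
  using eval_Const[of 1 v] by (simp add: Const_def)

lemma eval_power [simp]: "eval (F ^ n) v = eval F v ^ n"
  by (induction n) auto

lemma eval_prod [simp]: "eval (prod f A) v = (\<Prod>a\<in>A. eval (f a) v)"
  by (induction A rule: infinite_finite_induct) auto

section \<open>Comparison of the two types of polynomials\<close>

definition triple :: "(3 \<Rightarrow>\<^sub>0 nat) \<Rightarrow> nat \<times> nat \<times> nat" where
  "triple m = (Poly_Mapping.lookup m 1, Poly_Mapping.lookup m 2, Poly_Mapping.lookup m 3)"

definition untriple :: "nat \<times> nat \<times> nat \<Rightarrow> (3 \<Rightarrow>\<^sub>0 nat)" where
  "untriple e = Poly_Mapping.single 1 (expo e 1) + Poly_Mapping.single 2 (expo e 2) + Poly_Mapping.single 3 (expo e 3)"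

lemma lookup_untriple: "Poly_Mapping.lookup (untriple e) i = expo e i"
  using exhaust_3[of i] by (auto simp: untriple_def lookup_add lookup_single when_def)

lemma expo_triple: "expo (triple m) i = Poly_Mapping.lookup m i"
  using exhaust_3[of i] by (auto simp: triple_def)

lemma triple_inj: "triple m = triple n \<longleftrightarrow> m = n"
proof
  assume "triple m = triple n"
  then have "Poly_Mapping.lookup m i = Poly_Mapping.lookup n i" for i
    using expo_triple[of m i] expo_triple[of n i] by simp
  then show "m = n" by (rule poly_mapping_eqI)
qed simp

lemma triple_untriple [simp]: "triple (untriple e) = e"
  by (cases e) (simp add: triple_def lookup_untriple)

definition to_p3 :: "3 mpoly \<Rightarrow> p3" where
  "to_p3 F = (\<Sum>m\<in>Poly_Mapping.keys F. mono3 (Poly_Mapping.lookup F m) (triple m))"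

definition of_p3 :: "p3 \<Rightarrow> 3 mpoly" where
  "of_p3 p = (\<Sum>e\<in>supp p. Poly_Mapping.single (untriple e) (cf p e))"

lemma ev_mono3: "ev (mono3 c e) v = c * (\<Prod>i\<in>UNIV. (v $ i) ^ expo e i)"
  unfolding UNIV_3 by (cases e) (simp add: mono3_def)

lemma ev_to_p3 [simp]: "ev (to_p3 F) v = eval F v"
  by (simp add: to_p3_def ev_mono3 eval_def expo_triple)

lemma eval_of_p3 [simp]: "eval (of_p3 p) v = ev p v"
proof -
  have "eval (of_p3 p) v = ev (\<Sum>e\<in>supp p. mono3 (cf p e) e) v"
    by (simp add: of_p3_def eval_single lookup_untriple ev_mono3)
  then show ?thesis by (simp only: monomial_expansion[symmetric])
qed

lemma cf_to_p3: "cf (to_p3 F) (triple m) = Poly_Mapping.lookup F m"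
  by (auto simp: to_p3_def cf_sum cf_mono3 triple_inj in_keys_iff)

lemma mpoly_eqI: fixes F G :: "3 mpoly" assumes "\<And>v. eval F v = eval G v" shows "F = G"
proof (rule poly_mapping_eqI)
  fix m
  have "to_p3 F = to_p3 G" by (rule p3_eqI) (simp add: assms)
  then show "Poly_Mapping.lookup F m = Poly_Mapping.lookup G m" using cf_to_p3 by metis
qed

lemma to_p3_simps: "to_p3 (F + G) = to_p3 F + to_p3 G" "to_p3 (F * G) = to_p3 F * to_p3 G"
    "to_p3 (Const c) = c3 c" "to_p3 (Var i) = X i" "to_p3 (of_p3 p) = p" "to_p3 (F ^ n) = to_p3 F ^ n"
  by (rule p3_eqI, simp)+

lemma homogeneous_iff: "homogeneous d F \<longleftrightarrow> hom d (to_p3 F)"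
proof
  assume h: "homogeneous d F"
  show "hom d (to_p3 F)"
    unfolding to_p3_def
  proof (rule hom_sum)
    fix m assume "m \<in> Poly_Mapping.keys F"
    then have m: "(\<Sum>i\<in>UNIV. Poly_Mapping.lookup m i) = d" using h by (simp add: homogeneous_def)
    have "(\<Prod>i\<in>UNIV. (t * v $ i) ^ Poly_Mapping.lookup m i) =
        t ^ d * (\<Prod>i\<in>UNIV. (v $ i) ^ Poly_Mapping.lookup m i)" for t and v :: "complex ^ 3"
      unfolding m[symmetric] by (simp add: power_mult_distrib prod.distrib power_sum)
    then show "hom d (mono3 (Poly_Mapping.lookup F m) (triple m))"
      by (simp add: hom_def ev_mono3 expo_triple)
  qed
next
  assume h: "hom d (to_p3 F)"
  show "homogeneous d F"
    unfolding homogeneous_def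
  proof
    fix m assume "m \<in> Poly_Mapping.keys F"
    then have "triple m \<in> supp (to_p3 F)" by (simp add: supp_def cf_to_p3 in_keys_iff)
    from hom_supp[OF h this] show "(\<Sum>i\<in>UNIV. Poly_Mapping.lookup m i) = d" by (simp add: expo_triple)
  qed
qed

lemma no_common_factor_coprime: assumes "no_common_factor A B" shows "coprime (to_p3 A) (to_p3 B)"
proof (rule coprimeI)
  fix D assume D: "D dvd to_p3 A" "D dvd to_p3 B"
  have "of_p3 D dvd G" if dvd: "D dvd to_p3 G" for G
  proof -
    obtain H where H: "to_p3 G = D * H" using dvd by (auto simp: dvd_def)
    have "G = of_p3 D * of_p3 H"
    proof (rule mpoly_eqI)
      fix v show "eval G v = eval (of_p3 D * of_p3 H) v"
        using arg_cong[OF H, of "\<lambda>p. ev p v"] by simp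
    qed
    then show ?thesis by simp
  qed
  then have "of_p3 D dvd 1" using assms D unfolding no_common_factor_def by blast
  then obtain H where "1 = of_p3 D * H" by (auto simp: dvd_def)
  then have "to_p3 1 = D * to_p3 H" using to_p3_simps by metis
  moreover have "to_p3 1 = 1" by (rule p3_eqI) simp
  ultimately show "is_unit D" by (metis dvd_triv_left)
qed

lemma vars_of_p3: assumes "\<And>e. e \<in> supp p \<Longrightarrow> expo e 3 = 0" shows "vars (of_p3 p) \<subseteq> {1, 2}"
proof -
  have "m \<in> untriple ` supp p" if "m \<in> Poly_Mapping.keys (of_p3 p)" for m
  proof -
    have "triple m \<in> supp p"
      using that cf_to_p3[of "of_p3 p" m] by (simp add: to_p3_simps supp_def in_keys_iff)
    moreover have "untriple (triple m) = m" using triple_inj triple_untriple by metis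
    ultimately show ?thesis by (metis imageI)
  qed
  then have "Poly_Mapping.lookup m 3 = 0" if "m \<in> Poly_Mapping.keys (of_p3 p)" for m
    using that assms by (fastforce simp: lookup_untriple)
  then have "i \<noteq> 3" if "i \<in> vars (of_p3 p)" for i using that by (auto simp: vars_def in_keys_iff)
  then show ?thesis using exhaust_3 by blast
qed

section \<open>Points, automorphisms and endomorphisms\<close>

lemma rep_proj_nonzero [simp]: "rep_proj p \<noteq> 0"
  using Quotient_rep_reflp[OF Quotient_proj, of p] by (simp add: proj_rel_def)

lemma abs_rep_proj [simp]: "abs_proj (rep_proj p) = p"
  by (rule Quotient_abs_rep[OF Quotient_proj])

lemma abs_proj_eq: assumes "u \<noteq> 0" "v \<noteq> 0" shows "abs_proj u = abs_proj v \<longleftrightarrow> (\<exists>c. c \<noteq> 0 \<and> v = c *s u)"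
proof -
  have refl: "proj_rel w w" if "w \<noteq> 0" for w :: "complex ^ 'a"
    unfolding proj_rel_def using that by (auto intro: exI[of _ 1])
  show ?thesis
    using Quotient_rel[OF Quotient_proj, of u v] refl[OF assms(1)] refl[OF assms(2)] assms
    by (auto simp: proj_rel_def)
qed

lemma rep_abs_proj: assumes "v \<noteq> 0" shows "\<exists>c. c \<noteq> 0 \<and> rep_proj (abs_proj v) = c *s v"
  using abs_proj_eq[OF assms rep_proj_nonzero, of "abs_proj v"] by simp

lemma abs_proj_cases: obtains v where "v \<noteq> 0" "p = abs_proj v"
  using rep_proj_nonzero abs_rep_proj by metis

lemma invertible_mult_nonzero: "invertible M \<Longrightarrow> v \<noteq> 0 \<Longrightarrow> M *v v \<noteq> (0 :: complex ^ 'n)"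
  by (metis invertible_def matrix_vector_mul_assoc matrix_vector_mul_lid matrix_vector_mult_0_right)

lemma proj_map_abs:
  fixes M :: "complex ^ 'n ^ 'n"
  assumes "invertible M" "v \<noteq> 0" shows "proj_map M (abs_proj v) = abs_proj (M *v v)"
proof -
  obtain c where c: "c \<noteq> 0" "rep_proj (abs_proj v) = c *s v" using rep_abs_proj assms(2) by blast
  have "M *v (c *s v) = c *s (M *v v)" by (simp add: vector_scalar_commute)
  moreover from this have "abs_proj (M *v v) = abs_proj (M *v (c *s v))"
    using c(1) invertible_mult_nonzero[OF assms] by (subst abs_proj_eq) auto
  ultimately show ?thesis by (simp add: proj_map_def c(2))
qed

lemma invertibleE:
  fixes M :: "complex ^ 'n ^ 'n"
  assumes "invertible M"
  obtains N where "invertible N" "M ** N = mat 1" "N ** M = mat 1"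
  using assms unfolding invertible_def by blast

lemma proj_map_inverse:
  fixes M N :: "complex ^ 'n ^ 'n"
  assumes "invertible N" "invertible M" "M ** N = mat 1"
  shows "proj_map M (proj_map N p) = p"
proof -
  obtain v where v: "v \<noteq> 0" "p = abs_proj v" by (rule abs_proj_cases)
  then show ?thesis
    using assms by (simp add: proj_map_abs invertible_mult_nonzero matrix_vector_mul_assoc)
qed

lemma inv_proj_map:
  fixes M N :: "complex ^ 'n ^ 'n"
  assumes "invertible M" "invertible N" "M ** N = mat 1" "N ** M = mat 1"
  shows "inv (proj_map M) = proj_map N"
  using proj_map_inverse[OF assms(1,2,4)] proj_map_inverse[OF assms(2,1,3)]
  by (intro inv_equality) auto

text \<open>\<open>endo_form\<close> describes the map at chosen representatives; here the formula
  is available at every nonzero vector.\<close>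

definition represents :: "nat \<Rightarrow> p3 ^ 3 \<Rightarrow> (3 proj \<Rightarrow> 3 proj) \<Rightarrow> bool" where
  "represents d F f \<longleftrightarrow> nondeg d F \<and> (\<forall>v. v \<noteq> 0 \<longrightarrow> f (abs_proj v) = abs_proj (evv F v))"

lemma endo_form_represents:
  assumes "endo_form d G f" "d > 0" shows "represents d (\<chi> i. to_p3 (G $ i)) f"
proof -
  let ?F = "\<chi> i. to_p3 (G $ i)"
  have e: "evv ?F v = (\<chi> i. eval (G $ i) v)" for v by (simp add: vec_eq_iff)
  have nd: "nondeg d ?F"
    using assms unfolding endo_form_def nondeg_def by (auto simp: homogeneous_iff vec_eq_iff)
  have "f (abs_proj v) = abs_proj (evv ?F v)" if v: "v \<noteq> 0" for v
  proof -
    obtain c where c: "c \<noteq> 0" "rep_proj (abs_proj v) = c *s v" using rep_abs_proj v by blast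
    have "f (abs_proj v) = abs_proj (evv ?F (c *s v))"
      using assms(1) unfolding endo_form_def e c(2)[symmetric] by blast
    also have "evv ?F (c *s v) = c ^ d *s evv ?F v" using nd unfolding nondeg_def by (intro evv_hom) blast
    also have "abs_proj \<dots> = abs_proj (evv ?F v)"
    proof -
      have "evv ?F v \<noteq> 0" using nd v by (auto simp only: nondeg_def)
      then have "abs_proj (evv ?F v) = abs_proj (c ^ d *s evv ?F v)"
        using c(1) by (subst abs_proj_eq) (auto intro: exI[of _ "c ^ d"])
      then show ?thesis ..
    qed
    finally show ?thesis .
  qed
  then show ?thesis using nd unfolding represents_def by blast
qed

lemma represents_endo_form:
  assumes "represents d F f" "\<And>i v. eval (G $ i) v = ev (F $ i) v" shows "endo_form d G f"
proof -
  have "to_p3 (G $ i) = F $ i" for i by (rule p3_eqI) (simp add: assms(2))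
  moreover have "(\<chi> i. eval (G $ i) v) = evv F v" for v by (simp add: vec_eq_iff assms(2))
  ultimately show ?thesis
    using assms(1) unfolding endo_form_def represents_def nondeg_def homogeneous_iff
    by (metis assms(2) evv_nth rep_proj_nonzero abs_rep_proj vec_eq_iff zero_index)
qed

definition conj_form :: "complex ^ 3 ^ 3 \<Rightarrow> complex ^ 3 ^ 3 \<Rightarrow> p3 ^ 3 \<Rightarrow> p3 ^ 3" where
  "conj_form M N F = (\<chi> i. cmp (\<Sum>j\<in>UNIV. c3 (M $ i $ j) * F $ j) (mv N))"

lemma evv_conj_form: "evv (conj_form M N F) v = M *v evv F (N *v v)"
  by (simp add: vec_eq_iff conj_form_def evv_mv matrix_vector_mult_def[of M])

lemma represents_in_coords:
  assumes M: "invertible M" "invertible N" "M ** N = mat 1" "N ** M = mat 1" and F: "represents d F f"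
  shows "represents d (conj_form M N F) (in_coords (proj_map M) f)"
proof -
  have F': "\<forall>i. hom d (F $ i)" "\<And>v. evv F v = 0 \<Longrightarrow> v = 0" "d > 0"
    "\<And>v. v \<noteq> 0 \<Longrightarrow> f (abs_proj v) = abs_proj (evv F v)"
    using F by (auto simp: represents_def nondeg_def)
  have "hom d (conj_form M N F $ i)" for i
    unfolding conj_form_def vec_lambda_beta using F'(1) by (intro hom_cmp_mv hom_sum hom_c3_mult) auto
  moreover have nz: "evv (conj_form M N F) v \<noteq> 0" if "v \<noteq> 0" for v
    using that F'(2) invertible_mult_nonzero M unfolding evv_conj_form by blast
  moreover have "in_coords (proj_map M) f (abs_proj v) = abs_proj (evv (conj_form M N F) v)" if "v \<noteq> 0" for v
  proof -
    have "evv F (N *v v) \<noteq> 0" using F'(2) invertible_mult_nonzero[OF M(2) that] by blast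
    then show ?thesis
      using that M unfolding in_coords_def comp_def inv_proj_map[OF M]
      by (simp add: proj_map_abs invertible_mult_nonzero F'(4) evv_conj_form)
  qed
  ultimately show ?thesis using F'(3) unfolding represents_def nondeg_def by blast
qed

section \<open>Curves of a pencil\<close>

definition pair :: "p3 \<Rightarrow> p3 \<Rightarrow> complex ^ 3 \<Rightarrow> complex ^ 2" where
  "pair A B v = vector [ev A v, ev B v]"

definition dot2 :: "complex ^ 2 \<Rightarrow> complex ^ 2 \<Rightarrow> complex" where
  "dot2 c y = c $ 1 * y $ 1 + c $ 2 * y $ 2"

lemma pair_nth [simp]: "pair A B v $ 1 = ev A v" "pair A B v $ 2 = ev B v"
  by (simp_all add: pair_def)

lemma vec2_eq: "u = w \<longleftrightarrow> u $ 1 = w $ 1 \<and> u $ (2::2) = w $ 2"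
  by (simp add: vec_eq_iff forall_2)

lemma pair_hom: "hom k A \<Longrightarrow> hom k B \<Longrightarrow> pair A B (t *s v) = t ^ k *s pair A B v"
  by (simp add: vec2_eq hom_def)

lemma pencil_curve_iff:
  assumes "hom k (to_p3 A)" "hom k (to_p3 B)" "v \<noteq> 0"
  shows "abs_proj v \<in> pencil_curve A B c \<longleftrightarrow> dot2 c (pair (to_p3 A) (to_p3 B) v) = 0"
proof -
  obtain t where t: "t \<noteq> 0" "rep_proj (abs_proj v) = t *s v" using rep_abs_proj assms(3) by blast
  have "abs_proj v \<in> pencil_curve A B c \<longleftrightarrow> dot2 c (pair (to_p3 A) (to_p3 B) (t *s v)) = 0"
    by (simp add: pencil_curve_def zero_set_def pencil_element_def t(2) dot2_def)
  also have "dot2 c (pair (to_p3 A) (to_p3 B) (t *s v)) = t ^ k * dot2 c (pair (to_p3 A) (to_p3 B) v)"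
    unfolding pair_hom[OF assms(1,2)] by (simp add: dot2_def algebra_simps)
  finally show ?thesis using t(1) by simp
qed

lemma pencil_map_abs:
  assumes "hom k (to_p3 A)" "hom k (to_p3 B)" "v \<noteq> 0"
  shows "pencil_map A B (abs_proj v) = (if pair (to_p3 A) (to_p3 B) v = 0 then None
    else Some (abs_proj (pair (to_p3 A) (to_p3 B) v)))"
proof -
  obtain t where t: "t \<noteq> 0" "rep_proj (abs_proj v) = t *s v" using rep_abs_proj assms(3) by blast
  let ?y = "pair (to_p3 A) (to_p3 B)"
  have "pencil_map A B (abs_proj v) = (if ?y (t *s v) = 0 then None else Some (abs_proj (?y (t *s v))))"
    by (simp add: pencil_map_def t(2) Let_def vec2_eq pair_def)
  moreover have "abs_proj (?y v) = abs_proj (t ^ k *s ?y v)" if "?y v \<noteq> 0"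
    using that t(1) by (subst abs_proj_eq) (auto intro: exI[of _ "t ^ k"])
  ultimately show ?thesis using t(1) unfolding pair_hom[OF assms(1,2)] by auto
qed

text \<open>Retains from the invariance only that each member is mapped into a member, stated on the
  cones in the vector space so that no representatives have to be chosen.\<close>

definition pencil_invariant :: "p3 \<Rightarrow> p3 \<Rightarrow> p3 ^ 3 \<Rightarrow> bool" where
  "pencil_invariant A B F \<longleftrightarrow> (\<forall>c. c \<noteq> 0 \<longrightarrow> (\<exists>c'. c' \<noteq> 0 \<and>
    (\<forall>v. dot2 c (pair A B v) = 0 \<longrightarrow> dot2 c' (pair A B (evv F v)) = 0)))"

lemma pencil_invariantD:
  assumes "pencil_invariant A B F"
  shows "\<exists>s t. (s \<noteq> 0 \<or> t \<noteq> 0) \<and>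
      (\<forall>v. ev A v = c * ev B v \<longrightarrow> s * ev (cmp A F) v + t * ev (cmp B F) v = 0)"
proof -
  have "vector [1, - c] \<noteq> (0 :: complex ^ 2)" by (simp add: vec2_eq)
  then obtain c' where c': "c' \<noteq> 0"
    "\<And>v. dot2 (vector [1, - c]) (pair A B v) = 0 \<Longrightarrow> dot2 c' (pair A B (evv F v)) = 0"
    using assms unfolding pencil_invariant_def by blast
  show ?thesis
    by (rule exI[of _ "c' $ 1"], rule exI[of _ "c' $ 2"]) (use c' in \<open>auto simp: dot2_def vec2_eq\<close>)
qed

lemma maps_pencil_invariant:
  assumes h: "hom k (to_p3 A)" "hom k (to_p3 B)" "k > 0" and F: "represents d F f"
    and f: "maps_pencil_to_itself f A B"
  shows "pencil_invariant (to_p3 A) (to_p3 B) F"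
  unfolding pencil_invariant_def
proof (intro allI impI)
  fix c :: "complex ^ 2" assume "c \<noteq> 0"
  then have "f ` pencil_curve A B c \<in> pencil_curves A B"
    using f unfolding maps_pencil_to_itself_def pencil_curves_def by blast
  then obtain c' where c': "c' \<noteq> 0" "f ` pencil_curve A B c = pencil_curve A B c'"
    unfolding pencil_curves_def by blast
  have F': "\<And>v. evv F v = 0 \<Longrightarrow> v = 0" "\<And>v. v \<noteq> 0 \<Longrightarrow> f (abs_proj v) = abs_proj (evv F v)" "nondeg d F"
    using F by (auto simp: represents_def nondeg_def)
  have "dot2 c' (pair (to_p3 A) (to_p3 B) (evv F v)) = 0" if v: "dot2 c (pair (to_p3 A) (to_p3 B) v) = 0" for v
  proof (cases "v = 0")
    case True
    have "ev (cmp p F) 0 = 0" if "hom k p" for p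
      using hom_at_0[OF hom_cmp[OF that], of d F] F'(3) h(3) by (simp add: nondeg_def)
    from this[OF h(1)] this[OF h(2)] show ?thesis using True by (simp add: dot2_def)
  next
    case False
    then have "abs_proj v \<in> pencil_curve A B c" using pencil_curve_iff[OF h(1,2)] v by blast
    then have "f (abs_proj v) \<in> pencil_curve A B c'" using c'(2) by blast
    then show ?thesis using pencil_curve_iff[OF h(1,2)] F'(1,2) False by metis
  qed
  then show "\<exists>c'. c' \<noteq> 0 \<and> (\<forall>v. dot2 c (pair (to_p3 A) (to_p3 B) v) = 0 \<longrightarrow>
      dot2 c' (pair (to_p3 A) (to_p3 B) (evv F v)) = 0)" using c'(1) by blast
qed

lemma reducible_not_irreducible_set:
  assumes h: "hom k (to_p3 A)" "hom k (to_p3 B)" and r: "reducible (to_p3 A - c3 c * to_p3 B)"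
  shows "\<not> irreducible_set (pencil_curve A B (vector [1, - c]))"
proof
  assume irr: "irreducible_set (pencil_curve A B (vector [1, - c]))"
  obtain P Q n m v w where r: "hom n P" "hom m Q" "to_p3 A - c3 c * to_p3 B = P * Q" "v \<noteq> 0" "w \<noteq> 0"
    "ev P v = 0" "ev Q v \<noteq> 0" "ev P w \<noteq> 0" "ev Q w = 0" using r unfolding reducible_def by blast
  define Z where "Z R = zero_set {of_p3 R}" for R
  have zc: "zariski_closed (Z R)" if "hom j R" for j R
    unfolding zariski_closed_def Z_def using that homogeneous_iff to_p3_simps(5) by (intro exI[of _ "{of_p3 R}"]) auto
  have Zi: "abs_proj u \<in> Z R \<longleftrightarrow> ev R u = 0" if R: "hom j R" "u \<noteq> 0" for j R u
  proof -
    obtain t where t: "t \<noteq> 0" "rep_proj (abs_proj u) = t *s u" using rep_abs_proj R(2) by blast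
    have "abs_proj u \<in> Z R \<longleftrightarrow> ev R (t *s u) = 0" by (simp add: Z_def zero_set_def t(2))
    then show ?thesis using R(1) t(1) by (simp add: hom_def)
  qed
  have "pencil_curve A B (vector [1, - c]) = Z P \<union> Z Q"
  proof (rule set_eqI)
    fix p :: "3 proj"
    obtain u where u: "u \<noteq> 0" "p = abs_proj u" by (rule abs_proj_cases)
    have "p \<in> pencil_curve A B (vector [1, - c]) \<longleftrightarrow> ev (to_p3 A - c3 c * to_p3 B) u = 0"
      unfolding u(2) pencil_curve_iff[OF h u(1)] by (simp add: dot2_def)
    then show "p \<in> pencil_curve A B (vector [1, - c]) \<longleftrightarrow> p \<in> Z P \<union> Z Q"
      unfolding r(3) u(2) using Zi[OF r(1) u(1)] Zi[OF r(2) u(1)] by simp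
  qed
  then have "Z P \<union> Z Q = Z P \<or> Z P \<union> Z Q = Z Q"
    using irr zc[OF r(1)] zc[OF r(2)] unfolding irreducible_set_def by metis
  moreover have "abs_proj v \<in> Z P - Z Q" "abs_proj w \<in> Z Q - Z P"
    using Zi[OF r(1)] Zi[OF r(2)] r by auto
  ultimately show False by blast
qed

text \<open>The members \<open>A - c B\<close> have the pairwise distinct parameters
  \<open>[1 : - c]\<close>, so finitely many exceptional points allow only finitely many
  \<open>c\<close>.\<close>

lemma irreducible_pencil_finite_reducible:
  assumes h: "hom k (to_p3 A)" "hom k (to_p3 B)" and irr: "irreducible_pencil A B"
  shows "finite {c. reducible (to_p3 A - c3 c * to_p3 B)}"
proof -
  define g :: "complex \<Rightarrow> 2 proj" where "g c = abs_proj (vector [1, - c])" for c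
  have nz: "vector [1, - c] \<noteq> (0 :: complex ^ 2)" for c by (simp add: vec2_eq)
  have "g ` {c. reducible (to_p3 A - c3 c * to_p3 B)} \<subseteq>
      {abs_proj c | c. c \<noteq> 0 \<and> \<not> irreducible_set (pencil_curve A B c)}"
    unfolding g_def using reducible_not_irreducible_set[OF h] nz by blast
  then have "finite (g ` {c. reducible (to_p3 A - c3 c * to_p3 B)})"
    using irr finite_subset unfolding irreducible_pencil_def by blast
  moreover have "inj g"
  proof (rule injI)
    fix x y assume "g x = g y"
    then obtain c where "vector [1, - y] = c *s (vector [1, - x] :: complex ^ 2)"
      unfolding g_def abs_proj_eq[OF nz nz] by blast
    then show "x = y" by (simp add: vec2_eq)
  qed
  ultimately show ?thesis using finite_imageD inj_on_subset by blast
qed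

text \<open>Equality of the rational maps fixes the pair of values up to a scalar depending on the
  point, which suffices for vanishing; base points correspond, as there both maps are
  \<open>None\<close>. Parameters of members transform by the transpose of
  \<open>\<Psi>\<close>.\<close>

lemma coords_curves:
  assumes h: "hom k (to_p3 A)" "hom k (to_p3 B)" "hom k' (to_p3 A')" "hom k' (to_p3 B')" "k > 0" "k' > 0"
    and M: "invertible M" "invertible N" "M ** N = mat 1" "N ** M = mat 1" and \<Psi>: "invertible \<Psi>"
    and map: "map_in_coords (proj_map M) (proj_map \<Psi>) (pencil_map A B) = pencil_map A' B'"
  shows "dot2 c (pair (to_p3 A') (to_p3 B') v) = 0 \<longleftrightarrow>
    dot2 (c v* \<Psi>) (pair (to_p3 A) (to_p3 B) (N *v v)) = 0"
proof (cases "v = 0")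
  case True
  then show ?thesis
    using hom_at_0[OF h(1,5)] hom_at_0[OF h(2,5)] hom_at_0[OF h(3,6)] hom_at_0[OF h(4,6)]
    by (simp add: dot2_def)
next
  case False
  let ?x = "pair (to_p3 A') (to_p3 B') v" and ?y = "pair (to_p3 A) (to_p3 B) (N *v v)"
  have Nv: "N *v v \<noteq> 0" using invertible_mult_nonzero M(2) False by blast
  have d: "dot2 (c v* \<Psi>) y = dot2 c (\<Psi> *v y)" for y
    by (simp add: dot2_def vector_matrix_mult_def matrix_vector_mult_def sum_2 algebra_simps)
  have e: "(if ?x = 0 then None else Some (abs_proj ?x)) =
      map_option (proj_map \<Psi>) (if ?y = 0 then None else Some (abs_proj ?y))"
    using fun_cong[OF map, of "abs_proj v"] False Nv M
    by (simp add: map_in_coords_def inv_proj_map[OF M] proj_map_abs pencil_map_abs[OF h(1,2) Nv]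
        pencil_map_abs[OF h(3,4) False])
  show ?thesis
  proof (cases "?y = 0")
    case True
    then have x: "?x = 0" using e by (auto split: if_splits)
    show ?thesis unfolding True x by (simp add: dot2_def)
  next
    case y: False
    then have x: "?x \<noteq> 0" and "abs_proj ?x = abs_proj (\<Psi> *v ?y)"
      using e \<Psi> by (auto simp: proj_map_abs split: if_splits)
    then obtain t where t: "t \<noteq> 0" "\<Psi> *v ?y = t *s ?x"
      using abs_proj_eq[OF x invertible_mult_nonzero[OF \<Psi> y]] by blast
    have "dot2 c (t *s x) = t * dot2 c x" for x by (simp add: dot2_def algebra_simps)
    then show ?thesis unfolding d t(2) using t(1) by (simp only: mult_eq_0_iff) simp
  qed
qed

lemma invertible_vector_mult_nonzero: "invertible M \<Longrightarrow> c \<noteq> 0 \<Longrightarrow> c v* M \<noteq> (0 :: complex ^ 'n)"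
proof
  assume M: "invertible M" "c \<noteq> 0" "c v* M = 0"
  obtain N where "M ** N = mat 1" using M(1) by (auto simp: invertible_def)
  then have "c = (c v* M) v* N" by (simp add: vector_matrix_mul_assoc)
  also have "\<dots> = 0" unfolding M(3) by (simp add: vec_eq_iff vector_matrix_mult_def)
  finally show False using M(2) by simp
qed

lemma pencil_invariant_coords:
  assumes curves: "\<And>c v. dot2 c (pair A' B' v) = 0 \<longleftrightarrow> dot2 (c v* \<Psi>) (pair A B (N *v v)) = 0"
    and M: "N ** M = mat 1" and \<Psi>: "invertible \<Psi>" and F: "pencil_invariant A B F"
  shows "pencil_invariant A' B' (conj_form M N F)"
  unfolding pencil_invariant_def
proof (intro allI impI)
  fix c :: "complex ^ 2" assume "c \<noteq> 0"
  then have "c v* \<Psi> \<noteq> 0" using invertible_vector_mult_nonzero \<Psi> by blast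
  then obtain c' where c': "c' \<noteq> 0"
    "\<And>v. dot2 (c v* \<Psi>) (pair A B v) = 0 \<Longrightarrow> dot2 c' (pair A B (evv F v)) = 0"
    using F unfolding pencil_invariant_def by blast
  obtain \<Theta> where \<Theta>: "invertible \<Theta>" "\<Theta> ** \<Psi> = mat 1" using \<Psi> by (metis invertibleE)
  have c'': "(c' v* \<Theta>) v* \<Psi> = c'" by (simp add: vector_matrix_mul_assoc \<Theta>(2))
  have "dot2 (c' v* \<Theta>) (pair A' B' (evv (conj_form M N F) v)) = 0" if "dot2 c (pair A' B' v) = 0" for v
    unfolding curves c'' evv_conj_form using c'(2) that[unfolded curves] by (simp add: matrix_vector_mul_assoc M)
  then show "\<exists>c'. c' \<noteq> 0 \<and> (\<forall>v. dot2 c (pair A' B' v) = 0 \<longrightarrow> dot2 c' (pair A' B' (evv (conj_form M N F) v)) = 0)"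
    using invertible_vector_mult_nonzero[OF \<Theta>(1) c'(1)] by blast
qed

section \<open>Pencils of lines\<close>

lemma coprime_X: assumes "i \<noteq> j" shows "coprime (X i) (X j)"
proof (rule ccontr)
  assume "\<not> coprime (X i) (X j)"
  then obtain D where D: "D dvd X i" "D dvd X j" "\<not> is_unit D" using not_coprimeE by blast
  have "nondeg 1 XX" by (auto simp: nondeg_def vec_eq_iff)
  moreover have "cmp (lf (axis k 1)) XX = X k" for k
    using exhaust_3[of k] by (auto simp: lf_def sum_3 axis_def)
  moreover have "crs (axis i 1) (axis j (1::complex)) \<noteq> 0"
    using assms exhaust_3[of i] exhaust_3[of j] by (auto simp: vec3_eq axis_def)
  ultimately show False using nondeg_no_common_divisor D by metis
qed

text \<open>One component of the relation in \<open>omega_parallel\<close> says that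
  \<open>pd 3\<close> annihilates the ratio of \<open>F $ 1\<close> and \<open>F $ 2\<close>. These
  are coprime and their derivatives have smaller degree, so the derivatives vanish.\<close>

lemma lines_through_point_invariant:
  assumes F: "nondeg d F" and inv: "pencil_invariant (X 1) (X 2) F" and i: "i = 1 \<or> i = 2"
    and e: "e \<in> supp (F $ i)"
  shows "expo e 3 = 0"
proof -
  have F': "d > 0" "\<forall>i. hom d (F $ i)" using F by (auto simp: nondeg_def)
  have X2: "X 2 \<noteq> 0" by (simp add: X_def)
  have "crs (omega (X 1) (X 2)) (omega (cmp (X 1) F) (cmp (X 2) F)) = 0"
    by (rule omega_parallel[OF pencil_invariantD[OF inv] X2])
  then have "(crs (omega (X 1) (X 2)) (omega (F $ 1) (F $ 2))) $ 2 = 0" by simp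
  then have "X 2 * (F $ 1 * pd 3 (F $ 2) - F $ 2 * pd 3 (F $ 1)) = 0" by (simp add: algebra_simps)
  then have eq: "F $ 1 * pd 3 (F $ 2) = F $ 2 * pd 3 (F $ 1)" using X2 by simp
  have "coprime (F $ 1) (F $ 2)"
    using coprime_cmp[OF F coprime_X[of 1 2] hom_X(1) hom_X(1)] by simp
  then have "pd 3 (F $ 1) = 0 \<and> pd 3 (F $ 2) = 0"
    using hom_dvd_derivation_zero[OF _ _ _ F'(1) eq] hom_pd F'(2) by blast
  then have "pd 3 (F $ i) = 0" using i by auto
  then show ?thesis using cf_weight[of "axis 3 1" "F $ i" 0 e] e by (simp add: sum_3 axis_def)
qed

lemma map_in_coordsI:
  assumes h: "hom k (to_p3 A)" "hom k (to_p3 B)" "hom k' (to_p3 A')" "hom k' (to_p3 B')"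
    and M: "invertible M" "invertible N" "M ** N = mat 1" "N ** M = mat 1" and \<Psi>: "invertible \<Psi>"
    and eq: "\<And>v. \<Psi> *v pair (to_p3 A) (to_p3 B) (N *v v) = pair (to_p3 A') (to_p3 B') v"
  shows "map_in_coords (proj_map M) (proj_map \<Psi>) (pencil_map A B) = pencil_map A' B'"
proof
  fix p :: "3 proj"
  obtain v where v: "v \<noteq> 0" "p = abs_proj v" by (rule abs_proj_cases)
  have Nv: "N *v v \<noteq> 0" using invertible_mult_nonzero M(2) v(1) by blast
  let ?y = "pair (to_p3 A) (to_p3 B) (N *v v)"
  have "map_in_coords (proj_map M) (proj_map \<Psi>) (pencil_map A B) p =
      map_option (proj_map \<Psi>) (if ?y = 0 then None else Some (abs_proj ?y))"
    using v Nv M by (simp add: map_in_coords_def inv_proj_map[OF M] proj_map_abs pencil_map_abs[OF h(1,2) Nv])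
  also have "\<dots> = (if \<Psi> *v ?y = 0 then None else Some (abs_proj (\<Psi> *v ?y)))"
    using \<Psi> invertible_mult_nonzero[OF \<Psi>] by (auto simp: proj_map_abs)
  also have "\<dots> = pencil_map A' B' p" unfolding eq v(2) pencil_map_abs[OF h(3,4) v(1)] ..
  finally show "map_in_coords (proj_map M) (proj_map \<Psi>) (pencil_map A B) p = pencil_map A' B' p" .
qed

lemma PGL_cases:
  fixes \<phi> :: "'n::finite proj \<Rightarrow> 'n proj"
  assumes "\<phi> \<in> PGL"
  obtains M N where "\<phi> = proj_map M" "invertible M" "invertible N" "M ** N = mat 1" "N ** M = mat 1"
proof -
  obtain M where M: "\<phi> = proj_map M" "invertible M" using assms unfolding PGL_def by blast
  obtain N where "invertible N" "M ** N = mat 1" "N ** M = mat 1" using M(2) by (rule invertibleE)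
  then show thesis using that M by blast
qed

lemma independent_linear_forms:
  assumes "\<And>s t. c3 s * lf \<alpha> + c3 t * lf \<beta> = 0 \<Longrightarrow> s = 0 \<and> t = 0" shows "crs \<alpha> \<beta> \<noteq> 0"
proof
  assume z: "crs \<alpha> \<beta> = 0"
  have "\<alpha> \<noteq> 0" using assms[of 1 0] by (auto simp: lf_def)
  then obtain c where "\<beta> = c *s \<alpha>" using crs_zero_parallel z by blast
  then have "c3 c * lf \<alpha> + c3 (- 1) * lf \<beta> = 0" by (intro p3_eqI) (simp add: dot_def sum_3 algebra_simps)
  then show False using assms by force
qed

context
  fixes A B :: "3 mpoly" and k :: nat
  assumes pencil: "pencil k A B"
begin

lemma pencil_hom: "hom k (to_p3 A)" "hom k (to_p3 B)" "k > 0" "coprime (to_p3 A) (to_p3 B)"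
  using pencil no_common_factor_coprime unfolding pencil_def homogeneous_iff by auto

lemma pencil_independent: assumes "c3 s * to_p3 A + c3 t * to_p3 B = 0" shows "s = 0 \<and> t = 0"
proof -
  have "pencil_element A B (vector [s, t]) = 0"
    by (rule mpoly_eqI) (use assms in \<open>auto simp: pencil_element_def dest: arg_cong[where f = "\<lambda>q. ev q _"]\<close>)
  then have "vector [s, t] = (0 :: complex ^ 2)" using pencil unfolding pencil_def by blast
  then show ?thesis by (simp add: vec2_eq)
qed

lemma elementary_pencilI:
  assumes k: "k = 1"
  shows "elementary_pencil k A B \<and> (\<exists>\<phi> \<psi>. elementary_coords A B \<phi> \<psi>)"
proof -
  obtain \<alpha> \<beta> where ab: "to_p3 A = lf \<alpha>" "to_p3 B = lf \<beta>"
    using hom_1_lf pencil_hom(1,2) unfolding k by blast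
  have c0: "crs \<alpha> \<beta> \<noteq> 0" using independent_linear_forms pencil_independent unfolding ab by blast
  define n where "n = crs \<alpha> \<beta>"
  define g where "g = (\<chi> i. cnj (n $ i))"
  have ng: "dot n g \<noteq> 0"
  proof
    assume "dot n g = 0"
    then have "dot g n = 0" by (simp add: dot_def mult.commute)
    then show False using dot_evv_zero[of \<alpha> n \<beta>] c0 by (auto simp: n_def g_def dot_crs)
  qed
  have evA: "eval A v = dot \<alpha> v" "eval B v = dot \<beta> v" for v
    using ab by (metis ev_to_p3 ev_lf)+
  have z: "abs_proj n \<in> zero_set {L} \<longleftrightarrow> dot \<gamma> n = 0" if L: "to_p3 L = lf \<gamma>" for L \<gamma>
  proof -
    obtain t where t: "t \<noteq> 0" "rep_proj (abs_proj n) = t *s n" using rep_abs_proj c0 n_def by blast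
    have "eval L v = dot \<gamma> v" for v using L by (metis ev_to_p3 ev_lf)
    moreover have "dot \<gamma> (t *s n) = t * dot \<gamma> n" by (simp add: dot_def sum_3 algebra_simps)
    ultimately show ?thesis using t(1) by (simp add: zero_set_def t(2))
  qed
  have "pencil_curves A B = lines_through (abs_proj n)"
  proof
    show "pencil_curves A B \<subseteq> lines_through (abs_proj n)"
    proof
      fix C assume "C \<in> pencil_curves A B"
      then obtain c where c: "c \<noteq> 0" "C = zero_set {pencil_element A B c}"
        by (auto simp: pencil_curves_def pencil_curve_def)
      define \<gamma> where "\<gamma> = (c $ 1) *s \<alpha> + (c $ 2) *s \<beta>"
      have L: "to_p3 (pencil_element A B c) = lf \<gamma>"
        by (rule p3_eqI) (simp add: pencil_element_def evA \<gamma>_def dot_def sum_3 algebra_simps)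
      have "dot \<gamma> n = 0" by (simp add: \<gamma>_def n_def dot_def sum_3 algebra_simps)
      moreover have "homogeneous 1 (pencil_element A B c)" unfolding homogeneous_iff L by simp
      moreover have "pencil_element A B c \<noteq> 0" using pencil c(1) unfolding pencil_def by blast
      ultimately show "C \<in> lines_through (abs_proj n)"
        unfolding lines_through_def using z[OF L] c(2) by blast
    qed
    show "lines_through (abs_proj n) \<subseteq> pencil_curves A B"
    proof
      fix C assume "C \<in> lines_through (abs_proj n)"
      then obtain L where L: "homogeneous 1 L" "L \<noteq> 0" "abs_proj n \<in> zero_set {L}" "C = zero_set {L}"
        by (auto simp: lines_through_def)
      obtain \<gamma> where \<gamma>: "to_p3 L = lf \<gamma>" using hom_1_lf L(1) unfolding homogeneous_iff by blast
      have 0: "dot \<gamma> n = 0" using z[OF \<gamma>] L(3) by blast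
      \<comment> \<open>Cramer's rule for \<open>\<gamma>\<close> in the basis
        \<open>\<alpha>\<close>, \<open>\<beta>\<close>, \<open>g\<close>; the component along
        \<open>g\<close> vanishes because the line passes through \<open>n\<close>.\<close>
      define c :: "complex ^ 2" where "c = vector [dot \<gamma> (crs \<beta> g) / dot n g, dot \<gamma> (crs g \<alpha>) / dot n g]"
      have "dot n g *s \<gamma> = dot \<gamma> (crs \<beta> g) *s \<alpha> + dot \<gamma> (crs g \<alpha>) *s \<beta> + dot \<gamma> n *s g"
        unfolding n_def by (simp add: vec3_eq dot_def sum_3 algebra_simps)
      then have "dot n g * dot \<gamma> v = dot n g * (c $ 1 * dot \<alpha> v + c $ 2 * dot \<beta> v)" for v
      proof -
        assume *: "dot n g *s \<gamma> = dot \<gamma> (crs \<beta> g) *s \<alpha> + dot \<gamma> (crs g \<alpha>) *s \<beta> + dot \<gamma> n *s g"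
        have "dot n g * dot \<gamma> v = dot (dot n g *s \<gamma>) v" by (simp add: dot_def sum_3 algebra_simps)
        also have "\<dots> = dot \<gamma> (crs \<beta> g) * dot \<alpha> v + dot \<gamma> (crs g \<alpha>) * dot \<beta> v"
          unfolding * 0 by (simp add: dot_def[of _ v] sum_3 algebra_simps)
        also have "\<dots> = dot n g * (c $ 1 * dot \<alpha> v + c $ 2 * dot \<beta> v)"
          using ng by (simp add: c_def field_simps)
        finally show ?thesis .
      qed
      then have "dot \<gamma> v = c $ 1 * dot \<alpha> v + c $ 2 * dot \<beta> v" for v using ng by simp
      moreover have "eval L v = dot \<gamma> v" for v using \<gamma> by (metis ev_to_p3 ev_lf)
      ultimately have LL: "L = pencil_element A B c"
        by (intro mpoly_eqI) (simp add: pencil_element_def evA)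
      then have "c \<noteq> 0" using L(2) by (auto simp: pencil_element_def Const_def)
      then show "C \<in> pencil_curves A B" using L(4) LL by (auto simp: pencil_curves_def pencil_curve_def)
    qed
  qed
  moreover have "\<exists>\<phi> \<psi>. elementary_coords A B \<phi> \<psi>"
  proof -
    define M :: "complex ^ 3 ^ 3" where "M = vector [\<alpha>, \<beta>, g]"
    have M: "(M *v v) $ 1 = dot \<alpha> v" "(M *v v) $ 2 = dot \<beta> v" "(M *v v) $ 3 = dot g v" for v
      by (simp_all add: M_def matrix_vector_mult_def dot_def)
    have iM: "invertible M"
    proof (rule invertibleI_inj)
      fix v assume "M *v v = 0"
      then have "dot \<alpha> v = 0" "dot \<beta> v = 0" "dot g v = 0" using M by (metis zero_index)+
      then show "v = 0" using dot_evv_zero[OF _ _ _ c0] by (simp add: g_def n_def)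
    qed
    then obtain N where N: "invertible N" "M ** N = mat 1" "N ** M = mat 1" by (rule invertibleE)
    have id: "invertible (mat 1 :: complex ^ 2 ^ 2)" by (simp add: invertible_def)
    have h: "hom 1 (to_p3 (Var i))" for i by (simp add: to_p3_simps)
    have "mat 1 *v pair (to_p3 A) (to_p3 B) (N *v v) = pair (to_p3 (Var 1)) (to_p3 (Var 2)) v" for v
      using M[of "N *v v"] N(2) by (simp add: vec2_eq evA matrix_vector_mul_assoc)
    from map_in_coordsI[OF pencil_hom(1,2) h h iM N id this]
    have "elementary_coords A B (proj_map M) (proj_map (mat 1))"
      unfolding elementary_coords_def PGL_def using iM id by blast
    then show ?thesis by blast
  qed
  ultimately show ?thesis unfolding elementary_pencil_def k by blast
qed

lemma elementary_coords_form:
  assumes d: "d > 0" and F: "represents d F f" and inv: "pencil_invariant (to_p3 A) (to_p3 B) F"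
    and co: "elementary_coords A B \<phi> \<psi>"
  shows "\<exists>P Q R. homogeneous d P \<and> homogeneous d Q \<and> homogeneous d R \<and>
    vars P \<subseteq> {1, 2} \<and> vars Q \<subseteq> {1, 2} \<and> endo_form d (vector [P, Q, R]) (in_coords \<phi> f)"
proof -
  obtain M N where M: "\<phi> = proj_map M" "invertible M" "invertible N" "M ** N = mat 1" "N ** M = mat 1"
    using PGL_cases co unfolding elementary_coords_def by blast
  obtain \<Psi> \<Theta> where \<Psi>: "\<psi> = proj_map \<Psi>" "invertible \<Psi>" "\<Psi> ** \<Theta> = mat 1" "\<Theta> ** \<Psi> = mat 1"
    using PGL_cases co unfolding elementary_coords_def by blast
  have map: "map_in_coords (proj_map M) (proj_map \<Psi>) (pencil_map A B) = pencil_map (Var 1) (Var 2)"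
    using co unfolding elementary_coords_def M(1) \<Psi>(1) by blast
  have h: "hom 1 (to_p3 (Var i))" for i by (simp add: to_p3_simps)
  define G where "G = conj_form M N F"
  have G: "represents d G (in_coords \<phi> f)"
    unfolding G_def M(1) by (rule represents_in_coords[OF M(2-5) F])
  have "pencil_invariant (to_p3 (Var 1)) (to_p3 (Var 2)) G"
    unfolding G_def
    by (rule pencil_invariant_coords[OF coords_curves[OF pencil_hom(1,2) h h pencil_hom(3) zero_less_one M(2-5) \<Psi>(2) map] M(5) \<Psi>(2) inv])
  then have "pencil_invariant (X 1) (X 2) G" by (simp add: to_p3_simps)
  then have "expo e 3 = 0" if "e \<in> supp (G $ i)" "i = 1 \<or> i = 2" for e i
    using lines_through_point_invariant G that unfolding represents_def by blast
  then have "vars (of_p3 (G $ 1)) \<subseteq> {1, 2}" "vars (of_p3 (G $ 2)) \<subseteq> {1, 2}"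
    by (auto intro!: vars_of_p3)
  moreover have "homogeneous d (of_p3 (G $ i))" for i
    using G unfolding homogeneous_iff represents_def nondeg_def by (simp add: to_p3_simps)
  moreover have "endo_form d (vector [of_p3 (G $ 1), of_p3 (G $ 2), of_p3 (G $ 3)]) (in_coords \<phi> f)"
  proof (rule represents_endo_form[OF G])
    fix i v show "eval (vector [of_p3 (G $ 1), of_p3 (G $ 2), of_p3 (G $ 3)] $ i) v = ev (G $ i) v"
      using exhaust_3[of i] by auto
  qed
  ultimately show ?thesis by blast
qed

end

section \<open>Normal form in binomial coordinates\<close>

text \<open>An affine map of the line permuting three points fixes the middle one.\<close>

lemma affine_permutation:
  fixes p q r s :: real
  assumes "p > 0" "q > 0" "r \<noteq> 0"
    and 1: "r * p + s = p \<or> r * p + s = - q \<or> r * p + s = 0"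
    and 2: "- (r * q) + s = p \<or> - (r * q) + s = - q \<or> - (r * q) + s = 0"
    and 3: "s = p \<or> s = - q \<or> s = 0"
  shows "s = 0 \<and> (r = 1 \<or> r = - 1 \<and> p = q)"
proof -
  have sg: "r * p > 0 \<and> r * q > 0 \<or> r * p < 0 \<and> r * q < 0"
    using assms(1-3) by (metis linorder_neqE_linordered_idom mult_neg_pos mult_pos_pos)
  have s: "s = 0"
    using sg 1 2 3 assms(1,2) by (elim disjE) linarith+
  have "r * p = p \<or> r * p = - q \<and> r * q = - p"
    using sg 1 2 assms(1,2) unfolding s by (elim disjE) linarith+
  then show ?thesis
  proof
    assume "r * p = p" then show ?thesis using s assms(1) by simp
  next
    assume *: "r * p = - q \<and> r * q = - p"
    then have "(r + 1) * (p + q) = 0" by (simp add: algebra_simps)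
    then have r: "r = - 1" using assms(1,2) by simp
    have "p = q" using * unfolding r by linarith
    then show ?thesis using s r by blast
  qed
qed

text \<open>The images of the weights \<open>0\<close> and \<open>p\<close> are real, which makes
  \<open>h\<close> and then \<open>a\<close> real.\<close>

lemma affine_permutation_complex:
  fixes a h :: complex and p q :: nat and w :: "3 \<Rightarrow> complex"
  assumes pq: "p > 0" "q > 0" "a \<noteq> 0" and w: "w 1 = of_nat p" "w 2 = - of_nat q" "w 3 = 0"
    and perm: "\<And>i. \<exists>j. a * w i + h = w j"
  shows "h = 0 \<and> (a = 1 \<or> a = - 1 \<and> p = q)"
proof -
  have x: "a * w i + h = of_nat p \<or> a * w i + h = - of_nat q \<or> a * w i + h = 0" for i
    using perm[of i] w by (metis exhaust_3)
  have imh: "Im h = 0" using x[of 3] w(3) by auto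
  have "Im (a * of_nat p + h) = 0"
    using x[of 1] unfolding w(1) by (elim disjE) (drule arg_cong[where f = Im], simp)+
  then have ima: "Im a = 0" using imh pq(1) by simp
  have "Re a \<noteq> 0" using ima pq(3) by (simp add: complex_eq_iff)
  moreover have "Re a * p + Re h = p \<or> Re a * p + Re h = - real q \<or> Re a * p + Re h = 0"
    using x[of 1] by (auto simp: w complex_eq_iff)
  moreover have "- (Re a * q) + Re h = p \<or> - (Re a * q) + Re h = - real q \<or> - (Re a * q) + Re h = 0"
    using x[of 2] by (auto simp: w complex_eq_iff)
  moreover have "Re h = p \<or> Re h = - real q \<or> Re h = 0"
    using x[of 3] by (auto simp: w complex_eq_iff)
  ultimately have "Re h = 0 \<and> (Re a = 1 \<or> Re a = - 1 \<and> real p = real q)"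
    using affine_permutation[of "real p" "real q" "Re a" "Re h"] pq by simp
  then show ?thesis using ima imh by (auto simp: complex_eq_iff)
qed

lemma cop3_products: "cop3 (vector [c3 a * (X 2 * X 3), c3 b * (X 1 * X 3), c3 c * (X 1 * X 2)])"
  if "a \<noteq> 0" "b \<noteq> 0" "c \<noteq> 0"
  unfolding cop3_def
proof (intro allI impI)
  fix D assume D: "\<forall>i. D dvd vector [c3 a * (X 2 * X 3), c3 b * (X 1 * X 3), c3 c * (X 1 * X 2)] $ (i::3)"
  have u: "is_unit (c3 x)" if "x \<noteq> 0" for x
    using that by (auto intro!: dvdI[of _ _ "c3 (inverse x)"] simp: c3_hom[symmetric])
  have m: "D dvd q" if "D dvd c3 x * q" "x \<noteq> 0" for x q
    using that dvd_mult_unit_iff'[OF u[OF that(2)]] by blast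
  have "D dvd c3 a * (X 2 * X 3)" "D dvd c3 b * (X 1 * X 3)" "D dvd c3 c * (X 1 * X 2)"
    using D[THEN spec, of 1] D[THEN spec, of 2] D[THEN spec, of 3] by (simp_all only: vector_3)
  from m[OF this(1) \<open>a \<noteq> 0\<close>] m[OF this(2) \<open>b \<noteq> 0\<close>] m[OF this(3) \<open>c \<noteq> 0\<close>]
  have 1: "D dvd X 2 * X 3" "D dvd X 1 * X 3" "D dvd X 1 * X 2" .
  have "D dvd gcd (X 3 * X 2) (X 3 * X 1)" using 1(1,2) by (simp add: mult.commute)
  then have "D dvd X 3 * gcd (X 2) (X 1)" by (simp add: gcd_mult_left)
  then have "D dvd X 3" using coprime_X[of 2 1] by simp
  moreover have "coprime (X 3) (X 1 * X 2)" using coprime_X[of 3 1] coprime_X[of 3 2] by simp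
  ultimately show "is_unit D" using 1(3) coprime_common_divisor by blast
qed

lemma single_supp: assumes "supp p \<subseteq> {e}" shows "p = mono3 (cf p e) e"
proof (rule cf_eqI)
  fix e' show "cf p e' = cf (mono3 (cf p e) e) e'"
    using assms by (auto simp: cf_mono3 supp_def)
qed

lemma axis_supp:
  assumes "hom d p" "ev p (axis i 1) \<noteq> 0" shows "\<exists>e\<in>supp p. \<forall>j. expo e j = (if j = i then d else 0)"
proof -
  have "(\<Sum>e\<in>supp p. ev (mono3 (cf p e) e) (axis i 1)) \<noteq> 0"
    using assms(2) monomial_expansion[of p] by (metis ev_sum)
  then obtain e where e: "e \<in> supp p" "ev (mono3 (cf p e) e) (axis i 1) \<noteq> 0" by (meson sum.not_neutral_contains_not_neutral)
  have z: "expo e j = 0" if "j \<noteq> i" for j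
  proof (rule ccontr)
    assume "expo e j \<noteq> 0"
    then have "(\<Prod>m\<in>UNIV. (axis i 1 $ m :: complex) ^ expo e m) = 0"
      using that by (intro prod_zero) (auto simp: axis_def)
    then show False using e(2) by (simp add: ev_mono3)
  qed
  have "(\<Sum>j\<in>UNIV. expo e j) = d" using hom_supp[OF assms(1) e(1)] .
  moreover have "(\<Sum>j\<in>UNIV. expo e j) = (\<Sum>j\<in>{i}. expo e j)"
    using z by (intro sum.mono_neutral_right) auto
  ultimately show ?thesis using z e(1) by (intro bexI[of _ e]) auto
qed

text \<open>Zero is not a root, so each root \<open>r\<close> contributes a factor
  \<open>1 - t / r\<close>, that is, the nonzero constant \<open>- 1 / r\<close>.\<close>

lemma factor_at_zero:
  "poly \<rho> 0 \<noteq> 0 \<Longrightarrow> \<exists>c. (\<forall>i\<in>{1..degree \<rho>}. c i \<noteq> 0) \<and>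
    (\<forall>t. poly \<rho> t = poly \<rho> 0 * (\<Prod>i=1..degree \<rho>. 1 + c i * (t :: complex)))"
proof (induction "degree \<rho>" arbitrary: \<rho>)
  case 0
  then obtain a where "\<rho> = [:a:]" by (metis degree_eq_zeroE)
  then show ?case by simp
next
  case (Suc n)
  then have "\<not> constant (poly \<rho>)" using constant_degree[of \<rho>] by auto
  then obtain r where "poly \<rho> r = 0" using fundamental_theorem_of_algebra by blast
  then obtain \<sigma> where \<sigma>: "\<rho> = [:- r, 1:] * \<sigma>" by (metis dvdE poly_eq_0_iff_dvd)
  have r0: "r \<noteq> 0" "poly \<sigma> 0 \<noteq> 0" using Suc.prems unfolding \<sigma> by auto
  then have "\<sigma> \<noteq> 0" by auto
  then have n: "n = degree \<sigma>" using Suc(2) unfolding \<sigma> by (simp add: degree_mult_eq del: mult_pCons_left)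
  obtain c where c: "\<forall>i\<in>{1..degree \<sigma>}. c i \<noteq> 0"
    "\<And>t. poly \<sigma> t = poly \<sigma> 0 * (\<Prod>i=1..degree \<sigma>. 1 + c i * t)"
    using Suc.hyps(1)[OF n r0(2)] by blast
  define c' where "c' = c(Suc n := - inverse r)"
  have "\<forall>i\<in>{1..degree \<rho>}. c' i \<noteq> 0" using c(1) r0 Suc(2) n by (auto simp: c'_def)
  moreover have "poly \<rho> t = poly \<rho> 0 * (\<Prod>i=1..degree \<rho>. 1 + c' i * t)" for t
  proof -
    have "(\<Prod>i=1..degree \<rho>. 1 + c' i * t) = (\<Prod>i=1..n. 1 + c' i * t) * (1 - inverse r * t)"
      unfolding Suc(2)[symmetric] by (simp add: c'_def)
    also have "(\<Prod>i=1..n. 1 + c' i * t) = (\<Prod>i=1..n. 1 + c i * t)"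
      by (intro prod.cong) (auto simp: c'_def)
    finally have "poly \<rho> 0 * (\<Prod>i=1..degree \<rho>. 1 + c' i * t) =
        - r * (1 - inverse r * t) * (poly \<sigma> 0 * (\<Prod>i=1..n. 1 + c i * t))"
      by (simp add: \<sigma>)
    also have "\<dots> = (t - r) * poly \<sigma> t" unfolding n c(2)[of t, symmetric] using r0(1) by (simp add: field_simps)
    also have "\<dots> = poly \<rho> t" by (simp add: \<sigma> algebra_simps)
    finally show ?thesis ..
  qed
  ultimately show ?case by blast
qed

text \<open>By the weight condition and coprimality of \<open>h\<close> and \<open>k - h\<close>,
  the monomials are \<open>X 3 ^ (d - k * s) * U ^ s\<close>. So \<open>R\<close> is a power of
  \<open>X 3\<close> times a binary form of degree \<open>d div k\<close> in \<open>U\<close> and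
  \<open>V\<close>, and the value at the third coordinate point shows that the pure power of
  \<open>V\<close> occurs. If the dehomogenization has smaller degree \<open>l\<close>, the
  remaining factors \<open>V\<close> join the power of \<open>X 3\<close>.\<close>

lemma binomial_third_component:
  assumes h: "0 < h" "h < k" "gcd h k = 1" and R: "hom d R" "ev R (axis 3 1) \<noteq> 0"
    and w: "\<And>e. e \<in> supp R \<Longrightarrow> (k - h) * expo e 1 = h * expo e 2"
  shows "\<exists>\<zeta> l c. \<zeta> \<noteq> 0 \<and> k * l \<le> d \<and> (\<forall>i\<in>{1..l}. c i \<noteq> 0) \<and>
    R = c3 \<zeta> * X 3 ^ (d - k * l) * (\<Prod>i=1..l. X 3 ^ k + c3 (c i) * (X 1 ^ h * X 2 ^ (k - h)))"
proof -
  define L where "L = d div k"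
  define U where "U = X 1 ^ h * X 2 ^ (k - h)"
  define V where "V = X 3 ^ k"
  have kL: "k * L \<le> d" by (simp add: L_def)
  have cop: "coprime h (k - h)" using h by (metis coprime_iff_gcd_eq_1 gcd.commute gcd_diff1_nat less_imp_le_nat)
  have ex: "\<exists>s\<le>L. \<forall>c. mono3 c e = X 3 ^ (d - k * L) * (c3 c * U ^ s * V ^ (L - s))" if e: "e \<in> supp R" for e
  proof -
    obtain x y z where xyz: "e = (x, y, z)" by (cases e)
    have 1: "(k - h) * x = h * y" using w[OF e] by (simp add: xyz)
    have 2: "x + y + z = d" using hom_supp[OF R(1) e] by (simp add: xyz sum_3)
    have "h dvd (k - h) * x" using 1 by simp
    then have "h dvd x" using cop by (simp add: coprime_dvd_mult_right_iff)
    then obtain s where s: "x = h * s" by blast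
    then have "h * ((k - h) * s) = h * y" using 1 by (simp add: ac_simps)
    then have y: "y = (k - h) * s" using h by simp
    have "x + y = k * s" unfolding s y distrib_right[symmetric] using h by simp
    then have z: "z = d - k * s" "k * s \<le> d" using 2 by auto
    then have sL: "s \<le> L" unfolding L_def using h by (simp add: less_eq_div_iff_mult_less_eq mult.commute)
    have "d - k * s = (d - k * L) + k * (L - s)"
      using kL mult_le_mono2[OF sL, of k] by (simp add: diff_mult_distrib2)
    then have "X 3 ^ z = X 3 ^ (d - k * L) * V ^ (L - s)" unfolding z V_def by (simp add: power_add power_mult)
    then have "mono3 c e = X 3 ^ (d - k * L) * (c3 c * U ^ s * V ^ (L - s))" for c
      unfolding xyz mono3_def U_def s y prod.case power_mult power_mult_distrib by (simp only: ac_simps)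
    then show ?thesis using sL by blast
  qed
  then obtain S where S: "\<And>e. e \<in> supp R \<Longrightarrow> S e \<le> L"
    "\<And>e c. e \<in> supp R \<Longrightarrow> mono3 c e = X 3 ^ (d - k * L) * (c3 c * U ^ S e * V ^ (L - S e))" by metis
  have "\<exists>c. degree c \<le> L \<and> (\<Sum>e\<in>supp R. c3 (cf R e) * U ^ S e * V ^ (L - S e)) = bf L c U V"
  proof (rule bf_sum)
    fix e assume "e \<in> supp R"
    then have "S e \<le> L" using S(1) by blast
    then show "\<exists>c. degree c \<le> L \<and> c3 (cf R e) * U ^ S e * V ^ (L - S e) = bf L c U V"
      using bf_monom[of "S e" L "cf R e" U V] order_trans[OF degree_monom_le, of "S e" L "cf R e"] by metis
  qed
  then obtain \<rho> where \<rho>: "degree \<rho> \<le> L" "(\<Sum>e\<in>supp R. c3 (cf R e) * U ^ S e * V ^ (L - S e)) = bf L \<rho> U V" by blast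
  have "R = (\<Sum>e\<in>supp R. X 3 ^ (d - k * L) * (c3 (cf R e) * U ^ S e * V ^ (L - S e)))"
    by (subst monomial_expansion[of R]) (intro sum.cong refl S(2))
  then have RL: "R = X 3 ^ (d - k * L) * bf L \<rho> U V" by (simp only: sum_distrib_left[symmetric] \<rho>(2))
  have "ev U (axis 3 1) = 0" "ev V (axis 3 1) = 1" using h by (simp_all add: U_def V_def axis_def)
  then have "ev R (axis 3 1) = poly \<rho> 0" unfolding RL using \<rho>(1) by (simp add: bfc_1 axis_def)
  then have r0: "poly \<rho> 0 \<noteq> 0" using R(2) by simp
  define l where "l = degree \<rho>"
  obtain c where c: "\<forall>i\<in>{1..l}. c i \<noteq> 0" "\<And>t. poly \<rho> t = poly \<rho> 0 * (\<Prod>i=1..l. 1 + c i * t)"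
    using factor_at_zero[OF r0] unfolding l_def by blast
  have lL: "l \<le> L" using \<rho>(1) by (simp add: l_def)
  have kl: "k * l \<le> d" using kL mult_le_mono2[OF lL, of k] by linarith
  define Q where "Q = c3 (poly \<rho> 0) * X 3 ^ (d - k * l) * (\<Prod>i=1..l. V + c3 (c i) * U)"
  \<comment> \<open>The extra factor \<open>X 3\<close> restricts the comparison to points where
    \<open>V\<close> is not zero and \<open>U / V\<close> makes sense.\<close>
  have "R * X 3 = Q * X 3"
  proof (rule p3_eqI)
    fix v
    show "ev (R * X 3) v = ev (Q * X 3) v"
    proof (cases "v $ 3 = 0")
      case False
      define u where "u = ev U v"
      define n where "n = ev V v"
      have n: "n \<noteq> 0" "n = v $ 3 ^ k" using False by (simp_all add: n_def V_def)
      have "ev R v = v $ 3 ^ (d - k * L) * (n ^ L * poly \<rho> (u / n))"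
        unfolding RL using \<rho>(1) n(1) by (simp add: bfc_nonzero u_def n_def)
      also have "\<dots> = poly \<rho> 0 * (v $ 3 ^ (d - k * L) * n ^ (L - l)) * (n ^ l * (\<Prod>i=1..l. 1 + c i * (u / n)))"
        unfolding c(2)[of "u / n"] using lL by (simp add: power_add[symmetric])
      also have "n ^ l * (\<Prod>i=1..l. 1 + c i * (u / n)) = (\<Prod>i=1..l. n * (1 + c i * (u / n)))"
        by (simp add: prod.distrib)
      also have "\<dots> = (\<Prod>i=1..l. n + c i * u)" using n(1) by (intro prod.cong) (auto simp: field_simps)
      also have "v $ 3 ^ (d - k * L) * n ^ (L - l) = v $ 3 ^ (d - k * l)"
      proof -
        have "(d - k * L) + k * (L - l) = d - k * l"
          using kL mult_le_mono2[OF lL, of k] by (simp add: diff_mult_distrib2)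
        then show ?thesis unfolding n(2) by (simp add: power_mult[symmetric] power_add[symmetric])
      qed
      finally show ?thesis by (simp add: Q_def u_def n_def)
    qed simp
  qed
  moreover have "X 3 \<noteq> 0" by (simp add: X_def)
  ultimately have "R = Q" by simp
  then show ?thesis using r0 kl c(1) unfolding Q_def U_def V_def by blast
qed

theorem binomial_components:
  assumes F: "nondeg d F" and h: "0 < h" "h < k" "gcd h k = 1"
    and inv: "pencil_invariant (X 1 ^ h * X 2 ^ (k - h)) (X 3 ^ k) F"
  shows "\<exists>\<alpha> \<beta> \<zeta> l c. \<alpha> \<noteq> 0 \<and> \<beta> \<noteq> 0 \<and> \<zeta> \<noteq> 0 \<and> k * l \<le> d \<and> (\<forall>i\<in>{1..l}. c i \<noteq> 0) \<and>
    F $ 3 = c3 \<zeta> * X 3 ^ (d - k * l) * (\<Prod>i=1..l. X 3 ^ k + c3 (c i) * (X 1 ^ h * X 2 ^ (k - h))) \<and>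
    (F $ 1 = c3 \<alpha> * X 1 ^ d \<and> F $ 2 = c3 \<beta> * X 2 ^ d \<or> F $ 1 = c3 \<alpha> * X 2 ^ d \<and> F $ 2 = c3 \<beta> * X 1 ^ d)"
proof -
  have F': "d > 0" "\<forall>i. hom d (F $ i)" "\<And>v. evv F v = 0 \<Longrightarrow> v = 0" using F by (auto simp: nondeg_def)
  define U where "U = X 1 ^ h * X 2 ^ (k - h)"
  define V where "V = X 3 ^ k"
  define p where "p = k - h"
  have p: "p > 0" "k = h + p" using h by (auto simp: p_def)
  \<comment> \<open>The diagonal field with weights \<open>p\<close>, \<open>- h\<close>,
    \<open>0\<close> annihilates both \<open>U\<close> and \<open>V\<close>, so it is tangent to the
    pencil.\<close>
  define w :: "3 \<Rightarrow> complex" where "w i = (if i = 1 then of_nat p else if i = 2 then - of_nat h else 0)" for i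
  have w: "w 1 = of_nat p" "w 2 = - of_nat h" "w 3 = 0" by (simp_all add: w_def)
  define M :: "complex ^ 3 ^ 3" where "M = (\<chi> i j. if j = i then w i else 0)"
  have mvM: "mv M $ i = c3 (w i) * X i" for i
    using exhaust_3[of i] by (auto simp: lf_def M_def sum_3)
  have hU: "hom k U" unfolding U_def p(2)
    by (rule hom_mult'[OF hom_power[OF hom_X(1)] hom_power[OF hom_X(1)]]) simp
  have hV: "hom k V" unfolding V_def using hom_power[OF hom_X(1)[of 3], of k] by simp
  have cUV: "coprime U V" unfolding U_def V_def using coprime_X[of 1 3] coprime_X[of 2 3] by simp
  have "crs XX (mv M) = vector [c3 (of_nat h) * (X 2 * X 3), c3 (of_nat p) * (X 1 * X 3), c3 (- of_nat k) * (X 1 * X 2)]"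
    unfolding vec3_eq by (auto simp: mvM w p(2) c3_hom algebra_simps simp del: mv_nth)
  moreover have "cop3 (vector [c3 (of_nat h) * (X 2 * X 3), c3 (of_nat p) * (X 1 * X 3), c3 (- of_nat k) * (X 1 * X 2)])"
    by (rule cop3_products) (use h p(1) in auto)
  ultimately have cop: "cop3 (crs XX (mv M))" by (simp only:)
  define D where "D = - (X 1 ^ (h - 1) * X 2 ^ (p - 1) * X 3 ^ (k - 1))"
  have pw: "X i ^ n = X i * X i ^ (n - 1)" if "n > 0" for i n using that by (cases n) auto
  have pdp: "pd j (X i ^ n) = (if i = j then of_nat n * X i ^ (n - 1) else 0)" for i j n
  proof (induction n)
    case (Suc n)
    then show ?case by (cases n) (auto simp: algebra_simps)
  qed simp
  have om: "omega U V $ i = D * crs XX (mv M) $ i" for i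
  proof -
    have c: "c3 (of_nat n) = of_nat n" for n by (rule p3_eqI) simp
    define x where "x = X 1 ^ (h - 1)"
    define y where "y = X 2 ^ (p - 1)"
    define z where "z = X 3 ^ (k - 1)"
    have 1: "pd 1 U = of_nat h * x * (X 2 * y)" "pd 2 U = of_nat p * (X 1 * x) * y" "pd 3 U = 0"
      "pd 1 V = 0" "pd 2 V = 0" "pd 3 V = of_nat k * z"
      by (simp_all add: U_def V_def pdp p_def[symmetric] x_def y_def z_def pw[OF h(1), symmetric, simplified] pw[OF p(1), symmetric, simplified])
    have 2: "U = X 1 * x * (X 2 * y)" "V = X 3 * z" "D = - (x * y * z)" "(of_nat k :: p3) = of_nat h + of_nat p"
      using pw[OF h(1), of 1] pw[OF p(1), of 2] pw[of k 3] h p(2)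
      by (simp_all add: U_def V_def D_def x_def y_def z_def p_def[symmetric])
    show ?thesis using exhaust_3[of i]
      by (elim disjE) (simp_all add: 1 mvM w c3_hom c del: mv_nth, simp_all add: 2 algebra_simps)
  qed
  have k0: "k > 0" using h by simp
  obtain \<kappa> h' where \<kappa>: "\<kappa> \<noteq> 0" "\<And>v. M *v evv F v = \<kappa> *s evv (push F (mv M)) v + h' *s evv F v"
    using linear_foliation_equivariance[OF F cUV hU hV k0 pencil_invariantD om cop] inv unfolding U_def V_def by blast
  \<comment> \<open>Component \<open>j\<close> of the equivariance says that the diagonal field
    multiplies \<open>F $ j\<close> by this constant, which is therefore the weight of all its
    monomials.\<close>
  have wt: "(\<Sum>i\<in>UNIV. w i * of_nat (expo e i)) = (w j - h') / \<kappa>" if e: "e \<in> supp (F $ j)" for e j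
  proof -
    have "(\<Sum>i\<in>UNIV. c3 ((\<chi> i. w i) $ i) * X i * pd i (F $ j)) = c3 ((w j - h') / \<kappa>) * F $ j"
    proof (rule p3_eqI)
      fix v
      have "w j * ev (F $ j) v = (M *v evv F v) $ j"
        using exhaust_3[of j] by (auto simp: matrix_vector_mult_def M_def sum_3)
      also have "\<dots> = \<kappa> * (\<Sum>i\<in>UNIV. ev (pd i (F $ j)) v * (w i * v $ i)) + h' * ev (F $ j) v"
        unfolding \<kappa>(2) by (simp add: push_def dot_def mvM del: mv_nth)
      finally show "ev (\<Sum>i\<in>UNIV. c3 ((\<chi> i. w i) $ i) * X i * pd i (F $ j)) v = ev (c3 ((w j - h') / \<kappa>) * F $ j) v"
        using \<kappa>(1) by (simp add: field_simps sum_3)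
    qed
    from cf_weight[OF this e] show ?thesis by simp
  qed
  define a where "a = \<kappa> * of_nat d"
  have a0: "a \<noteq> 0" using \<kappa>(1) F'(1) by (simp add: a_def)
  \<comment> \<open>At the coordinate point \<open>i\<close> some component of \<open>F\<close> is
    not zero, so it contains the pure power of degree \<open>d\<close>, of weight
    \<open>d * w i\<close>. Equating this with the weight of the component gives the affine
    map.\<close>
  have "\<exists>j. a * w i + h' = w j" for i
  proof -
    have "evv F (axis i 1) \<noteq> 0" using F'(3)[of "axis i 1"] by (auto simp: axis_eq_0_iff)
    then obtain j where "ev (F $ j) (axis i 1) \<noteq> 0" by (auto simp: vec_eq_iff)
    then obtain e where e: "e \<in> supp (F $ j)" "\<And>j. expo e j = (if j = i then d else 0)"
      using axis_supp F'(2) by blast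
    have "(\<Sum>j\<in>UNIV. w j * of_nat (expo e j)) = w i * of_nat d"
      using exhaust_3[of i] by (auto simp: e(2) sum_3)
    then have "w i * of_nat d = (w j - h') / \<kappa>" using wt[OF e(1)] by simp
    then show ?thesis using \<kappa>(1) by (intro exI[of _ j]) (simp add: a_def field_simps)
  qed
  then have ah: "h' = 0 \<and> (a = 1 \<or> a = - 1 \<and> p = h)"
    using affine_permutation_complex[OF p(1) h(1) a0 w] by blast
  have wt': "a * (of_nat p * of_nat (expo e 1) - of_nat h * of_nat (expo e 2)) = of_nat d * w j"
    "expo e 1 + expo e 2 + expo e 3 = d" if e: "e \<in> supp (F $ j)" for e j
  proof -
    have "of_nat p * of_nat (expo e 1) - of_nat h * of_nat (expo e 2) = w j / \<kappa>"
      using wt[OF e] ah by (simp add: sum_3 w)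
    then show "a * (of_nat p * of_nat (expo e 1) - of_nat h * of_nat (expo e 2)) = of_nat d * w j"
      using \<kappa>(1) by (simp add: a_def)
    show "expo e 1 + expo e 2 + expo e 3 = d" using hom_supp[OF _ e] F'(2) by (simp add: sum_3)
  qed
  have nat: "x = y" if "(of_nat x :: complex) = of_nat y" for x y :: nat using that by simp
  have s3: "p * expo e 1 = h * expo e 2" if e: "e \<in> supp (F $ 3)" for e
  proof -
    have "(of_nat (p * expo e 1) :: complex) = of_nat (h * expo e 2)" using wt'(1)[OF e] a0 by (simp add: w)
    then show ?thesis by (rule nat)
  qed
  \<comment> \<open>The weight required of \<open>F $ 1\<close> and of \<open>F $ 2\<close> is
    extremal among monomials of degree \<open>d\<close> and attained only by a pure power.\<close>
  have big: "m = d \<and> n = 0" if "q * m = q * d + q' * n" "m \<le> d" "q > 0" "q' > 0" for q q' m n :: nat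
  proof -
    have "q * m \<le> q * d" using that(2) by simp
    then have "q' * n = 0" using that(1) by linarith
    then show ?thesis using that by simp
  qed
  define E where "E = ((d, 0, 0) :: nat \<times> nat \<times> nat)"
  define E' where "E' = ((0, d, 0) :: nat \<times> nat \<times> nat)"
  have trip: "e = (expo e 1, expo e 2, expo e 3)" for e by (cases e) simp
  have supps: "supp (F $ 1) \<subseteq> {E} \<and> supp (F $ 2) \<subseteq> {E'} \<or> supp (F $ 1) \<subseteq> {E'} \<and> supp (F $ 2) \<subseteq> {E}"
  proof (cases "a = 1")
    case True
    have "e = E" if e: "e \<in> supp (F $ 1)" for e
    proof -
      have "(of_nat (p * expo e 1) :: complex) = of_nat (p * d + h * expo e 2)"
        using wt'(1)[OF e] True by (simp add: w algebra_simps)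
      from big[OF nat[OF this]] show ?thesis using wt'(2)[OF e] p h trip[of e] by (simp add: E_def)
    qed
    moreover have "e = E'" if e: "e \<in> supp (F $ 2)" for e
    proof -
      have "(of_nat (h * expo e 2) :: complex) = of_nat (h * d + p * expo e 1)"
        using wt'(1)[OF e] True by (simp add: w algebra_simps)
      from big[OF nat[OF this]] show ?thesis using wt'(2)[OF e] p h trip[of e] by (simp add: E'_def)
    qed
    ultimately show ?thesis by blast
  next
    case False
    then have a: "a = - 1" "p = h" using ah by auto
    have "e = E'" if e: "e \<in> supp (F $ 1)" for e
    proof -
      have "(of_nat (h * expo e 2) :: complex) = of_nat (h * d + h * expo e 1)"
        using wt'(1)[OF e] by (simp add: w a algebra_simps)
      from big[OF nat[OF this]] show ?thesis using wt'(2)[OF e] p h trip[of e] by (simp add: E'_def)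
    qed
    moreover have "e = E" if e: "e \<in> supp (F $ 2)" for e
    proof -
      have "(of_nat (h * expo e 1) :: complex) = of_nat (h * d + h * expo e 2)"
        using wt'(1)[OF e] by (simp add: w a algebra_simps)
      from big[OF nat[OF this]] show ?thesis using wt'(2)[OF e] p h trip[of e] by (simp add: E_def)
    qed
    ultimately show ?thesis by blast
  qed
  have mE: "mono3 c E = c3 c * X 1 ^ d" "mono3 c E' = c3 c * X 2 ^ d" for c by (simp_all add: mono3_def E_def E'_def)
  have "\<exists>\<alpha> \<beta>. F $ 1 = c3 \<alpha> * X 1 ^ d \<and> F $ 2 = c3 \<beta> * X 2 ^ d \<or> F $ 1 = c3 \<alpha> * X 2 ^ d \<and> F $ 2 = c3 \<beta> * X 1 ^ d"
    using supps single_supp[of "F $ 1"] single_supp[of "F $ 2"] mE by metis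
  then obtain \<alpha> \<beta> where ab: "F $ 1 = c3 \<alpha> * X 1 ^ d \<and> F $ 2 = c3 \<beta> * X 2 ^ d \<or> F $ 1 = c3 \<alpha> * X 2 ^ d \<and> F $ 2 = c3 \<beta> * X 1 ^ d" by blast
  have F3: "ev (F $ 3) (axis i 1) = 0" if "i = 1 \<or> i = 2" for i
  proof (rule ccontr)
    assume "ev (F $ 3) (axis i 1) \<noteq> 0"
    then obtain e where e: "e \<in> supp (F $ 3)" "\<And>j. expo e j = (if j = i then d else 0)"
      using axis_supp F'(2) by blast
    then show False using s3[OF e(1)] that h p F'(1) by auto
  qed
  have ax: "\<exists>j. ev (F $ j) (axis i 1) \<noteq> 0" for i
  proof -
    have "evv F (axis i 1) \<noteq> 0" using F'(3)[of "axis i 1"] by (auto simp: axis_eq_0_iff)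
    then show ?thesis by (auto simp: vec_eq_iff)
  qed
  have nz: "\<alpha> \<noteq> 0" "\<beta> \<noteq> 0"
  proof -
    have "ev (F $ 1) (axis i 1) \<noteq> 0 \<or> ev (F $ 2) (axis i 1) \<noteq> 0" if "i = 1 \<or> i = 2" for i
      using ax[of i] F3[OF that] by (metis exhaust_3)
    from this[of 1] this[of 2] show "\<alpha> \<noteq> 0" "\<beta> \<noteq> 0" using ab F'(1) by (auto simp: axis_def)
  qed
  have r3: "ev (F $ 3) (axis 3 1) \<noteq> 0"
  proof -
    have "ev (F $ 1) (axis 3 1) = 0" "ev (F $ 2) (axis 3 1) = 0" using ab F'(1) by (auto simp: axis_def)
    then show ?thesis using ax[of 3] by (metis exhaust_3)
  qed
  have "hom d (F $ 3)" using F'(2) by blast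
  from binomial_third_component[OF h this r3 s3[unfolded p_def]]
  obtain \<zeta> l c where z: "\<zeta> \<noteq> 0" "k * l \<le> d" "\<forall>i\<in>{1..l}. c i \<noteq> 0"
    "F $ 3 = c3 \<zeta> * X 3 ^ (d - k * l) * (\<Prod>i=1..l. X 3 ^ k + c3 (c i) * (X 1 ^ h * X 2 ^ (k - h)))"
    by blast
  show ?thesis
    by (rule exI[of _ \<alpha>], rule exI[of _ \<beta>], rule exI[of _ \<zeta>], rule exI[of _ l], rule exI[of _ c])
      (intro conjI nz z ab)
qed

section \<open>Diagonal conjugation to the normal form\<close>

lemma scaling_exists:
  assumes "d > 1" "\<alpha> \<noteq> (0::complex)" shows "\<exists>s. s \<noteq> 0 \<and> s * \<alpha> = s ^ d"
proof -
  obtain s where s: "s ^ (d - 1) = \<alpha>" using complex_root_exists[of "d - 1" \<alpha>] assms(1) by auto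
  then have "s \<noteq> 0" using assms by (auto simp: power_0_left)
  moreover have "s ^ d = s * s ^ (d - 1)" using assms(1) by (cases d) auto
  ultimately show ?thesis using s by auto
qed

text \<open>Eliminating \<open>s\<close> leaves the equation of \<open>scaling_exists\<close> for
  \<open>t\<close>, with exponent \<open>d * d\<close> and constant
  \<open>\<alpha> ^ d * \<beta>\<close>.\<close>

lemma swap_scaling_exists:
  assumes "d > 1" "\<alpha> \<noteq> (0::complex)" "\<beta> \<noteq> 0"
  shows "\<exists>s t. s \<noteq> 0 \<and> t \<noteq> 0 \<and> s * \<alpha> = t ^ d \<and> t * \<beta> = s ^ d"
proof -
  have "d * d > 1" using assms(1) by (metis less_1_mult)
  then obtain t where t: "t \<noteq> 0" "t * (\<alpha> ^ d * \<beta>) = t ^ (d * d)"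
    using scaling_exists[of "d * d" "\<alpha> ^ d * \<beta>"] assms by auto
  define s where "s = t ^ d / \<alpha>"
  have "s * \<alpha> = t ^ d" "s \<noteq> 0" using assms t by (simp_all add: s_def)
  moreover have "s ^ d = t * \<beta>"
    using t(2) assms(2) by (simp add: s_def power_divide field_simps power_mult)
  ultimately show ?thesis using t(1) by metis
qed

definition diag3 :: "complex \<Rightarrow> complex \<Rightarrow> complex \<Rightarrow> complex ^ 3 ^ 3" where
  "diag3 s t u = vector [vector [s, 0, 0], vector [0, t, 0], vector [0, 0, u]]"

lemma diag3_mult: "diag3 s t u *v v = vector [s * v $ 1, t * v $ 2, u * v $ 3]"
  by (simp add: vec3_eq diag3_def matrix_vector_mult_def sum_3)

lemma diag3_inverse:
  assumes "s \<noteq> 0" "t \<noteq> 0" "u \<noteq> 0"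
  shows "diag3 s t u ** diag3 (inverse s) (inverse t) (inverse u) = mat 1"
    "diag3 (inverse s) (inverse t) (inverse u) ** diag3 s t u = mat 1"
    "invertible (diag3 s t u)" "invertible (diag3 (inverse s) (inverse t) (inverse u))"
proof -
  show 1: "diag3 s t u ** diag3 (inverse s) (inverse t) (inverse u) = mat 1"
    and 2: "diag3 (inverse s) (inverse t) (inverse u) ** diag3 s t u = mat 1"
    using assms by (simp_all add: matrix_eq matrix_vector_mul_assoc[symmetric] diag3_mult vec3_eq)
  show "invertible (diag3 s t u)" "invertible (diag3 (inverse s) (inverse t) (inverse u))"
    using 1 2 by (auto simp: invertible_def)
qed

lemma proj_map_comp:
  fixes M N :: "complex ^ 'n::finite ^ 'n"
  assumes "invertible M" "invertible N" shows "proj_map M \<circ> proj_map N = proj_map (M ** N)"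
proof
  fix p :: "'n proj"
  obtain v where v: "v \<noteq> 0" "p = abs_proj v" by (rule abs_proj_cases)
  then show "(proj_map M \<circ> proj_map N) p = proj_map (M ** N) p"
    using assms invertible_mult[OF assms]
    by (simp add: proj_map_abs invertible_mult_nonzero matrix_vector_mul_assoc)
qed

text \<open>\<open>T\<close> multiplies \<open>U\<close> and \<open>V\<close> by \<open>a\<close>
  and \<open>b\<close>, so it acts on the members by dividing their two parameters by
  \<open>a\<close> and \<open>b\<close>; \<open>N ** T ** M\<close> is the same map in the original
  coordinates.\<close>

lemma diagonal_preserves_pencil:
  assumes pencil: "pencil k A B"
    and curves: "\<And>c v. dot2 c (pair U V v) = 0 \<longleftrightarrow> dot2 (c v* \<Psi>) (pair (to_p3 A) (to_p3 B) (N *v v)) = 0"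
    and M: "invertible M" "invertible N" "M ** N = mat 1" "N ** M = mat 1" and \<Psi>: "invertible \<Psi>"
    and T: "invertible T" and UV: "\<And>v. ev U (T *v v) = a * ev U v" "\<And>v. ev V (T *v v) = b * ev V v" "a \<noteq> 0" "b \<noteq> 0"
  shows "maps_pencil_to_itself (proj_map (N ** T ** M)) A B"
  unfolding maps_pencil_to_itself_def
proof
  fix C assume "C \<in> pencil_curves A B"
  then obtain c where c: "c \<noteq> 0" "C = pencil_curve A B c" unfolding pencil_curves_def by blast
  note h = pencil_hom(1,2)[OF pencil]
  obtain \<Theta> where \<Theta>: "invertible \<Theta>" "\<Theta> ** \<Psi> = mat 1" using \<Psi> by (metis invertibleE)
  define e where "e = c v* \<Theta>"
  have e0: "e \<noteq> 0" using invertible_vector_mult_nonzero[OF \<Theta>(1) c(1)] by (simp add: e_def)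
  have ce: "c = e v* \<Psi>" by (simp add: e_def vector_matrix_mul_assoc \<Theta>(2))
  define e' :: "complex ^ 2" where "e' = vector [e $ 1 / a, e $ 2 / b]"
  have "e' \<noteq> 0" using e0 UV(3,4) by (auto simp: e'_def vec2_eq)
  then have c': "e' v* \<Psi> \<noteq> 0" using invertible_vector_mult_nonzero[OF \<Psi>] by blast
  define S where "S = N ** T ** M"
  have S: "invertible S" unfolding S_def using M T by (intro invertible_mult)
  then obtain S' where S': "invertible S'" "S ** S' = mat 1" by (metis invertibleE)
  have NM: "N *v (M *v w) = w" for w by (simp add: matrix_vector_mul_assoc M(4))
  have iff: "dot2 c (pair (to_p3 A) (to_p3 B) w) = 0 \<longleftrightarrow>
      dot2 (e' v* \<Psi>) (pair (to_p3 A) (to_p3 B) (S *v w)) = 0" for w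
  proof -
    have "dot2 c (pair (to_p3 A) (to_p3 B) w) = 0 \<longleftrightarrow> dot2 e (pair U V (M *v w)) = 0"
      unfolding ce using curves[of e "M *v w"] by (simp add: NM)
    also have "dot2 e (pair U V (M *v w)) = dot2 e' (pair U V (T *v (M *v w)))"
      using UV by (simp add: dot2_def e'_def)
    also have "\<dots> = 0 \<longleftrightarrow> dot2 (e' v* \<Psi>) (pair (to_p3 A) (to_p3 B) (N *v (T *v (M *v w)))) = 0"
      by (rule curves)
    finally show ?thesis by (simp only: S_def matrix_vector_mul_assoc matrix_mul_assoc)
  qed
  have "proj_map S ` C = pencil_curve A B (e' v* \<Psi>)"
  proof (rule set_eqI)
    fix p :: "3 proj"
    obtain v where v: "v \<noteq> 0" "p = abs_proj v" by (rule abs_proj_cases)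
    have w: "S' *v v \<noteq> 0" "S *v (S' *v v) = v"
      using invertible_mult_nonzero[OF S'(1) v(1)] S'(2) by (simp_all add: matrix_vector_mul_assoc)
    have "p \<in> pencil_curve A B (e' v* \<Psi>) \<longleftrightarrow> abs_proj (S' *v v) \<in> C"
      unfolding v(2) c(2) pencil_curve_iff[OF h v(1)] pencil_curve_iff[OF h w(1)] iff w(2) ..
    moreover have "proj_map S (abs_proj (S' *v v)) = p" using S w v by (simp add: proj_map_abs)
    moreover have "q = abs_proj (S' *v v)" if "proj_map S q = p" for q
    proof -
      obtain S'' where S'': "invertible S''" "S'' ** S = mat 1" using S by (metis invertibleE)
      have "proj_map S'' (proj_map S q') = q'" for q' using proj_map_inverse[OF S S''] .
      then show ?thesis using that \<open>proj_map S (abs_proj (S' *v v)) = p\<close> by metis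
    qed
    ultimately show "p \<in> proj_map S ` C \<longleftrightarrow> p \<in> pencil_curve A B (e' v* \<Psi>)" by blast
  qed
  then show "proj_map (N ** T ** M) ` C \<in> pencil_curves A B"
    using c' unfolding S_def pencil_curves_def by blast
qed

lemma binomial_normal_form:
  assumes pencil: "pencil k A B" and d: "d > 1" and F: "represents d F f"
    and inv: "pencil_invariant (to_p3 A) (to_p3 B) F"
    and h: "0 < h" "h < k" "gcd h k = 1" and co: "binomial_coords k h A B \<phi> \<psi>"
  shows "\<exists>\<sigma>\<in>PGL. maps_pencil_to_itself \<sigma> A B \<and>
    (\<exists>l c. k * l \<le> d \<and> (\<forall>i\<in>{1..l}. c i \<noteq> 0) \<and>
      (endo_form d (vector [Var 1 ^ d, Var 2 ^ d, binomial_R d k h l c]) (in_coords \<phi> (\<sigma> \<circ> f \<circ> inv \<sigma>)) \<or>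
       endo_form d (vector [Var 2 ^ d, Var 1 ^ d, binomial_R d k h l c]) (in_coords \<phi> (\<sigma> \<circ> f \<circ> inv \<sigma>))))"
proof -
  obtain M N where M: "\<phi> = proj_map M" "invertible M" "invertible N" "M ** N = mat 1" "N ** M = mat 1"
    using PGL_cases co unfolding binomial_coords_def by blast
  obtain \<Psi> \<Theta> where \<Psi>: "\<psi> = proj_map \<Psi>" "invertible \<Psi>" "\<Psi> ** \<Theta> = mat 1" "\<Theta> ** \<Psi> = mat 1"
    using PGL_cases co unfolding binomial_coords_def by blast
  define U where "U = X 1 ^ h * X 2 ^ (k - h)"
  define V where "V = X 3 ^ k"
  have k0: "k > 0" using h by simp
  have UV: "to_p3 (Var 1 ^ h * Var 2 ^ (k - h)) = U" "to_p3 (Var 3 ^ k) = V"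
    by (simp_all add: to_p3_simps U_def V_def)
  have "hom (h + (k - h)) U" unfolding U_def
    by (rule hom_mult'[OF hom_power[OF hom_X(1)] hom_power[OF hom_X(1)]]) simp
  then have hU: "hom k (to_p3 (Var 1 ^ h * Var 2 ^ (k - h)))" unfolding UV using h by simp
  have hV: "hom k (to_p3 (Var 3 ^ k))" unfolding UV V_def using hom_power[OF hom_X(1)[of 3], of k] by simp
  have map: "map_in_coords (proj_map M) (proj_map \<Psi>) (pencil_map A B) =
      pencil_map (Var 1 ^ h * Var 2 ^ (k - h)) (Var 3 ^ k)"
    using co unfolding binomial_coords_def M(1) \<Psi>(1) by blast
  note curves = coords_curves[OF pencil_hom(1,2)[OF pencil] hU hV pencil_hom(3)[OF pencil] k0 M(2-5) \<Psi>(2) map, unfolded UV]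
  define G where "G = conj_form M N F"
  have G: "represents d G (in_coords \<phi> f)"
    unfolding G_def M(1) by (rule represents_in_coords[OF M(2-5) F])
  have invG: "pencil_invariant U V G"
    unfolding G_def by (rule pencil_invariant_coords[OF curves M(5) \<Psi>(2) inv])
  have ndG: "nondeg d G" using G by (simp add: represents_def)
  obtain \<alpha> \<beta> \<zeta> l c where g: "\<alpha> \<noteq> 0" "\<beta> \<noteq> 0" "\<zeta> \<noteq> 0" "k * l \<le> d" "\<forall>i\<in>{1..l}. c i \<noteq> 0"
    "G $ 3 = c3 \<zeta> * X 3 ^ (d - k * l) * (\<Prod>i=1..l. X 3 ^ k + c3 (c i) * (X 1 ^ h * X 2 ^ (k - h)))"
    "G $ 1 = c3 \<alpha> * X 1 ^ d \<and> G $ 2 = c3 \<beta> * X 2 ^ d \<or> G $ 1 = c3 \<alpha> * X 2 ^ d \<and> G $ 2 = c3 \<beta> * X 1 ^ d"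
    using binomial_components[OF ndG h invG[unfolded U_def V_def]]
    by (elim exE conjE) (rule that; assumption)
  \<comment> \<open>The equations for \<open>u\<close>, \<open>s\<close> and \<open>t\<close>
    express that conjugation by the diagonal matrix with these entries turns the leading constants
    into 1.\<close>
  obtain u where u: "u \<noteq> 0" "u * \<zeta> = u ^ d" using scaling_exists[OF d g(3)] by blast
  obtain s t where st: "s \<noteq> 0" "t \<noteq> 0"
    "G $ 1 = c3 \<alpha> * X 1 ^ d \<and> G $ 2 = c3 \<beta> * X 2 ^ d \<and> s * \<alpha> = s ^ d \<and> t * \<beta> = t ^ d \<or>
     G $ 1 = c3 \<alpha> * X 2 ^ d \<and> G $ 2 = c3 \<beta> * X 1 ^ d \<and> s * \<alpha> = t ^ d \<and> t * \<beta> = s ^ d"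
    using g(7)
  proof
    assume *: "G $ 1 = c3 \<alpha> * X 1 ^ d \<and> G $ 2 = c3 \<beta> * X 2 ^ d"
    obtain s t where "s \<noteq> 0" "s * \<alpha> = s ^ d" "t \<noteq> 0" "t * \<beta> = t ^ d"
      using scaling_exists[OF d g(1)] scaling_exists[OF d g(2)] by blast
    then show thesis by (intro that[of s t] disjI1 conjI) (simp_all add: *)
  next
    assume *: "G $ 1 = c3 \<alpha> * X 2 ^ d \<and> G $ 2 = c3 \<beta> * X 1 ^ d"
    obtain s t where "s \<noteq> 0" "t \<noteq> 0" "s * \<alpha> = t ^ d" "t * \<beta> = s ^ d"
      using swap_scaling_exists[OF d g(1,2)] by blast
    then show thesis by (intro that[of s t] disjI2 conjI) (simp_all add: *)
  qed
  define T where "T = diag3 s t u"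
  define T' where "T' = diag3 (inverse s) (inverse t) (inverse u)"
  have T: "T ** T' = mat 1" "T' ** T = mat 1" "invertible T" "invertible T'"
    unfolding T_def T'_def by (rule diag3_inverse[OF st(1,2) u(1)])+
  define \<sigma> where "\<sigma> = proj_map (N ** T ** M)"
  have iS: "invertible (N ** T ** M)" "invertible (N ** T' ** M)" using M(2,3) T(3,4) by (simp_all add: invertible_mult)
  have \<sigma>PGL: "\<sigma> \<in> PGL" unfolding \<sigma>_def PGL_def using iS by blast
  have pres: "maps_pencil_to_itself \<sigma> A B"
    unfolding \<sigma>_def
  proof (rule diagonal_preserves_pencil[OF pencil curves M(2-5) \<Psi>(2) T(3)])
    show "ev U (T *v v) = (s ^ h * t ^ (k - h)) * ev U v" for v
      by (simp add: U_def T_def diag3_mult power_mult_distrib)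
    show "ev V (T *v v) = u ^ k * ev V v" for v
      by (simp add: V_def T_def diag3_mult power_mult_distrib)
  qed (use st u in auto)
  define H where "H = conj_form T T' G"
  have coords: "in_coords \<phi> (\<sigma> \<circ> f \<circ> inv \<sigma>) = in_coords (proj_map T) (in_coords \<phi> f)"
  proof -
    have NM: "proj_map N (proj_map M p) = p" "proj_map M (proj_map N p) = p" for p
      using proj_map_inverse[OF M(2) M(3) M(5)] proj_map_inverse[OF M(3) M(2) M(4)] by simp_all
    have s1: "\<sigma> p = proj_map N (proj_map T (proj_map M p))" for p
      unfolding \<sigma>_def proj_map_comp[OF invertible_mult[OF M(3) T(3)] M(2), symmetric]
        proj_map_comp[OF M(3) T(3), symmetric] by simp
    have 1: "M *v (N *v x) = x" "N *v (M *v x) = x" "T *v (T' *v x) = x" "T' *v (T *v x) = x" for x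
      using M(4,5) T(1,2) by (simp_all add: matrix_vector_mul_assoc)
    have "(N ** T ** M) ** (N ** T' ** M) = mat 1" "(N ** T' ** M) ** (N ** T ** M) = mat 1"
      by (simp_all add: matrix_eq matrix_vector_mul_assoc[symmetric] 1)
    then have i\<sigma>: "inv \<sigma> = proj_map (N ** T' ** M)" unfolding \<sigma>_def using inv_proj_map[OF iS] by blast
    have s2: "inv \<sigma> p = proj_map N (proj_map T' (proj_map M p))" for p
      unfolding i\<sigma> proj_map_comp[OF invertible_mult[OF M(3) T(4)] M(2), symmetric]
        proj_map_comp[OF M(3) T(4), symmetric] by simp
    show ?thesis
      by (rule ext) (simp add: in_coords_def s1 s2 M(1) inv_proj_map[OF M(2-5)]
          inv_proj_map[OF T(3,4,1,2)] NM)
  qed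
  have H: "represents d H (in_coords \<phi> (\<sigma> \<circ> f \<circ> inv \<sigma>))"
    unfolding H_def coords by (rule represents_in_coords[OF T(3,4,1,2) G])
  \<comment> \<open>Taking \<open>1 / u ^ k\<close> out of each factor of the conjugated product
    leaves these constants.\<close>
  define c' where "c' i = c i * u ^ k / (s ^ h * t ^ (k - h))" for i
  have c': "\<forall>i\<in>{1..l}. c' i \<noteq> 0" using g(5) st u by (simp add: c'_def)
  have Hv: "ev (H $ i) v = (T *v evv G (T' *v v)) $ i" for i v
    unfolding H_def evv_conj_form[symmetric] by simp
  have H3: "ev (H $ 3) v = eval (binomial_R d k h l c') v" for v
  proof -
    have f: "(v $ 3 / u) ^ k + c i * ((v $ 1 / s) ^ h * (v $ 2 / t) ^ (k - h)) =
        (1 / u ^ k) * (v $ 3 ^ k + c' i * v $ 1 ^ h * v $ 2 ^ (k - h))" for i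
      using st u by (simp add: c'_def power_divide field_simps)
    have "ev (H $ 3) v = u * (\<zeta> * (v $ 3 / u) ^ (d - k * l) *
        (\<Prod>i=1..l. (v $ 3 / u) ^ k + c i * ((v $ 1 / s) ^ h * (v $ 2 / t) ^ (k - h))))"
      unfolding Hv T_def T'_def diag3_mult by (simp add: g(6) field_simps)
    also have "\<dots> = (u * \<zeta>) * (1 / u ^ (d - k * l)) * (1 / u ^ k) ^ l *
        (v $ 3 ^ (d - k * l) * (\<Prod>i=1..l. v $ 3 ^ k + c' i * v $ 1 ^ h * v $ 2 ^ (k - h)))"
      unfolding f prod.distrib by (simp add: power_divide)
    also have "(u * \<zeta>) * (1 / u ^ (d - k * l)) * (1 / u ^ k) ^ l = 1"
    proof -
      have "u ^ d = u ^ (d - k * l) * (u ^ k) ^ l" using g(4) by (simp add: power_mult[symmetric] power_add[symmetric])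
      then show ?thesis unfolding u(2) using u(1) by (simp add: power_divide)
    qed
    finally show ?thesis by (simp add: binomial_R_def)
  qed
  from st(3) show ?thesis
  proof
    assume *: "G $ 1 = c3 \<alpha> * X 1 ^ d \<and> G $ 2 = c3 \<beta> * X 2 ^ d \<and> s * \<alpha> = s ^ d \<and> t * \<beta> = t ^ d"
    have "eval (vector [Var 1 ^ d, Var 2 ^ d, binomial_R d k h l c'] $ i) v = ev (H $ i) v" for i v
    proof -
      have "ev (H $ 1) v = (s * \<alpha>) * (v $ 1 / s) ^ d" "ev (H $ 2) v = (t * \<beta>) * (v $ 2 / t) ^ d"
        unfolding Hv T_def T'_def diag3_mult by (simp_all add: * field_simps)
      then have "ev (H $ 1) v = v $ 1 ^ d" "ev (H $ 2) v = v $ 2 ^ d"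
        using * st by (simp_all add: power_divide)
      then show ?thesis using exhaust_3[of i] H3 by auto
    qed
    then have "endo_form d (vector [Var 1 ^ d, Var 2 ^ d, binomial_R d k h l c']) (in_coords \<phi> (\<sigma> \<circ> f \<circ> inv \<sigma>))"
      by (rule represents_endo_form[OF H])
    then show ?thesis using \<sigma>PGL pres g(4) c' by blast
  next
    assume *: "G $ 1 = c3 \<alpha> * X 2 ^ d \<and> G $ 2 = c3 \<beta> * X 1 ^ d \<and> s * \<alpha> = t ^ d \<and> t * \<beta> = s ^ d"
    have "eval (vector [Var 2 ^ d, Var 1 ^ d, binomial_R d k h l c'] $ i) v = ev (H $ i) v" for i v
    proof -
      have "ev (H $ 1) v = (s * \<alpha>) * (v $ 2 / t) ^ d" "ev (H $ 2) v = (t * \<beta>) * (v $ 1 / s) ^ d"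
        unfolding Hv T_def T'_def diag3_mult by (simp_all add: * field_simps)
      then have "ev (H $ 1) v = v $ 2 ^ d" "ev (H $ 2) v = v $ 1 ^ d"
        using * st by (simp_all add: power_divide)
      then show ?thesis using exhaust_3[of i] H3 by auto
    qed
    then have "endo_form d (vector [Var 2 ^ d, Var 1 ^ d, binomial_R d k h l c']) (in_coords \<phi> (\<sigma> \<circ> f \<circ> inv \<sigma>))"
      by (rule represents_endo_form[OF H])
    then show ?thesis using \<sigma>PGL pres g(4) c' by blast
  qed
qed

text \<open>\<open>\<delta>\<close> is the determinant of the coefficients of the pencil with
  respect to the two monomials; it is not zero because the generators are independent. The inverse
  matrix \<open>\<Psi>\<close> gives the coordinates on the line.\<close>

lemma binomial_pencilI:
  assumes pencil: "pencil k A B" and P: "invertible P" and h: "0 < h" "h < k" "gcd h k = 1"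
    and AP: "cmp (to_p3 A) (mv P) = c3 a1 * (X 1 ^ h * X 2 ^ (k - h)) + c3 a0 * X 3 ^ k"
    and BP: "cmp (to_p3 B) (mv P) = c3 b1 * (X 1 ^ h * X 2 ^ (k - h)) + c3 b0 * X 3 ^ k"
  shows "binomial_pencil k A B"
proof -
  obtain M where M: "invertible M" "P ** M = mat 1" "M ** P = mat 1" using P by (rule invertibleE)
  define \<delta> where "\<delta> = a1 * b0 - a0 * b1"
  have indep: "s = 0 \<and> t = 0"
    if "c3 s * cmp (to_p3 A) (mv P) + c3 t * cmp (to_p3 B) (mv P) = 0" for s t
  proof (rule pencil_independent[OF pencil])
    have "cmp (c3 s * to_p3 A + c3 t * to_p3 B) (mv P) = 0" using that by simp
    then have "cmp (cmp (c3 s * to_p3 A + c3 t * to_p3 B) (mv P)) (mv M) = 0" by simp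
    then show "c3 s * to_p3 A + c3 t * to_p3 B = 0" by (simp only: cmp_mv_cmp_mv[OF M(2)])
  qed
  have \<delta>: "\<delta> \<noteq> 0"
  proof
    assume z: "\<delta> = 0"
    have "c3 b0 * cmp (to_p3 A) (mv P) + c3 (- a0) * cmp (to_p3 B) (mv P) = c3 \<delta> * (X 1 ^ h * X 2 ^ (k - h))"
      "c3 (- b1) * cmp (to_p3 A) (mv P) + c3 a1 * cmp (to_p3 B) (mv P) = c3 \<delta> * X 3 ^ k"
      unfolding AP BP by (simp_all add: \<delta>_def c3_hom algebra_simps)
    then have "c3 b0 * cmp (to_p3 A) (mv P) + c3 (- a0) * cmp (to_p3 B) (mv P) = 0"
      "c3 (- b1) * cmp (to_p3 A) (mv P) + c3 a1 * cmp (to_p3 B) (mv P) = 0"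
      by (simp_all only: z c3_simps mult_zero_left)
    from indep[OF this(1)] indep[OF this(2)] have "b0 = 0" "a0 = 0" "b1 = 0" "a1 = 0" by simp_all
    then have "c3 1 * cmp (to_p3 A) (mv P) + c3 0 * cmp (to_p3 B) (mv P) = 0" unfolding AP BP by simp
    from indep[OF this] show False by simp
  qed
  define \<Psi> :: "complex ^ 2 ^ 2" where
    "\<Psi> = vector [vector [b0 / \<delta>, - a0 / \<delta>], vector [- b1 / \<delta>, a1 / \<delta>]]"
  have \<Psi>v: "(\<Psi> *v y) $ 1 = (b0 * y $ 1 - a0 * y $ 2) / \<delta>" "(\<Psi> *v y) $ 2 = (a1 * y $ 2 - b1 * y $ 1) / \<delta>" for y
    by (simp_all add: \<Psi>_def matrix_vector_mult_def sum_2 diff_divide_distrib)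
  have i\<Psi>: "invertible \<Psi>"
  proof (rule invertibleI_inj)
    fix y assume "\<Psi> *v y = 0"
    then have "(\<Psi> *v y) $ 1 = 0" "(\<Psi> *v y) $ 2 = 0" by simp_all
    then have e: "b0 * y $ 1 = a0 * y $ 2" "a1 * y $ 2 = b1 * y $ 1" unfolding \<Psi>v using \<delta> by simp_all
    have "\<delta> * y $ 1 = a1 * (b0 * y $ 1) - a0 * (b1 * y $ 1)" by (simp add: \<delta>_def algebra_simps)
    also have "\<dots> = 0" unfolding e(1) e(2)[symmetric] by simp
    finally have 1: "y $ 1 = 0" using \<delta> by simp
    have "\<delta> * y $ 2 = b0 * (a1 * y $ 2) - b1 * (a0 * y $ 2)" by (simp add: \<delta>_def algebra_simps)
    also have "\<dots> = 0" unfolding e(1)[symmetric] e(2) by simp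
    finally show "y = 0" using 1 \<delta> by (simp add: vec2_eq)
  qed
  define U where "U = X 1 ^ h * X 2 ^ (k - h)"
  define V where "V = X 3 ^ k"
  have UV: "to_p3 (Var 1 ^ h * Var 2 ^ (k - h)) = U" "to_p3 (Var 3 ^ k) = V"
    by (simp_all add: to_p3_simps U_def V_def)
  have "hom (h + (k - h)) U" unfolding U_def
    by (rule hom_mult'[OF hom_power[OF hom_X(1)] hom_power[OF hom_X(1)]]) simp
  then have hU: "hom k (to_p3 (Var 1 ^ h * Var 2 ^ (k - h)))" unfolding UV using h by simp
  have hV: "hom k (to_p3 (Var 3 ^ k))" unfolding UV V_def using hom_power[OF hom_X(1)[of 3], of k] by simp
  have eq: "\<Psi> *v pair (to_p3 A) (to_p3 B) (P *v v) =
      pair (to_p3 (Var 1 ^ h * Var 2 ^ (k - h))) (to_p3 (Var 3 ^ k)) v" for v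
  proof -
    have AB: "ev (to_p3 A) (P *v v) = a1 * ev U v + a0 * ev V v" "ev (to_p3 B) (P *v v) = b1 * ev U v + b0 * ev V v"
      using arg_cong[OF AP, of "\<lambda>q. ev q v"] arg_cong[OF BP, of "\<lambda>q. ev q v"]
      by (simp_all add: U_def V_def evv_mv)
    have "b0 * (a1 * x + a0 * y) - a0 * (b1 * x + b0 * y) = \<delta> * x"
      "a1 * (b1 * x + b0 * y) - b1 * (a1 * x + a0 * y) = \<delta> * y" for x y
      by (simp_all add: \<delta>_def algebra_simps)
    then show ?thesis unfolding UV vec2_eq \<Psi>v pair_nth AB using \<delta> by simp
  qed
  have "binomial_coords k h A B (proj_map M) (proj_map \<Psi>)"
    unfolding binomial_coords_def
  proof (intro conjI)
    show "proj_map M \<in> PGL" unfolding PGL_def using M(1) by blast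
    show "proj_map \<Psi> \<in> PGL" unfolding PGL_def using i\<Psi> by blast
  qed (rule map_in_coordsI[OF pencil_hom(1,2)[OF pencil] hU hV M(1) P M(3,2) i\<Psi> eq])
  then show ?thesis unfolding binomial_pencil_def
    by - (rule exI[of _ h], rule exI[of _ "proj_map M"], rule exI[of _ "proj_map \<Psi>"], intro conjI h)
qed

theorem mainTheorem1:
  fixes f :: "3 proj \<Rightarrow> 3 proj" and A B :: "3 mpoly" and d k :: nat
  assumes "d > 1"
    and "endomorphism d f"
    and "pencil k A B"
    and "irreducible_pencil A B"
    and "maps_pencil_to_itself f A B"
  shows
    "(elementary_pencil k A B \<and>
      (\<exists>\<phi> \<psi>. elementary_coords A B \<phi> \<psi>) \<and>
      (\<forall>\<phi> \<psi>. elementary_coords A B \<phi> \<psi> \<longrightarrow>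
        (\<exists>P Q R. homogeneous d P \<and> homogeneous d Q \<and> homogeneous d R \<and>
           vars P \<subseteq> {1, 2} \<and> vars Q \<subseteq> {1, 2} \<and>
           endo_form d (vector [P, Q, R]) (in_coords \<phi> f))))
     \<or>
     (binomial_pencil k A B \<and>
      (\<forall>h \<phi> \<psi>. 0 < h \<longrightarrow> h < k \<longrightarrow> gcd h k = 1 \<longrightarrow> binomial_coords k h A B \<phi> \<psi> \<longrightarrow>
        (\<exists>\<sigma>\<in>PGL. maps_pencil_to_itself \<sigma> A B \<and>
          (\<exists>l c. k * l \<le> d \<and> (\<forall>i\<in>{1..l}. c i \<noteq> 0) \<and>
            (endo_form d (vector [Var 1 ^ d, Var 2 ^ d, binomial_R d k h l c])
               (in_coords \<phi> (\<sigma> \<circ> f \<circ> inv \<sigma>)) \<or>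
             endo_form d (vector [Var 2 ^ d, Var 1 ^ d, binomial_R d k h l c])
               (in_coords \<phi> (\<sigma> \<circ> f \<circ> inv \<sigma>)))))))"
proof -
  note ph = pencil_hom[OF assms(3)]
  have d0: "d > 0" using assms(1) by simp
  obtain F where F: "represents d F f"
    using endo_form_represents[OF _ d0] assms(2) unfolding endomorphism_def by blast
  then have nd: "nondeg d F" by (simp add: represents_def)
  have inv: "pencil_invariant (to_p3 A) (to_p3 B) F"
    using maps_pencil_invariant[OF ph(1-3) F assms(5)] .
  have fin: "finite {c. reducible (to_p3 A - c3 c * to_p3 B)}"
    using irreducible_pencil_finite_reducible[OF ph(1,2) assms(4)] .
  from pencil_classification[OF nd assms(1) ph(4,1-3) pencil_invariantD[OF inv] fin]
  show ?thesis
  proof (elim disjE exE conjE)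
    assume "k = 1"
    then show ?thesis
      using elementary_pencilI[OF assms(3)] elementary_coords_form[OF assms(3) d0 F inv] by blast
  next
    fix P h a1 a0 b1 b0
    assume *: "invertible P" "0 < h" "h < k" "gcd h k = 1"
      "cmp (to_p3 A) (mv P) = c3 a1 * (X 1 ^ h * X 2 ^ (k - h)) + c3 a0 * X 3 ^ k"
      "cmp (to_p3 B) (mv P) = c3 b1 * (X 1 ^ h * X 2 ^ (k - h)) + c3 b0 * X 3 ^ k"
    have "binomial_pencil k A B" using binomial_pencilI[OF assms(3) *] .
    then show ?thesis using binomial_normal_form[OF assms(3,1) F inv] by blast
  qed
qed

end
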